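(* Let $\mathcal{X}$ and $\mathcal{S}$ be finite sets, $X$ a random variable on $\mathcal{X}$ with $p_x=\Pr[X=x]$, $\mathcal{H}_B$ a finite-dimensional Hilbert space, and $\rho_{XB}=\sum_{x}p_x|x\rangle\langle x|\otimes\rho_x$ a classical-quantum state on $\mathcal{H}_X\otimes\mathcal{H}_B$ (where $\{|x\rangle\}$ is an orthonormal basis of $\mathcal{H}_X$ and $\rho_x$ are states on $\mathcal{H}_B$), with $\rho_B=\sum_x p_x\rho_x$. Let $\mathcal{G}$ be a two-universal family of functions $\mathcal{X}\to\mathcal{S}$ and $G$ a random variable, independent of $\rho_{XB}$, uniformly distributed over $\mathcal{G}$; let $S=G(X)$. Define $$\rho_{SGB}=\sum_{s\in\mathcal{S},g\in\mathcal{G}}p_{s|g}|s\rangle\langle s|\otimes\frac{1}{|\mathcal{G}|}|g\rangle\langle g|\otimes\rho_{s|g},\quad p_{s|g}=\sum_{x\in g^{-1}(s)}p_x,\quad \rho_{s|g}=\frac{1}{p_{s|g}}\sum_{x\in g^{-1}(s)}p_x\rho_x,$$ and $\sigma_{SGB}=\frac{1}{|\mathcal{S}|}\mathbb{I}_S\otimes\frac{1}{|\mathcal{G}|}\mathbb{I}_G\otimes\rho_B$. Then for every $\epsilon\ge 0$, $$D(\rho_{SGB}\,\|\,\sigma_{SGB})\le \epsilon\log_2(d|\mathcal{S}|)+\eta_0(\epsilon)+\frac{\delta+\epsilon+\epsilon^{1/2}}{\ln 2},$$ where $d=\mathrm{rank}\,\rho_B$, $\delta=|\mathcal{S}|\,2^{-R_\epsilon(X|B)_\rho}$,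 and $\eta_0(\epsilon)=-\epsilon\log_2\epsilon$ for $0\le\epsilon\le 1/2$, $\eta_0(\epsilon)=1/2$ for $\epsilon>1/2$.
   Context: A family $\mathcal{G}$ of functions $\mathcal{X}\to\mathcal{S}$ is two-universal if, for $G$ uniform on $\mathcal{G}$, $\Pr[G(x_0)=G(x_1)]\le 1/|\mathcal{S}|$ for all distinct $x_0,x_1\in\mathcal{X}$. The relative entropy is $D(A\|B)=\mathrm{Tr}[A(\log_2A-\log_2B)]$ (with $0\log_2 0=0$). For a Hermitian operator $Y=\sum_i\lambda_iE_i$, $\{Y\le0\}=\sum_{i:\lambda_i\le0}E_i$. For the state $\rho_{XB}$, with $\rho^{(2)}_B=\mathrm{Tr}_X[\rho_{XB}^2]$, the information spectrum collision entropy is $$R_\epsilon(X|B)_\rho=\sup\big\{\lambda:\mathrm{Tr}\big[\{\rho^{(2)}_B-2^{-\lambda}\rho_B^2\le0\}\rho_B\big]\ge1-\epsilon\big\}.$$ *)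

theory Defs
  imports "Jordan_Normal_Form.Jordan_Normal_Form" "Jordan_Normal_Form.Spectral_Radius"
    "Jordan_Normal_Form.DL_Rank" "HOL-Library.Extended_Real" "HOL-Library.FuncSet"
begin

text \<open>Finite-dimensional Hilbert spaces are modelled as C^n; operators as complex n x n matrices.\<close>

definition mtrace :: "complex mat \<Rightarrow> complex" where
  "mtrace A = (\<Sum>i<dim_row A. A $$ (i, i))"

definition hermitian :: "complex mat \<Rightarrow> bool" where
  "hermitian A \<longleftrightarrow> square_mat A \<and> mat_adjoint A = A"

definition psd :: "nat \<Rightarrow> complex mat \<Rightarrow> bool" where
  "psd n A \<longleftrightarrow> A \<in> carrier_mat n n \<and> hermitian A \<and>
     (\<forall>v \<in> carrier_vec n. 0 \<le> Re ((A *\<^sub>v v) \<bullet>c v))"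

definition density :: "nat \<Rightarrow> complex mat \<Rightarrow> bool" where
  "density n A \<longleftrightarrow> psd n A \<and> mtrace A = 1"

definition msum :: "nat \<Rightarrow> 'b list \<Rightarrow> ('b \<Rightarrow> complex mat) \<Rightarrow> complex mat" where
  "msum n xs f = foldr (\<lambda>x M. f x + M) xs (0\<^sub>m n n)"

definition mprod :: "nat \<Rightarrow> 'b list \<Rightarrow> ('b \<Rightarrow> complex mat) \<Rightarrow> complex mat" where
  "mprod n xs f = foldr (\<lambda>x M. f x * M) xs (1\<^sub>m n)"

text \<open>Real eigenvalues (for a Hermitian matrix: all eigenvalues).\<close>
definition rspec :: "complex mat \<Rightarrow> real set" where
  "rspec A = {r. eigenvalue A (complex_of_real r)}"

text \<open>Spectral projection E_r of a Hermitian matrix onto its eigenvalue r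
  (Lagrange interpolation form: product over the other eigenvalues mu of (A - mu I)/(r - mu)).\<close>
definition eigproj :: "complex mat \<Rightarrow> real \<Rightarrow> complex mat" where
  "eigproj A r = mprod (dim_row A) [\<mu> \<leftarrow> sorted_list_of_set (rspec A). \<mu> \<noteq> r]
      (\<lambda>\<mu>. complex_of_real (1 / (r - \<mu>)) \<cdot>\<^sub>m (A - complex_of_real \<mu> \<cdot>\<^sub>m 1\<^sub>m (dim_row A)))"

definition mfun :: "(real \<Rightarrow> real) \<Rightarrow> complex mat \<Rightarrow> complex mat" where
  "mfun f A = msum (dim_row A) (sorted_list_of_set (rspec A))
      (\<lambda>r. complex_of_real (f r) \<cdot>\<^sub>m eigproj A r)"

text \<open>log_2 of a positive semidefinite matrix, with the convention 0 log 0 = 0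
  (the logarithm is taken on the support).\<close>
definition mlog2 :: "complex mat \<Rightarrow> complex mat" where
  "mlog2 A = mfun (\<lambda>r. if r = 0 then 0 else log 2 r) A"

definition nonpos_proj :: "complex mat \<Rightarrow> complex mat" where
  "nonpos_proj Y = mfun (\<lambda>r. if r \<le> 0 then 1 else 0) Y"

text \<open>Relative entropy D(A||B) = Tr[A(log2 A - log2 B)], infinite when supp A is not contained in supp B.\<close>
definition rel_entropy :: "complex mat \<Rightarrow> complex mat \<Rightarrow> ereal" where
  "rel_entropy A B =
     (if \<forall>v \<in> carrier_vec (dim_row B). B *\<^sub>v v = 0\<^sub>v (dim_row B) \<longrightarrow> A *\<^sub>v v = 0\<^sub>v (dim_row A)
      then ereal (Re (mtrace (A * (mlog2 A - mlog2 B)))) else \<infinity>)"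

definition kron :: "complex mat \<Rightarrow> complex mat \<Rightarrow> complex mat" where
  "kron A B = mat (dim_row A * dim_row B) (dim_col A * dim_col B)
     (\<lambda>(i, j). A $$ (i div dim_row B, j div dim_col B) * B $$ (i mod dim_row B, j mod dim_col B))"

definition ketbra :: "nat \<Rightarrow> nat \<Rightarrow> complex mat" where
  "ketbra m i = mat m m (\<lambda>(a, b). if a = i \<and> b = i then 1 else 0)"

definition ptrace1 :: "nat \<Rightarrow> nat \<Rightarrow> complex mat \<Rightarrow> complex mat" where
  "ptrace1 m n M = mat n n (\<lambda>(i, j). \<Sum>k<m. M $$ (k * n + i, k * n + j))"

text \<open>Two-universality of a family (given as a list of distinct functions, G uniform on it)
  of functions X = {0..<nX} -> S = {0..<nS}.\<close>
definition two_universal :: "nat \<Rightarrow> nat \<Rightarrow> (nat \<Rightarrow> nat) list \<Rightarrow> bool" where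
  "two_universal nX nS Gs \<longleftrightarrow>
     (\<forall>x0<nX. \<forall>x1<nX. x0 \<noteq> x1 \<longrightarrow>
        real (card {g \<in> set Gs. g x0 = g x1}) / real (card (set Gs)) \<le> 1 / real nS)"

definition R_coll :: "real \<Rightarrow> complex mat \<Rightarrow> complex mat \<Rightarrow> ereal" where
  "R_coll eps rho2 rhoB = Sup {ereal lam | lam.
     Re (mtrace (nonpos_proj (rho2 - complex_of_real (2 powr (- lam)) \<cdot>\<^sub>m (rhoB * rhoB)) * rhoB))
       \<ge> 1 - eps}"

definition eta0 :: "real \<Rightarrow> real" where
  "eta0 eps = (if eps \<le> 1/2 then - eps * log 2 eps else 1/2)"

end

theory Submission
  imports Defs "HOL-Real_Asymp.Real_Asymp"
begin

text \<open>
  For positive \<open>w\<close> and \<open>\<kappa>\<close> one has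
  \<open>Tr w (ln w - ln \<kappa>) \<le> Tr (w \<kappa>\<^sup>-\<^sup>1\<^sup>/\<^sup>2 w \<kappa>\<^sup>-\<^sup>1\<^sup>/\<^sup>2) - Tr w\<close>: integrate the operator convexity of the
  inverse, \<open>(A\<^sup>-\<^sup>1 - B\<^sup>-\<^sup>1) A (A\<^sup>-\<^sup>1 - B\<^sup>-\<^sup>1) \<ge> 0\<close> with \<open>A = w + t\<close>, \<open>B = \<kappa> + t\<close>, over \<open>t\<close> and bound the
  logarithmic mean below by the geometric mean. Let \<open>P\<close> be the spectral projection in the definition
  of the collision entropy, \<open>Q = 1 - P\<close>, \<open>\<epsilon>' = Tr Q \<rho>\<^sub>B \<le> \<epsilon>\<close> and \<open>\<pi> = P \<rho>\<^sub>B P + Q \<rho>\<^sub>B Q\<close>. The inequality is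
  applied to every hashed block \<open>w\<close> with \<open>\<kappa> = ((1 + t)/|S| P + (1 + 1/t) Q) \<pi>\<close>. As
  \<open>w \<le> (1 + t) P w P + (1 + 1/t) Q w Q\<close>, the quadratic term splits into a \<open>Q\<close>-part, which sums to at
  most \<open>\<epsilon>'\<close>, and a \<open>P\<close>-part, where two-universality and the Schur complement bound give
  \<open>1 - \<epsilon>' + |S| 2\<^sup>-\<^sup>\<lambda>\<close>. Klein's inequality replaces \<open>ln \<pi>\<close> by \<open>ln \<rho>\<^sub>B\<close>. Altogether
  \<open>D ln 2 \<le> \<epsilon>' ln |S| + (1 - \<epsilon>') ln (1 + t) + \<epsilon>' ln (1 + 1/t) + |S| 2\<^sup>-\<^sup>\<lambda>\<close>, and \<open>t = \<epsilon>'\<close> gives the claim.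
\<close>

section \<open>Finitely supported matrices\<close>

text \<open>The spectral projection P need not commute with rho_B, so different weights on P and Q
  cannot be attached to rho_B itself. The pinched operator commutes with both, and ln kappa is then
  ln pi plus one scalar on each of P and Q. The weights in kappa are those that cancel the factors
  of the splitting: 1 + t against (1 + t)/|S| leaves |S|, and 1 + 1/t against itself leaves 1. The
  quadratic terms therefore sum to at most (1 - eps') + |S| 2^(-\<lambda>) + eps', while the terms
  -Tr w sum to -1, so that besides |S| 2^(-\<lambda>) only the logarithms of the weights survive.
  The quadratic form has one root of the inverse of kappa on either side of w because it then
  expands over pairs of inputs into nonnegative terms, as two-universality requires; the cross terms
  of Tr (w^2 kappa^(-1)) need not be nonnegative. On equal pairs, however, the collision entropy
  controls the squares of the weighted states and not this form. Positivity of the squared norm of a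
  commutator passes from the one to the other.\<close>

text \<open>
  Infinite matrices with finite support form a real algebra as a type, so that operators of all
  dimensions can be manipulated without carrier conditions; the identity of dimension \<open>n\<close> is the
  element \<open>unit n\<close>. The functional \<open>tr\<close> is the real part of the trace.
\<close>

typedef fmat = "{f :: nat \<Rightarrow> nat \<Rightarrow> complex. \<exists>N. \<forall>i j. N \<le> i \<or> N \<le> j \<longrightarrow> f i j = 0}"
  morphisms entry Fmat
  by (rule exI[of _ "\<lambda>_ _. 0"]) simp

setup_lifting type_definition_fmat

lift_definition bounded_by :: "nat \<Rightarrow> fmat \<Rightarrow> bool" is
  "\<lambda>N f. \<forall>i j. N \<le> i \<or> N \<le> j \<longrightarrow> f i j = 0" .

lemma fmat_eqI: "(\<And>i j. entry x i j = entry y i j) \<Longrightarrow> x = y"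
  by (simp add: entry_inject[symmetric] ext)

lemma bounded_byD: "bounded_by N x \<Longrightarrow> N \<le> i \<or> N \<le> j \<Longrightarrow> entry x i j = 0"
  by transfer blast

lemma bounded_by_entry: "bounded_by N x \<longleftrightarrow> (\<forall>i j. N \<le> i \<or> N \<le> j \<longrightarrow> entry x i j = 0)"
  by transfer simp

lemma bounded_by_ex: "\<exists>N. bounded_by N x"
  by transfer simp

lemma bounded_by_mono: "bounded_by N x \<Longrightarrow> N \<le> M \<Longrightarrow> bounded_by M x"
  by (auto simp: bounded_by_entry)

lemma bounded_by_ex2: "\<exists>N. bounded_by N x \<and> bounded_by N y"
  by (meson bounded_by_ex bounded_by_mono nat_le_linear)

lemma bounded_by_ex_ge: "\<exists>N\<ge>M. bounded_by N x"
  by (meson bounded_by_ex bounded_by_mono nat_le_linear)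

instantiation fmat :: real_algebra
begin

lift_definition zero_fmat :: fmat is "\<lambda>_ _. 0" by auto

lift_definition plus_fmat :: "fmat \<Rightarrow> fmat \<Rightarrow> fmat" is "\<lambda>f g i j. f i j + g i j"
proof -
  fix f g :: "nat \<Rightarrow> nat \<Rightarrow> complex"
  assume "\<exists>N. \<forall>i j. N \<le> i \<or> N \<le> j \<longrightarrow> f i j = 0" "\<exists>N. \<forall>i j. N \<le> i \<or> N \<le> j \<longrightarrow> g i j = 0"
  then obtain N M where "\<forall>i j. N \<le> i \<or> N \<le> j \<longrightarrow> f i j = 0" "\<forall>i j. M \<le> i \<or> M \<le> j \<longrightarrow> g i j = 0"
    by blast
  then show "\<exists>N. \<forall>i j. N \<le> i \<or> N \<le> j \<longrightarrow> f i j + g i j = 0"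
    by (intro exI[of _ "max N M"]) auto
qed

lift_definition uminus_fmat :: "fmat \<Rightarrow> fmat" is "\<lambda>f i j. - f i j" by auto

definition minus_fmat :: "fmat \<Rightarrow> fmat \<Rightarrow> fmat" where "minus_fmat x y = x + - y"

lift_definition scaleR_fmat :: "real \<Rightarrow> fmat \<Rightarrow> fmat" is "\<lambda>r f i j. complex_of_real r * f i j"
  by auto

text \<open>Summing over the support of row \<open>i\<close> of the left factor keeps the sum finite
  without choosing a dimension. A bound on either factor then gives an equivalent sum over an
  initial segment.\<close>

lift_definition times_fmat :: "fmat \<Rightarrow> fmat \<Rightarrow> fmat" is
  "\<lambda>f g i j. \<Sum>k | f i k \<noteq> 0. f i k * g k j"
proof -
  fix f g :: "nat \<Rightarrow> nat \<Rightarrow> complex"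
  assume "\<exists>N. \<forall>i j. N \<le> i \<or> N \<le> j \<longrightarrow> f i j = 0" "\<exists>N. \<forall>i j. N \<le> i \<or> N \<le> j \<longrightarrow> g i j = 0"
  then obtain N M where "\<forall>i j. N \<le> i \<or> N \<le> j \<longrightarrow> f i j = 0" "\<forall>i j. M \<le> i \<or> M \<le> j \<longrightarrow> g i j = 0"
    by blast
  then show "\<exists>N. \<forall>i j. N \<le> i \<or> N \<le> j \<longrightarrow> (\<Sum>k | f i k \<noteq> 0. f i k * g k j) = 0"
    by (intro exI[of _ "max N M"]) auto
qed

lemma entry_plus: "entry (x + y) i j = entry x i j + entry y i j" by transfer simp
lemma entry_uminus: "entry (- x) i j = - entry x i j" by transfer simp
lemma entry_minus: "entry (x - y) i j = entry x i j - entry y i j"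
  by (simp add: minus_fmat_def entry_plus entry_uminus)
lemma entry_zero: "entry 0 i j = 0" by transfer simp
lemma entry_scaleR: "entry (r *\<^sub>R x) i j = complex_of_real r * entry x i j" by transfer simp

lemma entry_mult_left:
  assumes "bounded_by N x" shows "entry (x * y) i j = (\<Sum>k<N. entry x i k * entry y k j)"
proof -
  have "entry (x * y) i j = (\<Sum>k | entry x i k \<noteq> 0. entry x i k * entry y k j)" by transfer simp
  also have "\<dots> = (\<Sum>k<N. entry x i k * entry y k j)"
    by (rule sum.mono_neutral_left) (use bounded_byD[OF assms] in \<open>auto simp: not_le[symmetric]\<close>)
  finally show ?thesis .
qed

lemma entry_mult_right:
  assumes "bounded_by N y" shows "entry (x * y) i j = (\<Sum>k<N. entry x i k * entry y k j)"
proof -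
  obtain M where M: "M \<ge> N" "bounded_by M x" using bounded_by_ex_ge by blast
  have "(\<Sum>k<M. entry x i k * entry y k j) = (\<Sum>k<N. entry x i k * entry y k j)"
    by (rule sum.mono_neutral_right) (use bounded_byD[OF assms] M in auto)
  then show ?thesis using entry_mult_left[OF M(2)] by simp
qed

instance
proof
  fix a b c :: fmat and r s :: real
  show "a * b * c = a * (b * c)"
  proof (rule fmat_eqI)
    fix i j
    obtain N where N: "bounded_by N a" using bounded_by_ex by blast
    obtain M where M: "bounded_by M c" using bounded_by_ex by blast
    show "entry (a * b * c) i j = entry (a * (b * c)) i j"
      unfolding entry_mult_right[OF M] entry_mult_left[OF N]
      by (simp add: sum_distrib_left sum_distrib_right mult.assoc) (rule sum.swap)
  qed
  show "(a + b) * c = a * c + b * c"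
  proof (rule fmat_eqI)
    fix i j
    obtain M where M: "bounded_by M c" using bounded_by_ex by blast
    show "entry ((a + b) * c) i j = entry (a * c + b * c) i j"
      by (simp add: entry_mult_right[OF M] entry_plus algebra_simps sum.distrib)
  qed
  show "a * (b + c) = a * b + a * c"
  proof (rule fmat_eqI)
    fix i j
    obtain M where M: "bounded_by M a" using bounded_by_ex by blast
    show "entry (a * (b + c)) i j = entry (a * b + a * c) i j"
      by (simp add: entry_mult_left[OF M] entry_plus algebra_simps sum.distrib)
  qed
  show "(r *\<^sub>R a) * b = r *\<^sub>R (a * b)"
  proof (rule fmat_eqI)
    fix i j
    obtain M where M: "bounded_by M b" using bounded_by_ex by blast
    show "entry ((r *\<^sub>R a) * b) i j = entry (r *\<^sub>R (a * b)) i j"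
      by (simp add: entry_mult_right[OF M] entry_scaleR sum_distrib_left mult.assoc)
  qed
  show "a * (r *\<^sub>R b) = r *\<^sub>R (a * b)"
  proof (rule fmat_eqI)
    fix i j
    obtain M where M: "bounded_by M a" using bounded_by_ex by blast
    show "entry (a * (r *\<^sub>R b)) i j = entry (r *\<^sub>R (a * b)) i j"
      by (simp add: entry_mult_left[OF M] entry_scaleR sum_distrib_left mult.left_commute)
  qed
qed (auto intro!: fmat_eqI simp: entry_plus entry_uminus entry_minus entry_zero entry_scaleR algebra_simps)

end

lemmas entry_simps = entry_plus entry_uminus entry_minus entry_zero entry_scaleR

lemma entry_sum: "entry (sum f A) i j = (\<Sum>a\<in>A. entry (f a) i j)"
  by (induction A rule: infinite_finite_induct) (simp_all add: entry_simps)

lift_definition star :: "fmat \<Rightarrow> fmat" is "\<lambda>f i j. cnj (f j i)" by auto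

text \<open>The type class provides real scalars only. Complex ones are needed until the eigenvalues
  of a hermitian matrix are known to be real.\<close>

lift_definition cscale :: "complex \<Rightarrow> fmat \<Rightarrow> fmat" is "\<lambda>c f i j. c * f i j" by auto

lift_definition unit :: "nat \<Rightarrow> fmat" is "\<lambda>n i j. if i = j \<and> i < n then 1 else 0"
  using not_le by auto

definition tr :: "fmat \<Rightarrow> real" where
  "tr x = Re (\<Sum>i | entry x i i \<noteq> 0. entry x i i)"

lemma entry_star: "entry (star x) i j = cnj (entry x j i)" by transfer simp
lemma entry_cscale: "entry (cscale c x) i j = c * entry x i j" by transfer simp
lemma entry_unit: "entry (unit n) i j = (if i = j \<and> i < n then 1 else 0)" by transfer simp

lemma bounded_by_unit: "bounded_by n (unit n)"
  by (auto simp: bounded_by_entry entry_unit)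

lemma unit_mult_left [simp]:
  assumes "bounded_by n x" shows "unit n * x = x"
proof (rule fmat_eqI)
  fix i j
  have "entry (unit n * x) i j = (\<Sum>k<n. if k = i then entry x i j else 0)"
    unfolding entry_mult_left[OF bounded_by_unit] by (rule sum.cong) (auto simp: entry_unit)
  then show "entry (unit n * x) i j = entry x i j" using bounded_byD[OF assms, of i j] by auto
qed

lemma unit_mult_right [simp]:
  assumes "bounded_by n x" shows "x * unit n = x"
proof (rule fmat_eqI)
  fix i j
  have "entry (x * unit n) i j = (\<Sum>k<n. if k = j then entry x i j else 0)"
    unfolding entry_mult_right[OF bounded_by_unit] by (rule sum.cong) (auto simp: entry_unit)
  then show "entry (x * unit n) i j = entry x i j" using bounded_byD[OF assms, of i j] by auto
qed

text \<open>This turns a statement about the support into an algebraic one: bounds for products and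
  for the members of a resolution then follow from associativity and \<open>star\<close>.\<close>

lemma bounded_by_unit_iff: "bounded_by n x \<longleftrightarrow> unit n * x = x \<and> x * unit n = x"
proof
  assume h: "unit n * x = x \<and> x * unit n = x"
  show "bounded_by n x"
    unfolding bounded_by_entry
  proof (intro allI impI)
    fix i j assume "n \<le> i \<or> n \<le> j"
    then show "entry x i j = 0"
    proof
      assume "n \<le> i"
      then have "entry (unit n * x) i j = 0" by (simp add: entry_mult_left[OF bounded_by_unit] entry_unit)
      then show ?thesis using h by simp
    next
      assume "n \<le> j"
      then have "entry (x * unit n) i j = 0" by (simp add: entry_mult_right[OF bounded_by_unit] entry_unit)
      then show ?thesis using h by simp
    qed
  qed
qed simp

lemma star_star [simp]: "star (star x) = x" by (rule fmat_eqI) (simp add: entry_star)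
lemma star_0 [simp]: "star 0 = 0" by (rule fmat_eqI) (simp add: entry_star entry_simps)
lemma star_add [simp]: "star (x + y) = star x + star y" by (rule fmat_eqI) (simp add: entry_star entry_simps)
lemma star_diff [simp]: "star (x - y) = star x - star y" by (rule fmat_eqI) (simp add: entry_star entry_simps)
lemma star_scaleR [simp]: "star (r *\<^sub>R x) = r *\<^sub>R star x" by (rule fmat_eqI) (simp add: entry_star entry_simps)
lemma star_unit [simp]: "star (unit n) = unit n" by (rule fmat_eqI) (simp add: entry_star entry_unit)
lemma star_sum [simp]: "star (sum f A) = (\<Sum>a\<in>A. star (f a))"
  by (induction A rule: infinite_finite_induct) simp_all
lemma bounded_by_star [simp]: "bounded_by n (star x) \<longleftrightarrow> bounded_by n x"
  by (auto simp: bounded_by_entry entry_star)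

lemma star_mult [simp]: "star (x * y) = star y * star x"
proof (rule fmat_eqI)
  fix i j
  obtain N where N: "bounded_by N x" using bounded_by_ex by blast
  then have N': "bounded_by N (star x)" by simp
  show "entry (star (x * y)) i j = entry (star y * star x) i j"
    by (simp add: entry_star entry_mult_left[OF N] entry_mult_right[OF N'] mult.commute)
qed

lemma tr_eq: assumes "bounded_by N x" shows "tr x = (\<Sum>i<N. Re (entry x i i))"
proof -
  have "(\<Sum>i | entry x i i \<noteq> 0. entry x i i) = (\<Sum>i<N. entry x i i)"
    by (rule sum.mono_neutral_left) (use bounded_byD[OF assms] in \<open>auto simp: not_le[symmetric]\<close>)
  then show ?thesis by (simp add: tr_def)
qed

lemma tr_0 [simp]: "tr 0 = 0" by (simp add: tr_def entry_simps)

lemma tr_add [simp]: "tr (x + y) = tr x + tr y"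
proof -
  obtain N where N: "bounded_by N x" "bounded_by N y" using bounded_by_ex2 by blast
  then have "bounded_by N (x + y)" by (auto simp: bounded_by_entry entry_simps)
  then show ?thesis by (simp add: tr_eq[OF N(1)] tr_eq[OF N(2)] tr_eq entry_simps sum.distrib)
qed

lemma tr_scaleR [simp]: "tr (r *\<^sub>R x) = r * tr x"
proof -
  obtain N where N: "bounded_by N x" using bounded_by_ex by blast
  then have "bounded_by N (r *\<^sub>R x)" by (auto simp: bounded_by_entry entry_simps)
  then show ?thesis by (simp add: tr_eq[OF N] tr_eq entry_simps sum_distrib_left)
qed

lemma tr_diff [simp]: "tr (x - y) = tr x - tr y"
  using tr_add[of x "(-1) *\<^sub>R y"] tr_scaleR[of "-1" y] by simp

lemma tr_sum [simp]: "tr (sum f A) = (\<Sum>a\<in>A. tr (f a))"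
  by (induction A rule: infinite_finite_induct) simp_all

lemma bounded_by_mult: "bounded_by N x \<Longrightarrow> bounded_by N y \<Longrightarrow> bounded_by N (x * y)"
  unfolding bounded_by_unit_iff by (metis mult.assoc)

lemma tr_commute: "tr (x * y) = tr (y * x)"
proof -
  obtain N where N: "bounded_by N x" "bounded_by N y" using bounded_by_ex2 by blast
  show ?thesis
    by (simp add: tr_eq[OF bounded_by_mult[OF N]] tr_eq[OF bounded_by_mult[OF N(2) N(1)]]
        entry_mult_left[OF N(1)] entry_mult_left[OF N(2)])
      (subst sum.swap, simp add: mult.commute)
qed

lemma tr_star_mult_eq:
  assumes "bounded_by N x"
  shows "tr (star x * x) = (\<Sum>i<N. \<Sum>k<N. (cmod (entry x k i))\<^sup>2)"
proof -
  have *: "bounded_by N (star x)" using assms by simp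
  have "Re (cnj z * z) = (cmod z)\<^sup>2" for z
    by (metis Re_complex_of_real complex_norm_square mult.commute)
  then show ?thesis
    by (simp add: tr_eq[OF bounded_by_mult[OF * assms]] entry_mult_left[OF *] entry_star
          del: times_complex.sel)
qed

lemma tr_star_mult_nonneg: "0 \<le> tr (star x * x)"
  using bounded_by_ex[of x] by (auto simp: tr_star_mult_eq intro!: sum_nonneg)

text \<open>Definiteness of the Hilbert-Schmidt form. It replaces vector norms: in what follows a
  matrix plays the part of a tuple of vectors, its columns.\<close>

lemma tr_star_mult_eq_0: "tr (star x * x) = 0 \<longleftrightarrow> x = 0"
proof
  assume h: "tr (star x * x) = 0"
  obtain N where N: "bounded_by N x" using bounded_by_ex by blast
  have "(\<Sum>i<N. \<Sum>k<N. (cmod (entry x k i))\<^sup>2) = 0" using h tr_star_mult_eq[OF N] by simp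
  then have "entry x k i = 0" if "i < N" "k < N" for i k
    using that by (auto simp: sum_nonneg_eq_0_iff sum_nonneg)
  then show "x = 0" using bounded_byD[OF N] by (intro fmat_eqI) (metis entry_zero not_le)
qed simp

lemma star_mult_eq_0: "star x * x = 0 \<longleftrightarrow> x = 0"
  using tr_star_mult_eq_0[of x] by auto

section \<open>Embedding and the spectral theorem\<close>

lift_definition emb :: "complex mat \<Rightarrow> fmat" is
  "\<lambda>A i j. if i < dim_row A \<and> j < dim_col A then A $$ (i, j) else 0"
proof -
  fix A :: "complex mat"
  show "\<exists>N. \<forall>i j. N \<le> i \<or> N \<le> j \<longrightarrow> (if i < dim_row A \<and> j < dim_col A then A $$ (i, j) else 0) = 0"
    by (rule exI[of _ "max (dim_row A) (dim_col A)"]) auto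
qed

lemma entry_emb: "entry (emb A) i j = (if i < dim_row A \<and> j < dim_col A then A $$ (i, j) else 0)"
  by (simp add: emb.rep_eq)

lemma bounded_by_emb: "A \<in> carrier_mat n n \<Longrightarrow> bounded_by n (emb A)"
  by (auto simp: bounded_by_entry entry_emb)

lemma emb_mult:
  assumes "dim_col A = dim_row B" shows "emb (A * B) = emb A * emb B"
proof (rule fmat_eqI)
  fix i j
  obtain N where N: "N \<ge> dim_row B" "bounded_by N (emb A)" using bounded_by_ex_ge by blast
  have "entry (emb A * emb B) i j = (\<Sum>k<dim_row B. entry (emb A) i k * entry (emb B) k j)"
    unfolding entry_mult_left[OF N(2)]
    by (rule sum.mono_neutral_right) (use N in \<open>auto simp: entry_emb\<close>)
  also have "\<dots> = entry (emb (A * B)) i j"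
    using assms by (auto simp: entry_emb scalar_prod_def lessThan_atLeast0 intro!: sum.cong)
  finally show "entry (emb (A * B)) i j = entry (emb A * emb B) i j" by simp
qed

lemma emb_add: "dim_row A = dim_row B \<Longrightarrow> dim_col A = dim_col B \<Longrightarrow> emb (A + B) = emb A + emb B"
  by (rule fmat_eqI) (simp add: entry_emb entry_simps)

lemma emb_minus: "dim_row A = dim_row B \<Longrightarrow> dim_col A = dim_col B \<Longrightarrow> emb (A - B) = emb A - emb B"
  by (rule fmat_eqI) (simp add: entry_emb entry_simps)

lemma emb_smult: "emb (complex_of_real c \<cdot>\<^sub>m A) = c *\<^sub>R emb A"
  by (rule fmat_eqI) (simp add: entry_emb entry_simps)

lemma emb_one: "emb (1\<^sub>m n) = unit n"
  by (rule fmat_eqI) (simp add: entry_emb entry_unit)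

lemma emb_zero: "emb (0\<^sub>m m n) = 0"
  by (rule fmat_eqI) (simp add: entry_emb entry_simps)

lemma emb_adjoint: "emb (mat_adjoint A) = star (emb A)"
  by (rule fmat_eqI) (auto simp: entry_emb entry_star mat_adjoint_def mat_of_rows_index)

lemma tr_emb: "A \<in> carrier_mat n n \<Longrightarrow> tr (emb A) = Re (mtrace A)"
  by (simp add: tr_eq[OF bounded_by_emb] mtrace_def entry_emb)

definition mat_of_fmat :: "nat \<Rightarrow> nat \<Rightarrow> fmat \<Rightarrow> complex mat" where
  "mat_of_fmat m n x = mat m n (\<lambda>(i, j). entry x i j)"

lemma emb_mat_of_fmat: "bounded_by n x \<Longrightarrow> emb (mat_of_fmat n n x) = x"
  by (rule fmat_eqI) (auto simp: mat_of_fmat_def entry_emb bounded_by_entry)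

lemma emb_msum:
  "(\<And>x. x \<in> set xs \<Longrightarrow> f x \<in> carrier_mat n n) \<Longrightarrow>
    msum n xs f \<in> carrier_mat n n \<and> emb (msum n xs f) = (\<Sum>x\<leftarrow>xs. emb (f x))"
proof (induction xs)
  case (Cons a xs)
  then have "f a \<in> carrier_mat n n" "msum n xs f \<in> carrier_mat n n"
    "emb (msum n xs f) = (\<Sum>x\<leftarrow>xs. emb (f x))" by auto
  moreover have "msum n (a # xs) f = f a + msum n xs f" by (simp add: msum_def)
  ultimately show ?case by (simp add: emb_add)
qed (simp add: msum_def emb_zero)

section \<open>Annihilating polynomials and eigenvector expansions\<close>

lemma cscale_diff: "cscale c (x - y) = cscale c x - cscale c y"
  by (rule fmat_eqI) (simp add: entry_cscale entry_simps algebra_simps)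

lemma cscale_0 [simp]: "cscale c 0 = 0"
  by (rule fmat_eqI) (simp add: entry_cscale entry_simps)

lemma cscale_sum: "cscale c (sum f A) = (\<Sum>a\<in>A. cscale c (f a))"
  by (rule fmat_eqI) (simp add: entry_cscale entry_sum sum_distrib_left)

lemma cscale_cscale: "cscale c (cscale d x) = cscale (c * d) x"
  by (rule fmat_eqI) (simp add: entry_cscale)

lemma cscale_scaleR: "cscale c (r *\<^sub>R x) = r *\<^sub>R cscale c x"
  by (rule fmat_eqI) (simp add: entry_cscale entry_simps)

lemma cscale_1: "cscale 1 x = x"
  by (rule fmat_eqI) (simp add: entry_cscale)

lemma cscale_of_real: "cscale (complex_of_real r) x = r *\<^sub>R x"
  by (rule fmat_eqI) (simp add: entry_cscale entry_simps)

lemma cscale_mult_right: "x * cscale c y = cscale c (x * y)"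
proof (rule fmat_eqI)
  fix i j
  obtain N where N: "bounded_by N x" using bounded_by_ex by blast
  show "entry (x * cscale c y) i j = entry (cscale c (x * y)) i j"
    by (simp add: entry_mult_left[OF N] entry_cscale sum_distrib_left mult.left_commute)
qed

lemma star_cscale: "star (cscale c x) = cscale (cnj c) (star x)"
  by (rule fmat_eqI) (simp add: entry_cscale entry_star)

lemma cscale_eq_0: "cscale c x = 0 \<Longrightarrow> c \<noteq> 0 \<Longrightarrow> x = 0"
  by (metis cscale_0 cscale_cscale cscale_of_real left_inverse of_real_1 scaleR_one)

lemma cscale_minus_left: "cscale (c - d) x = cscale c x - cscale d x"
  by (rule fmat_eqI) (simp add: entry_cscale entry_simps algebra_simps)

text \<open>Left multiplication by \<open>a - c\<close>, written as an operation on \<open>x\<close>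
  because the algebra has no identity element.\<close>

definition shift :: "fmat \<Rightarrow> complex \<Rightarrow> fmat \<Rightarrow> fmat" where
  "shift a c x = a * x - cscale c x"

lemma shift_0 [simp]: "shift a c 0 = 0" by (simp add: shift_def)

lemma shift_cscale: "shift a c (cscale d x) = cscale d (shift a c x)"
  by (simp add: shift_def cscale_diff cscale_cscale cscale_mult_right mult.commute)

lemma shift_diff: "shift a c (x - y) = shift a c x - shift a c y"
  by (simp add: shift_def cscale_diff algebra_simps)

lemma shift_sum: "shift a c (sum f A) = (\<Sum>i\<in>A. shift a c (f i))"
  by (simp add: shift_def cscale_sum sum_distrib_left sum_subtractf)

text \<open>In a row \<open>i \<ge> k\<close> of \<open>t * x\<close> the summands with
  \<open>l < i\<close> vanish by triangularity and those with \<open>l > k\<close> by the support of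
  \<open>x\<close>. For \<open>i = k\<close> the remaining one is cancelled by the shift, for
  \<open>i > k\<close> none remains. So one factor clears the last nonzero row.\<close>

lemma shift_triangular:
  assumes T: "bounded_by n t" "\<And>i j. j < i \<Longrightarrow> entry t i j = 0"
    and x: "\<And>i j. Suc k \<le> i \<Longrightarrow> entry x i j = 0"
    and i: "k \<le> i"
  shows "entry (shift t (entry t k k) x) i j = 0"
proof -
  have "entry t i l * entry x l j = (if l = k then entry t i k * entry x k j else 0)" for l
  proof (cases "l = k")
    case False
    then consider "l < i" | "Suc k \<le> l" using i by linarith
    then show ?thesis by cases (use False T x in auto)
  qed simp
  then have "entry (t * x) i j = (\<Sum>l<n. if l = k then entry t i k * entry x k j else 0)"
    unfolding entry_mult_left[OF T(1)] by (rule sum.cong[OF refl])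
  also have "\<dots> = entry t i k * entry x k j" using bounded_byD[OF T(1), of i k] by auto
  finally have "entry (t * x) i j = entry t i k * entry x k j" .
  moreover have "entry t i k * entry x k j = entry t k k * entry x i j"
    by (cases "i = k") (use i T x in auto)
  ultimately show ?thesis by (simp add: shift_def entry_simps entry_cscale)
qed

text \<open>Cayley-Hamilton for triangular matrices: \<open>foldr\<close> applies the last diagonal
  entry first, so the rows are cleared from the bottom upwards.\<close>

lemma shift_triangular_annihilates:
  assumes T: "bounded_by n t" "\<And>i j. j < i \<Longrightarrow> entry t i j = 0"
    and x: "\<And>i j. k \<le> i \<Longrightarrow> entry x i j = 0"
  shows "foldr (shift t) (map (\<lambda>k. entry t k k) [0..<k]) x = 0"
  using x
proof (induction k arbitrary: x)
  case 0
  then show ?case by (auto intro!: fmat_eqI simp: entry_simps)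
next
  case (Suc k)
  then show ?case using shift_triangular[OF T] by simp
qed

lemma shift_annihilates_unit:
  assumes "bounded_by n a"
  shows "\<exists>L. foldr (shift a) L (unit n) = 0"
proof -
  define A where "A = mat_of_fmat n n a"
  have A: "A \<in> carrier_mat n n" by (simp add: A_def mat_of_fmat_def)
  obtain es where "char_poly A = (\<Prod>e\<leftarrow>es. [:- e, 1:])" using char_poly_factorized[OF A] by blast
  from schur_decomposition_exists[OF A this] obtain B P Q where
    B: "B \<in> carrier_mat n n" "upper_triangular B" and "similar_mat_wit A B P Q"
    unfolding similar_mat_def by blast
  from similar_mat_witD2[OF A this(3)] have PQ: "P * Q = 1\<^sub>m n" "A = P * B * Q" "Q * P = 1\<^sub>m n"
    "P \<in> carrier_mat n n" "Q \<in> carrier_mat n n" by auto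
  define t where "t = emb B"
  have t: "bounded_by n t" using B by (simp add: t_def bounded_by_emb)
  have tri: "entry t i j = 0" if "j < i" for i j
    using B that by (auto simp: t_def entry_emb)
  have a: "a = emb P * t * emb Q"
    using emb_mat_of_fmat[OF assms] PQ B by (simp add: A_def[symmetric] emb_mult t_def mult.assoc)
  have u: "emb P * emb Q = unit n" "emb Q * emb P = unit n"
    using PQ by (simp_all add: emb_mult[symmetric] emb_one)
  have bQ: "bounded_by n (emb Q)" using PQ by (simp add: bounded_by_emb)
  \<comment> \<open>In the Schur form \<open>a = P t Q\<close> the product \<open>Q P\<close> is the
    identity, so shifts of \<open>a\<close> pass through \<open>P\<close> and become shifts of
    \<open>t\<close>.\<close>
  have step: "shift a c (emb P * x) = emb P * shift t c x" for c x
  proof -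
    have "a * (emb P * x) = emb P * (t * (emb Q * emb P) * x)" by (simp add: a mult.assoc)
    also have "\<dots> = emb P * (t * x)" by (simp add: u t)
    finally show ?thesis by (simp add: shift_def cscale_mult_right algebra_simps)
  qed
  have fold: "foldr (shift a) L (emb P * x) = emb P * foldr (shift t) L x" for L x
    by (induction L) (simp_all add: step)
  have "foldr (shift t) (map (\<lambda>k. entry t k k) [0..<n]) (emb Q) = 0"
    using shift_triangular_annihilates[OF t tri] bounded_byD[OF bQ] by blast
  then have "foldr (shift a) (map (\<lambda>k. entry t k k) [0..<n]) (unit n) = 0"
    using fold[of _ "emb Q"] by (simp add: u)
  then show ?thesis by blast
qed

text \<open>With \<open>w = (a - r) x\<close>, hermiticity moves one factor across the form:
  \<open>star w * w = star x * (a - r) w = 0\<close>. This excludes Jordan blocks.\<close>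

lemma shift_real_idem:
  assumes "star a = a" "shift a (complex_of_real r) (shift a (complex_of_real r) x) = 0"
  shows "shift a (complex_of_real r) x = 0"
proof -
  let ?w = "shift a (complex_of_real r) x"
  have "star ?w = star x * a - r *\<^sub>R star x" by (simp add: shift_def cscale_of_real assms)
  then have "star ?w * ?w = star x * a * ?w - r *\<^sub>R (star x * ?w)"
    by (simp add: left_diff_distrib)
  then have "star ?w * ?w = star x * shift a (complex_of_real r) ?w"
    by (simp add: shift_def[of _ _ ?w] cscale_of_real right_diff_distrib mult.assoc)
  then show ?thesis using assms star_mult_eq_0[of ?w] by simp
qed

text \<open>\<open>star x * a * x\<close> is hermitian and also equal to \<open>c\<close> times the
  hermitian \<open>star x * x\<close>, which for non-real \<open>c\<close> forces the latter to
  vanish.\<close>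

lemma shift_nonreal_inj:
  assumes "star a = a" "Im c \<noteq> 0" "shift a c x = 0"
  shows "x = 0"
proof -
  have "a * x = cscale c x" using assms by (simp add: shift_def)
  then have 1: "star x * a * x = cscale c (star x * x)" by (simp add: mult.assoc cscale_mult_right)
  have "star (star x * a * x) = star x * a * x" by (simp add: assms mult.assoc)
  then have "cscale (cnj c) (star x * x) = cscale c (star x * x)" using 1 by (simp add: star_cscale)
  then have "cscale (c - cnj c) (star x * x) = 0" by (simp add: cscale_minus_left)
  moreover have "c - cnj c \<noteq> 0" using assms by (simp add: complex_eq_iff)
  ultimately show ?thesis using cscale_eq_0 star_mult_eq_0 by blast
qed

text \<open>
  A vector annihilated by a product of factors \<open>a - c\<close> is a sum of eigenvectors: divide the
  components of \<open>(a - c) x\<close> by \<open>r - c\<close> and absorb the remainder, using that hermitian \<open>a\<close> has no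
  generalised eigenvectors.
\<close>

lemma shift_decompose:
  assumes "star a = a" "foldr (shift a) L x = 0"
  shows "\<exists>J X. finite J \<and> x = sum X J \<and> (\<forall>r\<in>J. a * X r = r *\<^sub>R X r)"
  using assms(2)
proof (induction L arbitrary: x rule: rev_induct)
  case Nil
  then show ?case by (intro exI[of _ "{}"]) simp
next
  case (snoc c L)
  then have "foldr (shift a) L (shift a c x) = 0" by simp
  from snoc.IH[OF this] obtain J Y where J: "finite J" "shift a c x = sum Y J"
    and Y: "\<And>r. r \<in> J \<Longrightarrow> a * Y r = r *\<^sub>R Y r" by blast
  define J' where "J' = {r \<in> J. complex_of_real r \<noteq> c}"
  define X where "X r = cscale (1 / (complex_of_real r - c)) (Y r)" for r
  have fJ': "finite J'" using J by (simp add: J'_def)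
  have aX: "a * X r = r *\<^sub>R X r" if "r \<in> J" for r
    by (simp add: X_def cscale_mult_right Y[OF that] cscale_scaleR)
  have sY: "shift a d (Y r) = cscale (complex_of_real r - d) (Y r)" if "r \<in> J" for r d
    by (simp add: shift_def Y[OF that] cscale_minus_left cscale_of_real)
  have sX: "shift a c (X r) = Y r" if "r \<in> J'" for r
    using that by (simp add: X_def shift_cscale sY cscale_cscale cscale_1 J'_def)
  define z where "z = x - sum X J'"
  have "shift a c z = sum Y J - sum Y J'"
    by (simp add: z_def shift_diff shift_sum J sX)
  also have "\<dots> = sum Y (J - J')" using J by (simp add: sum_diff J'_def)
  finally have "shift a c (shift a c z) = (\<Sum>r\<in>J - J'. shift a c (Y r))" by (simp add: shift_sum)
  also have "\<dots> = 0"
    by (rule sum.neutral) (auto simp: sY J'_def intro!: fmat_eqI simp: entry_cscale entry_simps)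
  finally have zz: "shift a c (shift a c z) = 0" .
  show ?case
  proof (cases "Im c = 0")
    case True
    then have c: "c = complex_of_real (Re c)" by (simp add: complex_eq_iff)
    have az: "a * z = Re c *\<^sub>R z"
      using shift_real_idem[OF assms(1), of "Re c" z] zz c cscale_of_real[of "Re c" z]
      by (simp add: shift_def)
    have nin: "Re c \<notin> J'" using c by (auto simp: J'_def)
    have "x = sum (X(Re c := z)) (insert (Re c) J')"
    proof -
      have "sum (X(Re c := z)) J' = sum X J'" by (rule sum.cong) (use nin in auto)
      then show ?thesis using nin fJ' by (simp add: z_def)
    qed
    moreover have "\<forall>r\<in>insert (Re c) J'. a * (X(Re c := z)) r = r *\<^sub>R (X(Re c := z)) r"
      using az aX by (auto simp: J'_def)
    ultimately show ?thesis using fJ' by blast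
  next
    case False
    then have "z = 0" using shift_nonreal_inj[OF assms(1)] zz by blast
    then have "x = sum X J'" by (simp add: z_def)
    then show ?thesis using fJ' aX by (auto simp: J'_def)
  qed
qed

text \<open>Index set and eigenvalues are kept apart, so that eigenvalues may repeat and members may
  be zero. The refinement of a spectral resolution by \<open>P\<close> and \<open>Q\<close> and the
  block resolutions below are of this kind.\<close>

definition resolution :: "nat \<Rightarrow> 'j set \<Rightarrow> ('j \<Rightarrow> fmat) \<Rightarrow> bool" where
  "resolution n J F \<longleftrightarrow> finite J \<and> (\<forall>j\<in>J. star (F j) = F j) \<and>
     (\<forall>i\<in>J. \<forall>j\<in>J. F i * F j = (if i = j then F i else 0)) \<and> sum F J = unit n"

lemma resolutionD:
  assumes "resolution n J F"
  shows "finite J" "j \<in> J \<Longrightarrow> star (F j) = F j"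
    "i \<in> J \<Longrightarrow> j \<in> J \<Longrightarrow> F i * F j = (if i = j then F i else 0)" "sum F J = unit n"
  using assms by (auto simp: resolution_def)

lemma resolution_bounded_by:
  assumes "resolution n J F" "j \<in> J" shows "bounded_by n (F j)"
proof -
  note R = resolutionD[OF assms(1)]
  have "F j * sum F J = F j"
    using assms(2) R(1) by (simp add: sum_distrib_left R(3) sum.delta)
  moreover from this have "star (F j * sum F J) = star (F j)" by simp
  then have "unit n * F j = F j" using R assms(2) by simp
  ultimately show ?thesis using R(4) bounded_by_unit_iff by metis
qed

text \<open>The identity itself is expanded into eigenvectors, and its components are automatically
  the spectral projections: components to different eigenvalues are orthogonal, so multiplying the
  expansion by \<open>star (F r)\<close> leaves \<open>star (F r) = star (F r) * F r\<close>, which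
  makes \<open>F r\<close> hermitian and idempotent.\<close>

lemma spectral_theorem:
  assumes "bounded_by n a" "star a = a"
  shows "\<exists>(J :: real set) F. resolution n J F \<and> a = (\<Sum>r\<in>J. r *\<^sub>R F r) \<and> (\<forall>r\<in>J. F r \<noteq> 0)"
proof -
  obtain L where "foldr (shift a) L (unit n) = 0" using shift_annihilates_unit[OF assms(1)] by blast
  from shift_decompose[OF assms(2) this] obtain J X where
    J: "finite J" "unit n = sum X J" and X: "\<And>r. r \<in> J \<Longrightarrow> a * X r = r *\<^sub>R X r" by blast
  \<comment> \<open>The components come without a support bound. Compressing them to dimension
    \<open>n\<close> keeps the eigenvector equation because \<open>a\<close> commutes with
    \<open>unit n\<close>.\<close>
  define F where "F r = unit n * X r * unit n" for r
  have bF: "unit n * F r = F r" "F r * unit n = F r" for r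
    by (simp_all add: F_def mult.assoc bounded_by_unit)
      (simp add: mult.assoc[symmetric] bounded_by_unit)
  have sumF: "sum F J = unit n"
    unfolding F_def sum_distrib_left[symmetric] sum_distrib_right[symmetric] J(2)[symmetric]
    by (simp add: bounded_by_unit)
  have aF: "a * F r = r *\<^sub>R F r" if "r \<in> J" for r
  proof -
    have "a * F r = (a * unit n) * X r * unit n" by (simp add: F_def mult.assoc)
    also have "\<dots> = (unit n * a) * X r * unit n" by (simp add: assms)
    also have "\<dots> = unit n * (a * X r) * unit n" by (simp only: mult.assoc)
    also have "\<dots> = r *\<^sub>R F r" by (simp add: F_def X[OF that])
    finally show ?thesis .
  qed
  have orth: "star (F r) * F s = 0" if "r \<in> J" "s \<in> J" "r \<noteq> s" for r s
  proof -
    have "star (F r) * a = star (a * F r)" by (simp add: assms)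
    also have "\<dots> = r *\<^sub>R star (F r)" using aF that by simp
    finally have "r *\<^sub>R (star (F r) * F s) = star (F r) * (a * F s)" by (simp add: mult.assoc[symmetric])
    also have "\<dots> = s *\<^sub>R (star (F r) * F s)" using aF that by simp
    finally show ?thesis using that by simp
  qed
  have sq: "star (F r) = star (F r) * F r" if "r \<in> J" for r
  proof -
    have "star (F r) * unit n = (\<Sum>s\<in>J. star (F r) * F s)" by (simp add: sumF[symmetric] sum_distrib_left)
    also have "\<dots> = (\<Sum>s\<in>J. if s = r then star (F r) * F r else 0)"
      by (rule sum.cong) (use orth that in auto)
    moreover have "star (F r) * unit n = star (F r)" using bF by (metis star_mult star_unit)
    ultimately show ?thesis using that J by simp
  qed
  have herm: "star (F r) = F r" if "r \<in> J" for r
    using sq[OF that] by (metis star_mult star_star)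
  have prod: "F i * F j = (if i = j then F i else 0)" if "i \<in> J" "j \<in> J" for i j
    using sq[of i] orth[of i j] herm that by auto
  \<comment> \<open>Dropping the zero components makes every remaining index an actual eigenvalue;
    \<open>emb_mfun\<close> relies on this.\<close>
  define J' where "J' = {r \<in> J. F r \<noteq> 0}"
  have "sum F J' = sum F J" by (rule sum.mono_neutral_left) (auto simp: J'_def J)
  then have "resolution n J' F" using J herm prod sumF by (auto simp: resolution_def J'_def)
  moreover have "a = (\<Sum>r\<in>J'. r *\<^sub>R F r)"
  proof -
    have "a = a * sum F J" by (simp add: sumF assms)
    also have "\<dots> = (\<Sum>r\<in>J. r *\<^sub>R F r)" by (simp add: sum_distrib_left aF)
    also have "\<dots> = (\<Sum>r\<in>J'. r *\<^sub>R F r)" by (rule sum.mono_neutral_right) (auto simp: J'_def J)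
    finally show ?thesis .
  qed
  ultimately show ?thesis by (auto simp: J'_def)
qed

section \<open>Logarithmic trace inequalities\<close>

text \<open>Testing on all matrices \<open>x\<close> amounts to the usual test on vectors, since the
  trace is the sum of the quadratic forms at the columns of \<open>x\<close>.\<close>

definition pos :: "fmat \<Rightarrow> bool" where
  "pos a \<longleftrightarrow> star a = a \<and> (\<forall>x. 0 \<le> tr (star x * a * x))"

lemma pos_star: "pos a \<Longrightarrow> star a = a" by (simp add: pos_def)

lemma pos_conj: "pos a \<Longrightarrow> pos (star y * a * y)"
  unfolding pos_def
proof safe
  fix x assume "star a = a" "\<forall>x. 0 \<le> tr (star x * a * x)"
  then have "0 \<le> tr (star (y * x) * a * (y * x))" by blast
  then show "0 \<le> tr (star x * (star y * a * y) * x)" by (simp add: mult.assoc)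
qed (simp add: mult.assoc)

lemma pos_star_mult: "pos (star b * b)"
  unfolding pos_def
proof safe
  fix x
  show "0 \<le> tr (star x * (star b * b) * x)"
    using tr_star_mult_nonneg[of "b * x"] by (simp add: mult.assoc)
qed simp

lemma pos_square: "star b = b \<Longrightarrow> pos (b * b)"
  using pos_star_mult[of b] by simp

lemma pos_0 [simp]: "pos 0" by (simp add: pos_def)

lemma pos_add: "pos a \<Longrightarrow> pos b \<Longrightarrow> pos (a + b)"
  by (simp add: pos_def distrib_left distrib_right)

lemma pos_sum: "(\<And>i. i \<in> I \<Longrightarrow> pos (f i)) \<Longrightarrow> pos (sum f I)"
  by (induction I rule: infinite_finite_induct) (simp_all add: pos_add)

lemma pos_scaleR: "pos a \<Longrightarrow> 0 \<le> r \<Longrightarrow> pos (r *\<^sub>R a)"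
  by (simp add: pos_def)

lemma resolution_fun_mult:
  assumes "resolution n J F"
  shows "(\<Sum>j\<in>J. f j *\<^sub>R F j) * (\<Sum>j\<in>J. g j *\<^sub>R F j) = (\<Sum>j\<in>J. (f j * g j) *\<^sub>R F j)"
proof -
  note R = resolutionD[OF assms]
  have "(\<Sum>j\<in>J. f j *\<^sub>R F j) * (\<Sum>j\<in>J. g j *\<^sub>R F j)
      = (\<Sum>i\<in>J. \<Sum>j\<in>J. (f i *\<^sub>R F i) * (g j *\<^sub>R F j))"
    by (rule sum_product)
  also have "\<dots> = (\<Sum>i\<in>J. \<Sum>j\<in>J. if j = i then (f i * g i) *\<^sub>R F i else 0)"
    by (intro sum.cong refl) (auto simp: R(3))
  finally show ?thesis using R(1) by simp
qed

lemma resolution_fun_proj: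
  assumes "resolution n J F" "k \<in> J"
  shows "(\<Sum>j\<in>J. f j *\<^sub>R F j) * F k = f k *\<^sub>R F k" "F k * (\<Sum>j\<in>J. f j *\<^sub>R F j) = f k *\<^sub>R F k"
proof -
  note R = resolutionD[OF assms(1)]
  have "(\<Sum>j\<in>J. f j *\<^sub>R F j) * F k = (\<Sum>j\<in>J. if j = k then f k *\<^sub>R F k else 0)"
    unfolding sum_distrib_right by (rule sum.cong) (use assms(2) in \<open>auto simp: R(3)\<close>)
  then show "(\<Sum>j\<in>J. f j *\<^sub>R F j) * F k = f k *\<^sub>R F k" using R(1) assms(2) by simp
  have "F k * (\<Sum>j\<in>J. f j *\<^sub>R F j) = (\<Sum>j\<in>J. if j = k then f k *\<^sub>R F k else 0)"
    unfolding sum_distrib_left by (rule sum.cong) (use assms(2) in \<open>auto simp: R(3)\<close>)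
  then show "F k * (\<Sum>j\<in>J. f j *\<^sub>R F j) = f k *\<^sub>R F k" using R(1) assms(2) by simp
qed

lemma resolution_fun_star:
  assumes "resolution n J F"
  shows "star (\<Sum>j\<in>J. f j *\<^sub>R F j) = (\<Sum>j\<in>J. f j *\<^sub>R F j)"
  unfolding star_sum by (rule sum.cong) (use resolutionD(2)[OF assms] in simp_all)

lemma bounded_by_sum: "(\<And>i. i \<in> I \<Longrightarrow> bounded_by n (f i)) \<Longrightarrow> bounded_by n (sum f I)"
  by (auto simp: bounded_by_entry entry_sum)

lemma bounded_by_scaleR: "bounded_by n x \<Longrightarrow> bounded_by n (r *\<^sub>R x)"
  by (auto simp: bounded_by_entry entry_simps)

lemma resolution_fun_bounded_by:
  "resolution n J F \<Longrightarrow> bounded_by n (\<Sum>j\<in>J. f j *\<^sub>R F j)"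
  by (intro bounded_by_sum bounded_by_scaleR resolution_bounded_by)

lemma resolution_pos: "resolution n J F \<Longrightarrow> j \<in> J \<Longrightarrow> pos (F j)"
  using pos_square[of "F j"] resolutionD[of n J F] by simp

lemma pos_spectral:
  assumes "pos a" "bounded_by n a"
  shows "\<exists>(J :: real set) F. resolution n J F \<and> a = (\<Sum>r\<in>J. r *\<^sub>R F r) \<and> (\<forall>r\<in>J. F r \<noteq> 0) \<and> (\<forall>r\<in>J. 0 \<le> r)"
proof -
  obtain J :: "real set" and F where JF: "resolution n J F" "a = (\<Sum>r\<in>J. r *\<^sub>R F r)" "\<forall>r\<in>J. F r \<noteq> 0"
    using spectral_theorem[OF assms(2) pos_star[OF assms(1)]] by blast
  note R = resolutionD[OF JF(1)]
  have "0 \<le> r" if r: "r \<in> J" for r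
  proof -
    have FF: "star (F r) * F r = F r" using R r by simp
    have "0 \<le> tr (star (F r) * a * F r)" using assms(1) by (simp add: pos_def)
    also have "star (F r) * a * F r = r *\<^sub>R (star (F r) * F r)"
      using resolution_fun_proj(1)[OF JF(1) r, of "\<lambda>r. r"] JF(2) by (simp add: mult.assoc)
    finally have "0 \<le> r * tr (star (F r) * F r)" by simp
    moreover have "tr (star (F r) * F r) > 0"
      using JF(3) r tr_star_mult_eq_0[of "F r"] tr_star_mult_nonneg[of "F r"] by fastforce
    ultimately show ?thesis by (simp add: zero_le_mult_iff)
  qed
  then show ?thesis using JF by blast
qed

lemma pos_sqrt:
  assumes "pos a" "bounded_by n a"
  shows "\<exists>b. star b = b \<and> bounded_by n b \<and> b * b = a"
proof -
  obtain J :: "real set" and F where JF: "resolution n J F" "a = (\<Sum>r\<in>J. r *\<^sub>R F r)" "\<forall>r\<in>J. 0 \<le> r"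
    using pos_spectral[OF assms] by blast
  have "(\<Sum>r\<in>J. sqrt r *\<^sub>R F r) * (\<Sum>r\<in>J. sqrt r *\<^sub>R F r) = a"
    unfolding resolution_fun_mult[OF JF(1)] JF(2) by (rule sum.cong) (use JF(3) in auto)
  then show ?thesis using resolution_fun_star[OF JF(1)] resolution_fun_bounded_by[OF JF(1)] by blast
qed

lemma tr_pos_mult:
  assumes "pos a" "pos b" shows "0 \<le> tr (a * b)"
proof -
  obtain n where "bounded_by n b" using bounded_by_ex by blast
  then obtain c where c: "star c = c" "c * c = b" using pos_sqrt[OF assms(2)] by blast
  have "tr (a * b) = tr (star c * a * c)" using c tr_commute[of "a * c" c] by (simp add: mult.assoc)
  then show ?thesis using assms(1) by (simp add: pos_def)
qed

text \<open>With \<open>a = c * c\<close> the trace is the squared Hilbert-Schmidt norm of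
  \<open>c * f\<close>. Kernel inclusions are later derived from traces in this way.\<close>

lemma tr_pos_proj_eq_0:
  assumes "pos a" "star f = f" "f * f = f" "tr (a * f) = 0"
  shows "a * f = 0"
proof -
  obtain n where "bounded_by n a" using bounded_by_ex by blast
  then obtain c where c: "star c = c" "c * c = a" using pos_sqrt[OF assms(1)] by blast
  have "tr (star (c * f) * (c * f)) = tr (f * (a * f))" using c assms by (simp add: mult.assoc[symmetric]) (simp add: mult.assoc)
  also have "\<dots> = tr (a * f)" using assms(3) by (subst tr_commute) (simp add: mult.assoc)
  finally have "c * f = 0" using assms(4) tr_star_mult_eq_0[of "c * f"] by argo
  then show ?thesis using c by (metis mult.assoc mult_zero_right)
qed

lemma tr_mult_mono:
  assumes "pos (b - a)" "pos c" shows "tr (a * c) \<le> tr (b * c)"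
  using tr_pos_mult[OF assms] by (simp add: left_diff_distrib)

text \<open>The integration over \<open>t\<close>, carried out by monotonicity: a function with
  nonnegative derivative on the positive axis that tends to 0 at infinity has a nonpositive limit at
  0. In the application \<open>a\<close> and \<open>b\<close> are the eigenvalues of
  \<open>w\<close> and kappa, \<open>e\<close> the traces of the spectral projections of
  \<open>w\<close>, \<open>r j = tr (w * F j)\<close> and
  \<open>q j k = tr (w * F j * w * F k)\<close>.\<close>

lemma log_gradient_scalar:
  fixes a e :: "'i \<Rightarrow> real" and b r :: "'j \<Rightarrow> real" and q :: "'j \<Rightarrow> 'j \<Rightarrow> real"
  assumes a: "\<And>i. i \<in> I \<Longrightarrow> 0 \<le> a i" and b: "\<And>j. j \<in> J \<Longrightarrow> 0 \<le> b j"
    and q: "\<And>j k. j \<in> J \<Longrightarrow> k \<in> J \<Longrightarrow> 0 \<le> q j k"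
    and r0: "\<And>j. j \<in> J \<Longrightarrow> b j = 0 \<Longrightarrow> r j = 0"
    and q0: "\<And>j k. j \<in> J \<Longrightarrow> k \<in> J \<Longrightarrow> b j = 0 \<or> b k = 0 \<Longrightarrow> q j k = 0"
    and mass: "(\<Sum>i\<in>I. e i * a i) = (\<Sum>j\<in>J. r j)"
    and resolvent: "\<And>t. 0 < t \<Longrightarrow> (\<Sum>j\<in>J. r j / (b j + t)) + (\<Sum>j\<in>J. r j * b j / (b j + t)\<^sup>2)
       - (\<Sum>j\<in>J. \<Sum>k\<in>J. q j k / ((b j + t) * (b k + t))) \<le> (\<Sum>i\<in>I. e i * a i / (a i + t))"
  shows "(\<Sum>i\<in>I. e i * a i * ln (a i)) \<le>
    (\<Sum>j\<in>J. r j * ln (b j)) + (\<Sum>j\<in>J. \<Sum>k\<in>J. q j k / sqrt (b j * b k)) - (\<Sum>j\<in>J. r j)"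
proof -
  \<comment> \<open>An antiderivative of the difference of the two sides of
    \<open>resolvent\<close>, except in the double sum, where the geometric mean stands in for the
    logarithmic mean. By \<open>amgm\<close> this only makes the derivative larger.\<close>
  define H where "H t = (\<Sum>i\<in>I. e i * a i * ln (a i + t)) - (\<Sum>j\<in>J. r j * ln (b j + t))
    - (\<Sum>j\<in>J. \<Sum>k\<in>J. q j k / sqrt ((b j + t) * (b k + t))) + (\<Sum>j\<in>J. r j * b j / (b j + t))" for t
  define H' where "H' t = (\<Sum>i\<in>I. e i * a i / (a i + t)) - (\<Sum>j\<in>J. r j / (b j + t))
    - (\<Sum>j\<in>J. \<Sum>k\<in>J. - (q j k * ((b j + t) + (b k + t)) / (2 * ((b j + t) * (b k + t)) * sqrt ((b j + t) * (b k + t)))))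
    + (\<Sum>j\<in>J. - (r j * b j / (b j + t)\<^sup>2))" for t
  have d1: "((\<lambda>t. c * ln (x + t)) has_real_derivative c / (x + t)) (at t)" if "x + t > 0" for c x t :: real
    using that by (auto intro!: derivative_eq_intros)
  have d3: "((\<lambda>t. c * x / (x + t)) has_real_derivative - (c * x / (x + t)\<^sup>2)) (at t)" if "x + t > 0" for c x t :: real
    using that by (auto intro!: derivative_eq_intros simp: power2_eq_square)
  have d2: "((\<lambda>t. c / sqrt ((x + t) * (y + t))) has_real_derivative
      - (c * ((x + t) + (y + t)) / (2 * ((x + t) * (y + t)) * sqrt ((x + t) * (y + t))))) (at t)"
    if "x + t > 0" "y + t > 0" for c x y t :: real
  proof -
    have "(x + t) * (y + t) > 0" using that by simp
    moreover have "sqrt ((x + t) * (y + t)) * sqrt ((x + t) * (y + t)) = (x + t) * (y + t)"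
      using calculation by simp
    ultimately show ?thesis
      by (auto intro!: derivative_eq_intros simp: field_simps)
  qed
  have deriv: "(H has_real_derivative H' t) (at t)" if "t > 0" for t
    unfolding H_def H'_def
    by (intro DERIV_add DERIV_diff DERIV_sum d1 d2 d3) (use that a b in \<open>auto simp: add_nonneg_pos\<close>)
  have amgm: "q j k / ((b j + t) * (b k + t)) \<le>
      q j k * ((b j + t) + (b k + t)) / (2 * ((b j + t) * (b k + t)) * sqrt ((b j + t) * (b k + t)))"
    if "j \<in> J" "k \<in> J" "t > 0" for j k t
  proof -
    let ?x = "b j + t" and ?y = "b k + t"
    have xy: "?x > 0" "?y > 0" using that b by (simp_all add: add_nonneg_pos)
    then have s: "sqrt (?x * ?y) > 0" by simp
    have "2 * sqrt (?x * ?y) \<le> ?x + ?y" using arith_geo_mean_sqrt[of ?x ?y] xy by simp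
    then have "1 \<le> (?x + ?y) / (2 * sqrt (?x * ?y))" using s by simp
    then have "q j k / (?x * ?y) * 1 \<le> q j k / (?x * ?y) * ((?x + ?y) / (2 * sqrt (?x * ?y)))"
      using q that xy by (intro mult_left_mono) auto
    then show ?thesis by (simp add: algebra_simps)
  qed
  have H'_nonneg: "0 \<le> H' t" if "t > 0" for t
  proof -
    have "(\<Sum>j\<in>J. \<Sum>k\<in>J. q j k / ((b j + t) * (b k + t))) \<le>
      (\<Sum>j\<in>J. \<Sum>k\<in>J. q j k * ((b j + t) + (b k + t)) / (2 * ((b j + t) * (b k + t)) * sqrt ((b j + t) * (b k + t))))"
      by (intro sum_mono amgm that)
    then show ?thesis using resolvent[OF that] unfolding H'_def by (simp add: sum_negf)
  qed
  have mono: "H s \<le> H t" if "0 < s" "s \<le> t" for s t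
    by (rule DERIV_nonneg_imp_nondecreasing[OF that(2)]) (use deriv H'_nonneg that in \<open>meson less_le_trans\<close>)
  \<comment> \<open>By \<open>mass\<close> the logarithms may be replaced by
    \<open>ln (a i + t) - ln t\<close> and \<open>ln (b j + t) - ln t\<close>, which tend to
    0.\<close>
  have "(H \<longlongrightarrow> 0) at_top"
  proof -
    have "((\<lambda>t. (\<Sum>i\<in>I. e i * a i * (ln (a i + t) - ln t)) - (\<Sum>j\<in>J. r j * (ln (b j + t) - ln t))
      - (\<Sum>j\<in>J. \<Sum>k\<in>J. q j k / sqrt ((b j + t) * (b k + t))) + (\<Sum>j\<in>J. r j * b j / (b j + t)))
      \<longlongrightarrow> (\<Sum>i\<in>I. e i * a i * 0) - (\<Sum>j\<in>J. r j * 0) - (\<Sum>j\<in>J. \<Sum>k\<in>J. 0) + (\<Sum>j\<in>J. 0)) at_top"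
      by (intro tendsto_add tendsto_diff tendsto_sum tendsto_mult tendsto_const) real_asymp+
    moreover have "H = (\<lambda>t. (\<Sum>i\<in>I. e i * a i * (ln (a i + t) - ln t)) - (\<Sum>j\<in>J. r j * (ln (b j + t) - ln t))
      - (\<Sum>j\<in>J. \<Sum>k\<in>J. q j k / sqrt ((b j + t) * (b k + t))) + (\<Sum>j\<in>J. r j * b j / (b j + t)))"
      unfolding H_def right_diff_distrib sum_subtractf sum_distrib_right[symmetric] mass by auto
    ultimately show ?thesis by simp
  qed
  then have H_nonpos: "H t \<le> 0" if "t > 0" for t
    by (rule tendsto_lowerbound) (use mono that in \<open>auto simp: eventually_at_top_linorder\<close>)
  \<comment> \<open>At an eigenvalue 0 the coefficients vanish (by \<open>r0\<close>,
    \<open>q0\<close> and the factor \<open>a i\<close>), so these summands are constantly 0 and no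
    singularity arises.\<close>
  have "(H \<longlongrightarrow> (\<Sum>i\<in>I. e i * a i * ln (a i)) - (\<Sum>j\<in>J. r j * ln (b j))
    - (\<Sum>j\<in>J. \<Sum>k\<in>J. q j k / sqrt (b j * b k)) + (\<Sum>j\<in>J. r j)) (at_right 0)"
    unfolding H_def
  proof (intro tendsto_add tendsto_diff tendsto_sum)
    have id0: "((\<lambda>t. x + t) \<longlongrightarrow> x) (at_right 0)" for x :: real by real_asymp
    fix i assume "i \<in> I"
    then show "((\<lambda>t. e i * a i * ln (a i + t)) \<longlongrightarrow> e i * a i * ln (a i)) (at_right 0)"
      by (cases "a i = 0") (auto intro!: tendsto_intros id0)
  next
    have id0: "((\<lambda>t. x + t) \<longlongrightarrow> x) (at_right 0)" for x :: real by real_asymp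
    fix j assume j: "j \<in> J"
    then show "((\<lambda>t. r j * ln (b j + t)) \<longlongrightarrow> r j * ln (b j)) (at_right 0)"
      by (cases "b j = 0") (auto intro!: tendsto_intros id0 simp: r0)
    show "((\<lambda>t. r j * b j / (b j + t)) \<longlongrightarrow> r j) (at_right 0)"
    proof (cases "b j = 0")
      case False
      then have "((\<lambda>t. r j * b j / (b j + t)) \<longlongrightarrow> r j * b j / b j) (at_right 0)"
        by (intro tendsto_divide tendsto_const id0) auto
      then show ?thesis using False by simp
    qed (simp add: r0 j)
    fix k assume k: "k \<in> J"
    show "((\<lambda>t. q j k / sqrt ((b j + t) * (b k + t))) \<longlongrightarrow> q j k / sqrt (b j * b k)) (at_right 0)"
      by (cases "b j = 0 \<or> b k = 0") (auto intro!: tendsto_intros id0 simp: q0 j k)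
  qed
  then have "(\<Sum>i\<in>I. e i * a i * ln (a i)) - (\<Sum>j\<in>J. r j * ln (b j))
    - (\<Sum>j\<in>J. \<Sum>k\<in>J. q j k / sqrt (b j * b k)) + (\<Sum>j\<in>J. r j) \<le> 0"
    by (rule tendsto_upperbound) (auto simp: eventually_at_right_less H_nonpos eventually_at_filter intro!: always_eventually)
  then show ?thesis by simp
qed

text \<open>For kappa with eigenvalues \<open>b j\<close> and projections \<open>F j\<close>, the
  sums on the right are Tr (w ln kappa) and Tr (w kappa^(-1/2) w kappa^(-1/2)). The third assumption
  on \<open>F\<close> puts the kernel of kappa into that of \<open>w\<close>.\<close>

lemma tr_log_upper:
  assumes w: "w = (\<Sum>i\<in>I. a i *\<^sub>R E i)" "resolution n I E" "\<And>i. i \<in> I \<Longrightarrow> 0 \<le> a i"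
    and F: "resolution n J F" "\<And>j. j \<in> J \<Longrightarrow> 0 \<le> b j" "\<And>j. j \<in> J \<Longrightarrow> b j = 0 \<Longrightarrow> w * F j = 0"
  shows "(\<Sum>i\<in>I. a i * ln (a i) * tr (E i)) \<le>
    (\<Sum>j\<in>J. tr (w * F j) * ln (b j)) + (\<Sum>j\<in>J. \<Sum>k\<in>J. tr (w * F j * w * F k) / sqrt (b j * b k)) - tr w"
proof -
  note RE = resolutionD[OF w(2)] and RF = resolutionD[OF F(1)]
  have sw: "star w = w" unfolding w(1) by (rule resolution_fun_star[OF w(2)])
  have bw: "bounded_by n w" unfolding w(1) by (rule resolution_fun_bounded_by[OF w(2)])
  have pw: "pos w" unfolding w(1) by (intro pos_sum pos_scaleR resolution_pos[OF w(2)] w(3))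
  have trw: "tr w = (\<Sum>j\<in>J. tr (w * F j))"
    using bw RF(4) by (simp add: tr_sum[symmetric] sum_distrib_left[symmetric])
  have trw': "tr w = (\<Sum>i\<in>I. tr (E i) * a i)" by (simp add: w(1) mult.commute)
  \<comment> \<open>The trace is the squared Hilbert-Schmidt norm of
    \<open>F j * w * F k\<close>.\<close>
  have q: "0 \<le> tr (w * F j * w * F k)" if "j \<in> J" "k \<in> J" for j k
  proof -
    have "tr (w * F j * w * F k) = tr (w * F j * F j * w * F k * F k)"
      using that RF(3) by (simp add: mult.assoc)
    also have "\<dots> = tr (F k * (w * F j * F j * w * F k))" by (rule tr_commute)
    also have "\<dots> = tr (star (F j * w * F k) * (F j * w * F k))"
      using that RF(2) sw by (simp add: mult.assoc)
    finally show ?thesis using tr_star_mult_nonneg[of "F j * w * F k"] by argo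
  qed
  have res: "(\<Sum>j\<in>J. tr (w * F j) / (b j + t)) + (\<Sum>j\<in>J. tr (w * F j) * b j / (b j + t)\<^sup>2)
       - (\<Sum>j\<in>J. \<Sum>k\<in>J. tr (w * F j * w * F k) / ((b j + t) * (b k + t))) \<le> (\<Sum>i\<in>I. tr (E i) * a i / (a i + t))"
    if t: "0 < t" for t
  proof -
    define A where "A = (\<Sum>i\<in>I. (a i + t) *\<^sub>R E i)"
    define A' where "A' = (\<Sum>i\<in>I. (1 / (a i + t)) *\<^sub>R E i)"
    define B' where "B' = (\<Sum>j\<in>J. (1 / (b j + t)) *\<^sub>R F j)"
    have A: "A = w + t *\<^sub>R unit n"
      by (simp add: A_def w(1) scaleR_add_left sum.distrib scaleR_sum_right[symmetric] RE(4))
    have at: "a i + t \<noteq> 0" if "i \<in> I" for i using w(3)[OF that] t by linarith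
    have bt: "b j + t \<noteq> 0" if "j \<in> J" for j using F(2)[OF that] t by linarith
    have AA': "A * A' = unit n" "A' * A = unit n"
      unfolding A_def A'_def resolution_fun_mult[OF w(2)] RE(4)[symmetric]
      by (rule sum.cong; use at in simp)+
    have bds: "bounded_by n A" "bounded_by n A'" "bounded_by n B'"
      unfolding A_def A'_def B'_def by (rule resolution_fun_bounded_by, fact)+
    have stars: "star A' = A'" "star B' = B'"
      unfolding A'_def B'_def by (rule resolution_fun_star, fact)+
    have pA: "pos A" unfolding A_def by (intro pos_sum pos_scaleR resolution_pos[OF w(2)]) (use w(3) t in \<open>auto intro: add_nonneg_nonneg\<close>)
    \<comment> \<open>Since \<open>A'\<close> inverts \<open>A\<close>, the expansion contains
      \<open>A\<close> itself only between two factors \<open>B'\<close>. Traced against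
      \<open>w\<close>, with \<open>A = w + t\<close>, this gives the term quadratic in
      \<open>w\<close>.\<close>
    have "(A' - B') * A * (A' - B') = A' - B' - B' + B' * A * B'"
    proof -
      have "(A' - B') * A = unit n - B' * A" by (simp add: left_diff_distrib AA')
      then have "(A' - B') * A * (A' - B') = (unit n - B' * A) * A' - (unit n - B' * A) * B'"
        by (simp add: right_diff_distrib)
      also have "\<dots> = (A' - B') - (B' - B' * A * B')"
        using bds AA' by (simp add: left_diff_distrib mult.assoc)
      finally show ?thesis by simp
    qed
    moreover have "pos ((A' - B') * A * (A' - B'))"
      using pos_conj[OF pA, of "A' - B'"] stars by simp
    ultimately have "0 \<le> tr (w * (A' - B' - B' + B' * A * B'))" using tr_pos_mult[OF pw] by simp
    then have main: "0 \<le> tr (w * A') - 2 * tr (w * B') + tr (w * B' * w * B') + t * tr (w * (B' * B'))"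
      using bds by (simp add: A distrib_left distrib_right right_diff_distrib mult.assoc)
    have wA': "tr (w * A') = (\<Sum>i\<in>I. tr (E i) * a i / (a i + t))"
      unfolding w(1) A'_def resolution_fun_mult[OF w(2)] by (simp add: mult.commute)
    have wB': "tr (w * B') = (\<Sum>j\<in>J. tr (w * F j) / (b j + t))"
      unfolding B'_def by (simp add: sum_distrib_left)
    have wBB': "tr (w * (B' * B')) = (\<Sum>j\<in>J. tr (w * F j) / (b j + t)\<^sup>2)"
      unfolding B'_def resolution_fun_mult[OF F(1)] by (simp add: sum_distrib_left power2_eq_square)
    have wBwB: "tr (w * B' * w * B') = (\<Sum>j\<in>J. \<Sum>k\<in>J. tr (w * F j * w * F k) / ((b j + t) * (b k + t)))"
    proof -
      have "w * B' * w = (\<Sum>j\<in>J. (1 / (b j + t)) *\<^sub>R (w * F j * w))"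
        unfolding B'_def by (simp add: sum_distrib_left sum_distrib_right)
      then have "w * B' * w * B' = (\<Sum>j\<in>J. \<Sum>k\<in>J. ((1 / (b j + t)) *\<^sub>R (w * F j * w)) * ((1 / (b k + t)) *\<^sub>R F k))"
        by (simp add: B'_def sum_product)
      then show ?thesis by (simp add: mult.commute)
    qed
    have "tr (w * F j) / (b j + t) + tr (w * F j) * b j / (b j + t)\<^sup>2
        = 2 * (tr (w * F j) / (b j + t)) - t * (tr (w * F j) / (b j + t)\<^sup>2)" if "j \<in> J" for j
      using bt[OF that] by (simp add: divide_simps power2_eq_square) (simp add: algebra_simps)
    then have "(\<Sum>j\<in>J. tr (w * F j) / (b j + t)) + (\<Sum>j\<in>J. tr (w * F j) * b j / (b j + t)\<^sup>2)
        = 2 * tr (w * B') - t * tr (w * (B' * B'))"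
      unfolding wB' wBB' sum_distrib_left sum.distrib[symmetric] sum_subtractf[symmetric] by (rule sum.cong[OF refl])
    then show ?thesis using main wA' wBwB by linarith
  qed
  have z: "w * F j = 0" if "j \<in> J" "b j = 0" for j using F(3) that by blast
  have "(\<Sum>i\<in>I. tr (E i) * a i * ln (a i)) \<le>
    (\<Sum>j\<in>J. tr (w * F j) * ln (b j)) + (\<Sum>j\<in>J. \<Sum>k\<in>J. tr (w * F j * w * F k) / sqrt (b j * b k)) - (\<Sum>j\<in>J. tr (w * F j))"
  proof (rule log_gradient_scalar)
    fix j k assume jk: "j \<in> J" "k \<in> J" "b j = 0 \<or> b k = 0"
    then show "tr (w * F j * w * F k) = 0" using z by (metis mult.assoc mult_zero_left mult_zero_right tr_0)
  next
    show "(\<Sum>i\<in>I. tr (E i) * a i) = (\<Sum>j\<in>J. tr (w * F j))" using trw trw' by simp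
  qed (use w(3) F(2) q z res in auto)
  then show ?thesis using trw by (simp add: mult.commute mult.left_commute)
qed

text \<open>Klein's inequality. The weights \<open>m i j = tr (E i * F j)\<close> are nonnegative
  with row and column sums \<open>tr (E i)\<close> and \<open>tr (F j)\<close>, which reduces the
  claim to the scalar inequality x ln y + x - y <= x ln x.\<close>

lemma tr_log_lower:
  assumes w: "w = (\<Sum>i\<in>I. a i *\<^sub>R E i)" "resolution n I E" "\<And>i. i \<in> I \<Longrightarrow> 0 \<le> a i"
    and F: "resolution n J F" "\<And>j. j \<in> J \<Longrightarrow> 0 \<le> b j" "\<And>j. j \<in> J \<Longrightarrow> b j = 0 \<Longrightarrow> w * F j = 0"
  shows "(\<Sum>j\<in>J. tr (w * F j) * ln (b j)) + tr w - (\<Sum>j\<in>J. b j * tr (F j)) \<le> (\<Sum>i\<in>I. a i * ln (a i) * tr (E i))"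
proof -
  note RE = resolutionD[OF w(2)] and RF = resolutionD[OF F(1)]
  define m where "m i j = tr (E i * F j)" for i j
  have m: "0 \<le> m i j" if "i \<in> I" "j \<in> J" for i j
    unfolding m_def using that by (intro tr_pos_mult resolution_pos[OF w(2)] resolution_pos[OF F(1)])
  have E: "tr (E i) = (\<Sum>j\<in>J. m i j)" if "i \<in> I" for i
    using resolution_bounded_by[OF w(2) that] RF(4)
    by (simp add: m_def tr_sum[symmetric] sum_distrib_left[symmetric])
  have Fj: "tr (F j) = (\<Sum>i\<in>I. m i j)" if "j \<in> J" for j
    using resolution_bounded_by[OF F(1) that] RE(4)
    by (simp add: m_def tr_sum[symmetric] sum_distrib_right[symmetric])
  have wF: "tr (w * F j) = (\<Sum>i\<in>I. a i * m i j)" for j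
    by (simp add: w(1) m_def sum_distrib_right)
  have le: "m i j * (a i * ln (b j) + a i - b j) \<le> m i j * (a i * ln (a i))" if ij: "i \<in> I" "j \<in> J" for i j
  proof (cases "b j = 0")
    \<comment> \<open>With \<open>ln 0 = 0\<close> the scalar inequality can fail at
      \<open>b j = 0\<close>; the kernel condition makes \<open>a i * m i j\<close> vanish
      instead.\<close>
    case True
    then have "(\<Sum>i\<in>I. a i * m i j) = 0" using F(3)[OF ij(2)] wF[of j] by simp
    then have "a i * m i j = 0"
      using ij RE(1) m w(3) by (subst (asm) sum_nonneg_eq_0_iff) auto
    then show ?thesis using True by auto
  next
    case False
    then have bj: "b j > 0" using F(2) ij by force
    have "a i * ln (b j) + a i - b j \<le> a i * ln (a i)"
    proof (cases "a i = 0")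
      case False
      then have ai: "a i > 0" using w(3)[OF ij(1)] by simp
      have "ln (b j / a i) \<le> b j / a i - 1" using ai bj by (intro ln_le_minus_one) simp
      then have "a i * (ln (b j) - ln (a i)) \<le> a i * (b j / a i - 1)"
        using ai bj by (intro mult_left_mono) (simp_all add: ln_div)
      then show ?thesis using ai by (simp add: algebra_simps)
    qed (use bj in simp)
    then show ?thesis using m[OF ij] by (rule mult_left_mono)
  qed
  have "(\<Sum>i\<in>I. \<Sum>j\<in>J. m i j * (a i * ln (b j) + a i - b j)) \<le> (\<Sum>i\<in>I. \<Sum>j\<in>J. m i j * (a i * ln (a i)))"
    by (intro sum_mono le)
  also have "\<dots> = (\<Sum>i\<in>I. a i * ln (a i) * tr (E i))"
    by (rule sum.cong) (auto simp: E sum_distrib_right mult.commute)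
  also have "(\<Sum>i\<in>I. \<Sum>j\<in>J. m i j * (a i * ln (b j) + a i - b j)) =
      (\<Sum>i\<in>I. \<Sum>j\<in>J. a i * m i j * ln (b j)) + (\<Sum>i\<in>I. \<Sum>j\<in>J. a i * m i j) - (\<Sum>i\<in>I. \<Sum>j\<in>J. b j * m i j)"
    unfolding sum.distrib[symmetric] sum_subtractf[symmetric]
    by (intro sum.cong refl) (simp add: algebra_simps)
  also have "(\<Sum>i\<in>I. \<Sum>j\<in>J. a i * m i j * ln (b j)) = (\<Sum>j\<in>J. tr (w * F j) * ln (b j))"
    by (subst sum.swap) (simp add: wF sum_distrib_right)
  also have "(\<Sum>i\<in>I. \<Sum>j\<in>J. a i * m i j) = tr w"
    by (simp add: w(1) E sum_distrib_left)
  also have "(\<Sum>i\<in>I. \<Sum>j\<in>J. b j * m i j) = (\<Sum>j\<in>J. b j * tr (F j))"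
    by (subst sum.swap) (simp add: Fj sum_distrib_left)
  finally show ?thesis .
qed

section \<open>Pinching\<close>

text \<open>Tr (w ln w), read off from an arbitrarily chosen spectral resolution;
  \<open>tr_xlnx_eq\<close> shows that every resolution gives this value.\<close>

definition tr_xlnx :: "nat \<Rightarrow> fmat \<Rightarrow> real" where
  "tr_xlnx n w = (SOME v. \<exists>(J :: real set) F. resolution n J F \<and> w = (\<Sum>r\<in>J. r *\<^sub>R F r) \<and>
     (\<forall>r\<in>J. 0 \<le> r) \<and> v = (\<Sum>r\<in>J. r * ln r * tr (F r)))"

text \<open>Klein's inequality for \<open>w\<close> against itself, in two resolutions. By symmetry
  the two values coincide, and the projections need not be compared.\<close>

lemma resolution_xlnx_le:
  assumes w: "w = (\<Sum>i\<in>I. a i *\<^sub>R E i)" "resolution n I E" "\<And>i. i \<in> I \<Longrightarrow> 0 \<le> a i"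
    and F: "w = (\<Sum>j\<in>J. b j *\<^sub>R F j)" "resolution n J F" "\<And>j. j \<in> J \<Longrightarrow> 0 \<le> b j"
  shows "(\<Sum>j\<in>J. b j * ln (b j) * tr (F j)) \<le> (\<Sum>i\<in>I. a i * ln (a i) * tr (E i))"
proof -
  have wF: "w * F j = b j *\<^sub>R F j" if "j \<in> J" for j
    unfolding F(1) by (rule resolution_fun_proj(1)[OF F(2) that])
  have "(\<Sum>j\<in>J. tr (w * F j) * ln (b j)) + tr w - (\<Sum>j\<in>J. b j * tr (F j)) \<le> (\<Sum>i\<in>I. a i * ln (a i) * tr (E i))"
  proof (rule tr_log_lower[OF w F(2,3)])
    fix j assume j: "j \<in> J" "b j = 0"
    show "w * F j = 0" using wF[OF j(1)] unfolding j(2) by simp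
  qed
  moreover have "(\<Sum>j\<in>J. tr (w * F j) * ln (b j)) = (\<Sum>j\<in>J. b j * ln (b j) * tr (F j))"
    by (rule sum.cong) (simp_all add: wF)
  moreover have "tr w = (\<Sum>j\<in>J. b j * tr (F j))" by (simp add: F(1))
  ultimately show ?thesis by simp
qed

lemma tr_xlnx_eq:
  assumes w: "w = (\<Sum>i\<in>I. a i *\<^sub>R E i)" "resolution n I E" "\<And>i. i \<in> I \<Longrightarrow> 0 \<le> a i"
  shows "tr_xlnx n w = (\<Sum>i\<in>I. a i * ln (a i) * tr (E i))"
proof -
  have "pos w" unfolding w(1) by (intro pos_sum pos_scaleR resolution_pos[OF w(2)] w(3))
  moreover have "bounded_by n w" unfolding w(1) by (rule resolution_fun_bounded_by[OF w(2)])
  ultimately have "\<exists>v. \<exists>(J :: real set) F. resolution n J F \<and> w = (\<Sum>r\<in>J. r *\<^sub>R F r) \<and>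
     (\<forall>r\<in>J. 0 \<le> r) \<and> v = (\<Sum>r\<in>J. r * ln r * tr (F r))"
    using pos_spectral[of w n] by blast
  from someI_ex[OF this] obtain J :: "real set" and F where
    F: "w = (\<Sum>r\<in>J. r *\<^sub>R F r)" "resolution n J F" "\<And>r. r \<in> J \<Longrightarrow> 0 \<le> r"
      "tr_xlnx n w = (\<Sum>r\<in>J. r * ln r * tr (F r))"
    unfolding tr_xlnx_def by blast
  show ?thesis unfolding F(4)
    by (intro antisym resolution_xlnx_le[OF w F(1-3)] resolution_xlnx_le[OF F(1-3) w])
qed

text \<open>Moving \<open>p\<close> through \<open>x\<close> multiplies \<open>H i * x * H j\<close>
  by \<open>i\<close> on one side and by \<open>j\<close> on the other, so it vanishes for
  \<open>i \<noteq> j\<close>.\<close>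

lemma resolution_commute:
  fixes K :: "real set"
  assumes H: "resolution n K H" and p: "p = (\<Sum>k\<in>K. k *\<^sub>R H k)"
    and x: "x * p = p * x" "bounded_by n x" and k: "k \<in> K"
  shows "x * H k = H k * x"
proof -
  note R = resolutionD[OF H]
  have off: "H i * x * H j = 0" if "i \<in> K" "j \<in> K" "i \<noteq> j" for i j
  proof -
    have "i *\<^sub>R (H i * x * H j) = (H i * p) * x * H j"
      using resolution_fun_proj(2)[OF H that(1), of "\<lambda>k. k"] by (simp add: p)
    also have "\<dots> = H i * x * (p * H j)" using x by (metis mult.assoc)
    also have "\<dots> = j *\<^sub>R (H i * x * H j)"
      using resolution_fun_proj(1)[OF H that(2), of "\<lambda>k. k"] by (simp add: p)
    finally show ?thesis using that by simp
  qed
  have "x * H k = (\<Sum>i\<in>K. H i * x * H k)"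
    using R(4) x(2) resolution_bounded_by[OF H k]
    by (simp add: sum_distrib_right[symmetric])
  also have "\<dots> = (\<Sum>i\<in>K. if i = k then H k * x * H k else 0)"
    by (rule sum.cong) (use off k in auto)
  finally have 1: "x * H k = H k * x * H k" using R(1) k by simp
  have "H k * x = (\<Sum>i\<in>K. H k * x * H i)"
    using R(4) x(2) resolution_bounded_by[OF H k]
    by (simp add: sum_distrib_left[symmetric] mult.assoc)
  also have "\<dots> = (\<Sum>i\<in>K. if i = k then H k * x * H k else 0)"
    by (rule sum.cong) (use off k in auto)
  finally show ?thesis using 1 R(1) k by simp
qed

text \<open>The difference of the two sides is half the squared Hilbert-Schmidt norm of the
  commutator of \<open>y\<close> and \<open>m\<close>.\<close>

lemma tr_square_commutator:
  assumes "star y = y" "star m = m"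
  shows "tr (y * m * y * m) \<le> tr (y * y * (m * m))"
proof -
  have "0 \<le> tr (star (y * m - m * y) * (y * m - m * y))" by (rule tr_star_mult_nonneg)
  also have "star (y * m - m * y) * (y * m - m * y) =
      m * (y * y * m) - m * (y * m * y) - y * m * y * m + y * (m * m * y)"
    using assms by (simp add: algebra_simps)
  finally have "0 \<le> tr (m * (y * y * m)) - tr (m * (y * m * y)) - tr (y * m * y * m) + tr (y * (m * m * y))"
    by simp
  moreover have "tr (m * (y * y * m)) = tr (y * y * (m * m))" by (subst tr_commute) (simp add: mult.assoc)
  moreover have "tr (m * (y * m * y)) = tr (y * m * y * m)" by (subst tr_commute) simp
  moreover have "tr (y * (m * m * y)) = tr (y * y * (m * m))"
    by (subst tr_commute) (simp add: mult.assoc, subst tr_commute, simp add: mult.assoc)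
  ultimately show ?thesis by simp
qed

text \<open>\<open>r\<close> stands for rho_B and \<open>p\<close> for the pinched operator pi. As
  \<open>p\<close> commutes with \<open>P\<close> and \<open>Q\<close>, the operator
  \<open>p\<close> and the weights on \<open>P\<close> and \<open>Q\<close> have a common spectral
  resolution.\<close>

locale pinching =
  fixes n :: nat and P Q r p :: fmat and K :: "real set" and H :: "real \<Rightarrow> fmat"
  assumes bP: "bounded_by n P" and sP: "star P = P" and PP: "P * P = P"
    and Q: "Q = unit n - P"
    and r: "pos r" "bounded_by n r"
    and p: "p = P * r * P + Q * r * Q"
    and H: "resolution n K H" "p = (\<Sum>k\<in>K. k *\<^sub>R H k)" "\<And>k. k \<in> K \<Longrightarrow> 0 \<le> k"
begin

text \<open>\<open>M\<close> is \<open>p\<^sup>-\<^sup>1\<^sup>/\<^sup>2\<close> and \<open>L\<close> is \<open>ln p\<close>, both on the support of \<open>p\<close>, because \<open>1 / 0 = 0\<close> and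
  \<open>ln 0 = 0\<close>.\<close>

definition M where "M = (\<Sum>k\<in>K. (1 / sqrt k) *\<^sub>R H k)"
definition L where "L = (\<Sum>k\<in>K. ln k *\<^sub>R H k)"

lemma sQ: "star Q = Q" by (simp add: Q sP)
lemma PQ: "P * Q = 0" using bP by (simp add: Q right_diff_distrib PP)
lemma QP: "Q * P = 0" using bP by (simp add: Q left_diff_distrib PP)
lemma QQ: "Q * Q = Q" using bP by (simp add: Q left_diff_distrib right_diff_distrib PP bounded_by_unit)
lemma bQ: "bounded_by n Q" using bP bounded_by_unit by (auto simp: Q bounded_by_entry entry_simps)
lemma PQ_unit: "P + Q = unit n" by (simp add: Q)

lemma PP' [simp]: "P * (P * x) = P * x" by (simp add: PP flip: mult.assoc)
lemma QQ' [simp]: "Q * (Q * x) = Q * x" by (simp add: QQ flip: mult.assoc)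
lemma PQ' [simp]: "P * (Q * x) = 0" by (simp add: PQ flip: mult.assoc)
lemma QP' [simp]: "Q * (P * x) = 0" by (simp add: QP flip: mult.assoc)

lemma tr_PQ: assumes "bounded_by n x" shows "tr (x * P) + tr (x * Q) = tr x"
  using assms by (simp add: tr_add[symmetric] distrib_left[symmetric] PQ_unit del: tr_add)

lemma P_p: "P * p = P * r * P" "p * P = P * r * P" and Q_p: "Q * p = Q * r * Q" "p * Q = Q * r * Q"
  by (simp_all add: p distrib_left distrib_right mult.assoc PP QQ PQ QP)

lemma star_M: "star M = M" unfolding M_def by (rule resolution_fun_star[OF H(1)])
lemma bounded_M: "bounded_by n M" unfolding M_def by (rule resolution_fun_bounded_by[OF H(1)])

lemma P_H: "k \<in> K \<Longrightarrow> P * H k = H k * P" and Q_H: "k \<in> K \<Longrightarrow> Q * H k = H k * Q"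
  by (rule resolution_commute[OF H(1,2)]; simp add: P_p Q_p bP bQ)+

lemma P_M: "P * M = M * P" and Q_M: "Q * M = M * Q"
  unfolding M_def sum_distrib_left sum_distrib_right by (auto intro!: sum.cong simp: P_H Q_H)

lemma p_M_p_M: "p * M * p * M = p"
  unfolding M_def H(2) resolution_fun_mult[OF H(1)]
  by (rule sum.cong) (use H(3) in \<open>auto simp: field_simps\<close>)

lemma M_M_p_M_M: "M * M * p * (M * M) = M * M"
  unfolding M_def H(2) resolution_fun_mult[OF H(1)]
  by (rule sum.cong) (use H(3) in \<open>auto simp: field_simps\<close>)

lemma tr_p: "tr p = tr r"
proof -
  have "tr p = tr (P * (r * P)) + tr (Q * (r * Q))" by (simp add: p mult.assoc)
  also have "\<dots> = tr (r * P) + tr (r * Q)"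
    by (simp add: tr_commute[of P] tr_commute[of Q] mult.assoc PP QQ)
  finally show ?thesis using tr_PQ[OF r(2)] by simp
qed

text \<open>\<open>H 0\<close> commutes with \<open>P\<close> and \<open>Q\<close>, so pinching does
  not change its expectation: \<open>tr (r * H 0) = tr (p * H 0) = 0\<close>. Hence the kernel of
  \<open>p\<close> lies in that of \<open>r\<close>, and by \<open>w_H0\<close> in that of every
  positive \<open>w\<close> below \<open>r\<close>.\<close>

lemma r_H0: assumes "0 \<in> K" shows "r * H 0 = 0"
proof (rule tr_pos_proj_eq_0[OF r(1)])
  note R = resolutionD[OF H(1)]
  show "star (H 0) = H 0" "H 0 * H 0 = H 0" using R assms by auto
  have "tr (P * r * P * H 0) = tr (r * H 0 * P)"
  proof -
    have "tr (P * r * P * H 0) = tr (P * (r * (P * H 0)))" by (simp add: mult.assoc)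
    also have "\<dots> = tr (r * H 0 * P)" by (subst tr_commute) (simp add: P_H assms mult.assoc PP)
    finally show ?thesis .
  qed
  moreover have "tr (Q * r * Q * H 0) = tr (r * H 0 * Q)"
  proof -
    have "tr (Q * r * Q * H 0) = tr (Q * (r * (Q * H 0)))" by (simp add: mult.assoc)
    also have "\<dots> = tr (r * H 0 * Q)" by (subst tr_commute) (simp add: Q_H assms mult.assoc QQ)
    finally show ?thesis .
  qed
  moreover have "p * H 0 = 0" using resolution_fun_proj(1)[OF H(1) assms, of "\<lambda>k. k"] by (simp add: H(2))
  moreover have "bounded_by n (r * H 0)"
    using r(2) resolution_bounded_by[OF H(1) assms] by (rule bounded_by_mult)
  ultimately show "tr (r * H 0) = 0"
    using tr_PQ[of "r * H 0"] by (simp add: p distrib_right) (metis tr_0 tr_add)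
qed

lemma w_H0:
  assumes "pos w" "pos (r - w)" "0 \<in> K" shows "w * H 0 = 0"
proof (rule tr_pos_proj_eq_0[OF assms(1)])
  note R = resolutionD[OF H(1)]
  show "star (H 0) = H 0" "H 0 * H 0 = H 0" using R assms by auto
  have "tr (w * H 0) \<le> tr (r * H 0)" by (rule tr_mult_mono[OF assms(2) resolution_pos[OF H(1) assms(3)]])
  then show "tr (w * H 0) = 0"
    using r_H0[OF assms(3)] tr_pos_mult[OF assms(1) resolution_pos[OF H(1) assms(3)]] by simp
qed

lemma pos_pinching_diff:
  assumes w: "pos w" "bounded_by n w" and t: "0 < t"
  shows "pos ((1 + t) *\<^sub>R (P * w * P) + (1 + 1 / t) *\<^sub>R (Q * w * Q) - w)"
proof -
  \<comment> \<open>The two weights have product 1, so \<open>y * w * y\<close> has the off-diagonal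
    blocks of \<open>- w\<close>. Its diagonal blocks carry the weights t and 1/t, to which adding
    \<open>w\<close> contributes 1 each.\<close>
  define y where "y = sqrt t *\<^sub>R P - (1 / sqrt t) *\<^sub>R Q"
  have "w = (P + Q) * w * (P + Q)" using w PQ_unit by simp
  then have w': "w = P * w * P + P * w * Q + Q * w * P + Q * w * Q"
    by (simp add: distrib_left distrib_right add_ac)
  have sy: "star y = y" by (simp add: y_def sP sQ)
  have "y * w * y = t *\<^sub>R (P * w * P) - P * w * Q - Q * w * P + (1 / t) *\<^sub>R (Q * w * Q)"
    using t by (simp add: y_def left_diff_distrib right_diff_distrib scaleR_diff_right)
  also have "\<dots> = (1 + t) *\<^sub>R (P * w * P) + (1 + 1 / t) *\<^sub>R (Q * w * Q)
      - (P * w * P + P * w * Q + Q * w * P + Q * w * Q)"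
    by (simp add: scaleR_add_left)
  finally have "y * w * y = (1 + t) *\<^sub>R (P * w * P) + (1 + 1 / t) *\<^sub>R (Q * w * Q) - w"
    using w' by simp
  then show ?thesis using pos_conj[OF w(1), of y] sy by simp
qed

text \<open>This is \<open>tr_log_upper\<close> for kappa = (\<alpha> P + \<beta> Q) p. Its
  resolution refines \<open>H\<close> by \<open>P\<close> and \<open>Q\<close>, and \<open>N\<close>
  is its inverse square root on the support.\<close>

lemma block_xlnx_le:
  assumes w: "pos w" "bounded_by n w" "pos (r - w)" and t: "0 < t" and ab: "0 < \<alpha>" "0 < \<beta>"
  shows "tr_xlnx n w \<le> tr (w * L) + ln \<alpha> * tr (w * P) + ln \<beta> * tr (w * Q)
    + (1 + t) / \<alpha> * tr (P * w * P * M * (P * w * P) * M)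
    + (1 + 1 / t) / \<beta> * tr (Q * w * Q * M * (Q * w * Q) * M) - tr w"
proof -
  note R = resolutionD[OF H(1)]
  define J where "J = K \<times> (UNIV :: bool set)"
  define F where "F = (\<lambda>(k, c). if c then H k * P else H k * Q)"
  define b where "b = (\<lambda>(k, c). if c then \<alpha> * k else \<beta> * k)"
  define N where "N = (\<Sum>j\<in>J. (1 / sqrt (b j)) *\<^sub>R F j)"
  have split: "sum f J = (\<Sum>k\<in>K. f (k, True) + f (k, False))" for f :: "real \<times> bool \<Rightarrow> 'z :: comm_monoid_add"
    by (simp add: J_def sum.cartesian_product' UNIV_bool add.commute)
  have HHP: "H i * P * (H j * P) = (if i = j then H i * P else 0)"
       "H i * Q * (H j * Q) = (if i = j then H i * Q else 0)"
       "H i * P * (H j * Q) = 0" "H i * Q * (H j * P) = 0" if "i \<in> K" "j \<in> K" for i j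
  proof -
    have 1: "H i * A * (H j * B) = H i * H j * (A * B)" if "A * H j = H j * A" for A B
      using that by (metis mult.assoc)
    show "H i * P * (H j * P) = (if i = j then H i * P else 0)"
      using 1[OF P_H[OF that(2)], of P] R(3) that by (simp add: PP)
    show "H i * Q * (H j * Q) = (if i = j then H i * Q else 0)"
      using 1[OF Q_H[OF that(2)], of Q] R(3) that by (simp add: QQ)
    show "H i * P * (H j * Q) = 0" "H i * Q * (H j * P) = 0"
      using 1[OF P_H[OF that(2)], of Q] 1[OF Q_H[OF that(2)], of P] that by (simp_all add: PQ QP)
  qed
  have F: "resolution n J F"
    unfolding resolution_def
  proof (intro conjI ballI)
    show "finite J" using R(1) by (simp add: J_def)
    fix i assume i: "i \<in> J"
    then show "star (F i) = F i"
      by (cases i) (auto simp: F_def J_def R(2) sP sQ P_H Q_H)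
    fix j assume j: "j \<in> J"
    show "F i * F j = (if i = j then F i else 0)"
      using i j by (cases i; cases j) (auto simp: F_def J_def HHP)
  next
    have "sum F J = (\<Sum>k\<in>K. H k * (P + Q))" unfolding split by (simp add: F_def distrib_left)
    also have "\<dots> = unit n" by (simp add: PQ_unit sum_distrib_right[symmetric] R(4) bounded_by_unit)
    finally show "sum F J = unit n" .
  qed
  have w0: "w * H 0 = 0" if "0 \<in> K" by (rule w_H0[OF w(1,3) that])
  obtain I :: "real set" and E where E: "resolution n I E" "w = (\<Sum>i\<in>I. i *\<^sub>R E i)" "\<And>i. i \<in> I \<Longrightarrow> 0 \<le> i"
    using pos_spectral[OF w(1,2)] by blast
  have "tr_xlnx n w = (\<Sum>i\<in>I. i * ln i * tr (E i))" by (rule tr_xlnx_eq[OF E(2,1,3)])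
  also have "\<dots> \<le> (\<Sum>j\<in>J. tr (w * F j) * ln (b j)) + (\<Sum>j\<in>J. \<Sum>k\<in>J. tr (w * F j * w * F k) / sqrt (b j * b k)) - tr w"
  proof (rule tr_log_upper[OF E(2,1,3) F])
    show "0 \<le> b j" if "j \<in> J" for j using that ab H(3) by (auto simp: b_def J_def)
    show "w * F j = 0" if "j \<in> J" "b j = 0" for j
    proof -
      obtain k c where j: "j = (k, c)" "k \<in> K" using \<open>j \<in> J\<close> by (auto simp: J_def)
      then have "k = 0" using that ab by (auto simp: b_def split: if_splits)
      then have "w * H k = 0" using w0 j by simp
      then show ?thesis using j by (simp add: F_def mult.assoc[symmetric])
    qed
  qed
  also have "(\<Sum>j\<in>J. tr (w * F j) * ln (b j)) = tr (w * L) + ln \<alpha> * tr (w * P) + ln \<beta> * tr (w * Q)"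
  proof -
    have k: "tr (w * F (k, True)) * ln (b (k, True)) + tr (w * F (k, False)) * ln (b (k, False))
      = ln k * tr (w * H k) + ln \<alpha> * tr (w * H k * P) + ln \<beta> * tr (w * H k * Q)" if "k \<in> K" for k
    proof (cases "k = 0")
      case True
      then show ?thesis using w0 that by (simp add: F_def b_def mult.assoc[symmetric])
    next
      case False
      then have "k > 0" using H(3)[OF that] by simp
      moreover have "tr (w * H k) = tr (w * H k * P) + tr (w * H k * Q)"
        using tr_PQ[of "w * H k"] bounded_by_mult[OF w(2) resolution_bounded_by[OF H(1) that]] by simp
      moreover have "w * F (k, True) = w * H k * P" "w * F (k, False) = w * H k * Q"
        by (simp_all add: F_def mult.assoc)
      ultimately show ?thesis using ab by (simp add: b_def ln_mult distrib_left distrib_right)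
    qed
    have "tr (w * L) = (\<Sum>k\<in>K. ln k * tr (w * H k))" by (simp add: L_def sum_distrib_left)
    moreover have "(\<Sum>k\<in>K. tr (w * H k * A)) = tr (w * A)" if "bounded_by n A" for A
    proof -
      have "(\<Sum>k\<in>K. tr (w * H k * A)) = tr (w * sum H K * A)"
        by (simp add: sum_distrib_left sum_distrib_right)
      then show ?thesis using w by (simp add: R(4))
    qed
    ultimately show ?thesis unfolding split using k bP bQ
      by (simp add: sum.distrib sum_distrib_left[symmetric])
  qed
  also have "(\<Sum>j\<in>J. \<Sum>k\<in>J. tr (w * F j * w * F k) / sqrt (b j * b k)) = tr (w * N * w * N)"
  proof -
    have "w * N * w = (\<Sum>j\<in>J. (1 / sqrt (b j)) *\<^sub>R (w * F j * w))"
      unfolding N_def by (simp add: sum_distrib_left sum_distrib_right)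
    then have "w * N * w * N = (\<Sum>j\<in>J. \<Sum>k\<in>J. ((1 / sqrt (b j)) *\<^sub>R (w * F j * w)) * ((1 / sqrt (b k)) *\<^sub>R F k))"
      unfolding N_def by (simp add: sum_product)
    then show ?thesis by (simp add: real_sqrt_mult mult.commute)
  qed
  also have "tr (w * N * w * N) \<le> (1 + t) / \<alpha> * tr (P * w * P * M * (P * w * P) * M)
    + (1 + 1 / t) / \<beta> * tr (Q * w * Q * M * (Q * w * Q) * M)"
  proof -
    have N: "N = (1 / sqrt \<alpha>) *\<^sub>R (M * P) + (1 / sqrt \<beta>) *\<^sub>R (M * Q)"
      unfolding N_def split
      by (simp add: F_def b_def M_def real_sqrt_mult sum.distrib sum_distrib_right scaleR_sum_right)
    have sN: "star N = N" by (simp add: N star_M sP sQ P_M Q_M)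
    have pN: "pos (N * w * N)" using pos_conj[OF w(1), of N] sN by simp
    have PN: "P * N = (1 / sqrt \<alpha>) *\<^sub>R (M * P)" "N * P = (1 / sqrt \<alpha>) *\<^sub>R (M * P)"
      "Q * N = (1 / sqrt \<beta>) *\<^sub>R (M * Q)" "N * Q = (1 / sqrt \<beta>) *\<^sub>R (M * Q)"
      by (simp_all add: N distrib_left distrib_right mult.assoc PP QQ PQ QP)
        (simp_all add: mult.assoc[symmetric] P_M Q_M, simp_all add: mult.assoc PP QQ PQ QP)
    \<comment> \<open>Only the first \<open>w\<close> is replaced by its pinched bound. The second
      one gets compressed as well, because \<open>P\<close> and \<open>Q\<close> pass through
      \<open>N\<close> and around the trace.\<close>
    have "tr (w * N * w * N) = tr (w * (N * w * N))" by (simp add: mult.assoc)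
    also have "\<dots> \<le> tr (((1 + t) *\<^sub>R (P * w * P) + (1 + 1 / t) *\<^sub>R (Q * w * Q)) * (N * w * N))"
      by (rule tr_mult_mono[OF pos_pinching_diff[OF w(1,2) t] pN])
    also have "\<dots> = (1 + t) * tr (P * w * P * (N * w * N)) + (1 + 1 / t) * tr (Q * w * Q * (N * w * N))"
      by (simp add: distrib_right)
    also have "tr (P * w * P * (N * w * N)) = tr (P * w * P * M * (P * w * P) * M) / \<alpha>"
    proof -
      have "tr (P * w * P * (N * w * N)) = tr (P * (w * (P * N) * w * N))" by (simp add: mult.assoc)
      also have "\<dots> = tr (w * (P * N) * w * (N * P))" by (subst tr_commute) (simp add: mult.assoc)
      also have "\<dots> = (1 / sqrt \<alpha>) * (1 / sqrt \<alpha>) * tr (w * (M * P) * w * (M * P))" by (simp add: PN)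
      also have "tr (w * (M * P) * w * (M * P)) = tr (w * (M * P) * w * P * M * P)"
        by (simp add: mult.assoc PP flip: P_M)
      also have "\<dots> = tr (P * (w * (M * P) * w * P * M))" by (rule tr_commute[symmetric])
      also have "M * P = P * M * P" by (metis P_M PP mult.assoc)
      also have "tr (P * (w * (P * M * P) * w * P * M)) = tr (P * w * P * M * (P * w * P) * M)"
        by (simp add: mult.assoc)
      finally show ?thesis using ab by simp
    qed
    also have "tr (Q * w * Q * (N * w * N)) = tr (Q * w * Q * M * (Q * w * Q) * M) / \<beta>"
    proof -
      have "tr (Q * w * Q * (N * w * N)) = tr (Q * (w * (Q * N) * w * N))" by (simp add: mult.assoc)
      also have "\<dots> = tr (w * (Q * N) * w * (N * Q))" by (subst tr_commute) (simp add: mult.assoc)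
      also have "\<dots> = (1 / sqrt \<beta>) * (1 / sqrt \<beta>) * tr (w * (M * Q) * w * (M * Q))" by (simp add: PN)
      also have "tr (w * (M * Q) * w * (M * Q)) = tr (w * (M * Q) * w * Q * M * Q)"
        by (simp add: mult.assoc QQ flip: Q_M)
      also have "\<dots> = tr (Q * (w * (M * Q) * w * Q * M))" by (rule tr_commute[symmetric])
      also have "M * Q = Q * M * Q" by (metis Q_M QQ mult.assoc)
      also have "tr (Q * (w * (Q * M * Q) * w * Q * M)) = tr (Q * w * Q * M * (Q * w * Q) * M)"
        by (simp add: mult.assoc)
      finally show ?thesis using ab by simp
    qed
    finally show ?thesis by simp
  qed
  finally show ?thesis by simp
qed

text \<open>Klein's inequality; the linear terms cancel because pinching preserves the
  trace.\<close>

lemma tr_r_L: "tr (r * L) \<le> tr_xlnx n r"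
proof -
  obtain I :: "real set" and E where E: "resolution n I E" "r = (\<Sum>i\<in>I. i *\<^sub>R E i)" "\<And>i. i \<in> I \<Longrightarrow> 0 \<le> i"
    using pos_spectral[OF r] by blast
  have "(\<Sum>k\<in>K. tr (r * H k) * ln k) + tr r - (\<Sum>k\<in>K. k * tr (H k)) \<le> (\<Sum>i\<in>I. i * ln i * tr (E i))"
    by (rule tr_log_lower[OF E(2,1,3) H(1,3)]) (use r_H0 in auto)
  moreover have "(\<Sum>k\<in>K. k * tr (H k)) = tr r" using tr_p by (simp add: H(2))
  moreover have "(\<Sum>k\<in>K. tr (r * H k) * ln k) = tr (r * L)"
    by (simp add: L_def sum_distrib_left mult.commute)
  ultimately show ?thesis using tr_xlnx_eq[OF E(2,1,3)] by simp
qed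

section \<open>Quadratic terms of the pinched blocks\<close>

lemma quad_P_r: "tr (P * r * P * M * (P * r * P) * M) = tr (r * P)"
proof -
  have "P * r * P * M * (P * r * P) * M = P * (p * M * p * M) * P"
    by (metis P_M P_p mult.assoc)
  also have "\<dots> = P * r * P" unfolding p_M_p_M P_p by (simp add: PP mult.assoc)
  finally show ?thesis using tr_commute[of P "r * P"] by (simp add: mult.assoc PP)
qed

lemma quad_Q_r: "tr (Q * r * Q * M * (Q * r * Q) * M) = tr (r * Q)"
proof -
  have "Q * r * Q * M * (Q * r * Q) * M = Q * (p * M * p * M) * Q"
    by (metis Q_M Q_p mult.assoc)
  also have "\<dots> = Q * r * Q" unfolding p_M_p_M Q_p by (simp add: QQ mult.assoc)
  finally show ?thesis using tr_commute[of Q "r * Q"] by (simp add: mult.assoc QQ)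
qed

text \<open>With \<open>h\<^sup>2 = r\<close>, the operator \<open>h P p\<^sup>-\<^sup>1 P h\<close> (pseudo-inverse) is a projection; this is the
  Schur complement inequality for the block \<open>P r P\<close>.\<close>

lemma schur_complement: "tr (P * (r * r) * P * (M * M)) \<le> tr r"
proof -
  obtain h where h: "star h = h" "bounded_by n h" "h * h = r" using pos_sqrt[OF r] by blast
  define Z where "Z = h * P * (M * M) * P * h"
  have sZ: "star Z = Z" by (simp add: Z_def h sP star_M mult.assoc)
  have bZ: "bounded_by n Z" unfolding Z_def by (intro bounded_by_mult h bP bounded_M)
  have MMP: "M * M * P = P * (M * M)" using P_M by (metis mult.assoc)
  have "Z * Z = h * P * (M * M) * (P * (h * h) * P) * (M * M) * P * h" by (simp add: Z_def mult.assoc)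
  also have "\<dots> = h * P * (M * M) * (P * p) * (M * M) * P * h" by (simp only: h P_p)
  also have "\<dots> = h * P * (P * (M * M * p * (M * M))) * P * h" by (metis MMP mult.assoc)
  also have "\<dots> = Z" unfolding M_M_p_M_M by (simp add: Z_def mult.assoc)
  finally have ZZ: "Z * Z = Z" .
  have "pos ((unit n - Z) * (unit n - Z))" by (rule pos_square) (simp add: sZ)
  also have "(unit n - Z) * (unit n - Z) = unit n - Z"
    using bZ by (simp add: left_diff_distrib right_diff_distrib ZZ bounded_by_unit)
  finally have "0 \<le> tr (r * (unit n - Z))" by (rule tr_pos_mult[OF r(1)])
  then have "tr (r * Z) \<le> tr r" using r(2) by (simp add: right_diff_distrib)
  also have "tr (r * Z) = tr (P * (r * r) * P * (M * M))"
  proof -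
    have "tr (r * Z) = tr (h * (h * h * P * (M * M) * P * h))" by (simp add: Z_def h(3)[symmetric] mult.assoc)
    also have "\<dots> = tr (h * h * P * (M * M) * P * h * h)" by (rule tr_commute)
    also have "\<dots> = tr (r * P * (M * M) * (P * r))" by (simp add: h(3)[symmetric] mult.assoc)
    also have "\<dots> = tr (P * r * (r * P * (M * M)))" by (rule tr_commute)
    finally show ?thesis
      by (simp add: mult.assoc)
  qed
  finally show ?thesis .
qed

text \<open>\<open>P\<close> is defined by comparing squares, so the symmetric form has to be turned
  into one that contains \<open>x * x\<close>. The commutator inequality brings the two factors
  \<open>M\<close> together, and \<open>P * x * P * x * P\<close> misses
  \<open>P * (x * x) * P\<close> only by the positive \<open>P * x * Q * x * P\<close>.\<close>

lemma quad_P_diag: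
  assumes "pos x" "bounded_by n x"
  shows "tr (P * x * P * M * (P * x * P) * M) \<le> tr (P * (x * x) * P * (M * M))"
proof -
  have sx: "star x = x" using assms pos_star by blast
  have "tr (P * x * P * M * (P * x * P) * M) \<le> tr (P * x * P * (P * x * P) * (M * M))"
    by (rule tr_square_commutator) (simp_all add: sP sx star_M mult.assoc)
  also have "\<dots> \<le> tr (P * (x * x) * P * (M * M))"
  proof (rule tr_mult_mono)
    have "x * x = x * (P + Q) * x" using PQ_unit assms by simp
    then have "x * x = x * P * x + x * Q * x" by (simp add: distrib_left distrib_right)
    then have "P * (x * x) * P - P * x * P * (P * x * P) = star (Q * x * P) * (Q * x * P)"
      by (simp add: sP sQ sx distrib_left distrib_right mult.assoc)
    then show "pos (P * (x * x) * P - P * x * P * (P * x * P))" using pos_star_mult by metis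
    show "pos (M * M)" by (rule pos_square[OF star_M])
  qed
  finally show ?thesis .
qed

lemma quad_P_nonneg:
  assumes "pos x" "pos y" shows "0 \<le> tr (P * x * P * M * (P * y * P) * M)"
proof -
  have "tr (P * x * P * M * (P * y * P) * M) = tr ((star P * x * P) * (star (P * M) * y * (P * M)))"
    by (simp add: sP star_M mult.assoc)
  then show ?thesis using tr_pos_mult[OF pos_conj pos_conj] assms by metis
qed

text \<open>Replacing one factor by \<open>r\<close> makes the term linear in \<open>w\<close>;
  summed over the blocks it becomes \<open>tr (r * Q)\<close> by \<open>quad_Q_r\<close>.\<close>

lemma quad_Q_le:
  assumes "pos w" "pos (r - w)"
  shows "tr (Q * w * Q * M * (Q * w * Q) * M) \<le> tr (Q * w * Q * M * (Q * r * Q) * M)"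
proof -
  have "0 \<le> tr ((star Q * w * Q) * (star (Q * M) * (r - w) * (Q * M)))"
    by (intro tr_pos_mult pos_conj assms)
  then show ?thesis by (simp add: sQ star_M mult.assoc left_diff_distrib right_diff_distrib)
qed

end

section \<open>Two-universal hashing\<close>

lemma pos_diff_sum_subset:
  assumes "finite X" "Y \<subseteq> X" "\<And>x. x \<in> X \<Longrightarrow> pos (f x)"
  shows "pos (sum f X - sum f Y)"
proof -
  have "sum f X - sum f Y = sum f (X - Y)" using assms by (simp add: sum_diff)
  then show ?thesis using assms pos_sum[of "X - Y" f] by auto
qed

text \<open>The bound in nats, with \<open>t\<close> still free. Here \<open>\<sigma> x\<close> is
  the weighted state p_x rho_x, \<open>c\<close> is 2^(-\<lambda>), \<open>dom\<close> is what the
  spectral projection provides, and \<open>\<epsilon>\<close> is the exact mass outside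
  \<open>P\<close>.\<close>

lemma universal_hash_xlnx:
  fixes \<sigma> :: "'x \<Rightarrow> fmat" and G :: "('x \<Rightarrow> 's) set" and S :: "'s set"
  assumes fin: "finite X" "finite S" "finite G" "S \<noteq> {}" "G \<noteq> {}"
    and \<sigma>: "\<And>x. x \<in> X \<Longrightarrow> pos (\<sigma> x)" "\<And>x. x \<in> X \<Longrightarrow> bounded_by n (\<sigma> x)"
    and r_def: "r = sum \<sigma> X" "tr r = 1"
    and maps: "\<And>g x. g \<in> G \<Longrightarrow> x \<in> X \<Longrightarrow> g x \<in> S"
    and univ: "\<And>x y. x \<in> X \<Longrightarrow> y \<in> X \<Longrightarrow> x \<noteq> y \<Longrightarrow>
        real (card {g \<in> G. g x = g y}) \<le> real (card G) / real (card S)"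
    and P: "bounded_by n P" "star P = P" "P * P = P"
    and dom: "pos (P * (c *\<^sub>R (r * r) - (\<Sum>x\<in>X. \<sigma> x * \<sigma> x)) * P)"
    and c: "0 \<le> c" and t: "0 < t" and \<epsilon>: "\<epsilon> = 1 - tr (r * P)"
  shows "(\<Sum>g\<in>G. \<Sum>s\<in>S. tr_xlnx n (\<Sum>x | x \<in> X \<and> g x = s. \<sigma> x)) / real (card G)
      - tr_xlnx n r + ln (real (card S))
    \<le> \<epsilon> * ln (real (card S)) + (1 - \<epsilon>) * ln (1 + t) + \<epsilon> * ln (1 + 1 / t) + real (card S) * c"
proof -
  have pr: "pos r" unfolding r_def by (intro pos_sum \<sigma>)
  have br: "bounded_by n r" unfolding r_def by (intro bounded_by_sum \<sigma>)
  define Q where "Q = unit n - P"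
  define p where "p = P * r * P + Q * r * Q"
  have sQ: "star Q = Q" by (simp add: Q_def P)
  have bQ: "bounded_by n Q" using P bounded_by_unit by (auto simp: Q_def bounded_by_entry entry_simps)
  have "pos p" unfolding p_def using pos_conj[OF pr, of P] pos_conj[OF pr, of Q] P sQ by (intro pos_add) auto
  moreover have "bounded_by n p"
    unfolding p_def using bounded_by_sum[of UNIV n "\<lambda>b. if b then P * r * P else Q * r * Q"] P bQ br
    by (simp add: UNIV_bool bounded_by_mult add.commute)
  ultimately obtain K :: "real set" and H where
    K: "resolution n K H" "p = (\<Sum>k\<in>K. k *\<^sub>R H k)" "\<And>k. k \<in> K \<Longrightarrow> 0 \<le> k"
    using pos_spectral by blast
  interpret pinching n P Q r p K H
    by unfold_locales (use P K pr br in \<open>auto simp: Q_def p_def\<close>)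
  define s where "s = real (card S)"
  define m where "m = real (card G)"
  have s: "s > 0" using fin by (simp add: s_def card_gt_0_iff)
  have m: "m > 0" using fin by (simp add: m_def card_gt_0_iff)
  define \<omega> where "\<omega> g z = (\<Sum>x | x \<in> X \<and> g x = z. \<sigma> x)" for g :: "'x \<Rightarrow> 's" and z
  define q where "q x y = tr (P * \<sigma> x * P * M * (P * \<sigma> y * P) * M)" for x y
  have q: "0 \<le> q x y" if "x \<in> X" "y \<in> X" for x y
    unfolding q_def using that \<sigma> by (intro quad_P_nonneg)
  have p\<omega>: "pos (\<omega> g z)" for g z unfolding \<omega>_def by (intro pos_sum) (use \<sigma> in auto)
  have b\<omega>: "bounded_by n (\<omega> g z)" for g z unfolding \<omega>_def by (intro bounded_by_sum) (use \<sigma> in auto)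
  have r\<omega>: "pos (r - \<omega> g z)" for g z
    unfolding \<omega>_def r_def by (rule pos_diff_sum_subset) (use fin \<sigma> in auto)
  have \<omega>_if: "\<omega> g z = (\<Sum>x\<in>X. if g x = z then \<sigma> x else 0)" for g z
    unfolding \<omega>_def by (rule sum.inter_filter[OF fin(1)])
  have sum\<omega>: "(\<Sum>z\<in>S. \<omega> g z) = r" if "g \<in> G" for g
    unfolding \<omega>_if by (subst sum.swap) (use maps[OF that] fin in \<open>simp add: r_def sum.delta\<close>)
  have trr: "tr (r * P) = 1 - \<epsilon>" "tr (r * Q) = \<epsilon>"
    using \<epsilon> tr_PQ[OF br] r_def(2) by auto

  \<comment> \<open>The weights (1 + t)/s and 1 + 1/t turn the prefactors in
    \<open>block_xlnx_le\<close> into s and 1. The final \<open>\<epsilon> - 1\<close> consists of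
    the Q-term \<open>tr (r * Q)\<close> and the total mass.\<close>
  have block: "(\<Sum>z\<in>S. tr_xlnx n (\<omega> g z)) \<le> tr (r * L) + (ln (1 + t) - ln s) * (1 - \<epsilon>) + ln (1 + 1 / t) * \<epsilon>
      + s * (\<Sum>z\<in>S. tr (P * \<omega> g z * P * M * (P * \<omega> g z * P) * M)) + \<epsilon> - 1" if g: "g \<in> G" for g
  proof -
    have "tr_xlnx n (\<omega> g z) \<le> tr (\<omega> g z * L) + (ln (1 + t) - ln s) * tr (\<omega> g z * P) + ln (1 + 1 / t) * tr (\<omega> g z * Q)
        + s * tr (P * \<omega> g z * P * M * (P * \<omega> g z * P) * M)
        + tr (Q * \<omega> g z * Q * M * (Q * r * Q) * M) - tr (\<omega> g z)" for z
    proof -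
      have pt: "0 < 1 + 1 / t" using t by (simp add: add_pos_pos)
      then have e: "(1 + 1 / t) / (1 + 1 / t) = 1" by simp
      have "(1 + t) / ((1 + t) / s) = s" "ln ((1 + t) / s) = ln (1 + t) - ln s"
        using t s by (simp_all add: ln_div)
      then show ?thesis
        using block_xlnx_le[OF p\<omega> b\<omega> r\<omega>, of t "(1 + t) / s" "1 + 1 / t" g z] quad_Q_le[OF p\<omega>[of g z] r\<omega>] t s pt
        unfolding e by simp
    qed
    then have "(\<Sum>z\<in>S. tr_xlnx n (\<omega> g z)) \<le> (\<Sum>z\<in>S. tr (\<omega> g z * L) + (ln (1 + t) - ln s) * tr (\<omega> g z * P)
        + ln (1 + 1 / t) * tr (\<omega> g z * Q) + s * tr (P * \<omega> g z * P * M * (P * \<omega> g z * P) * M)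
        + tr (Q * \<omega> g z * Q * M * (Q * r * Q) * M) - tr (\<omega> g z))"
      by (intro sum_mono)
    also have "\<dots> = tr ((\<Sum>z\<in>S. \<omega> g z) * L) + (ln (1 + t) - ln s) * tr ((\<Sum>z\<in>S. \<omega> g z) * P)
        + ln (1 + 1 / t) * tr ((\<Sum>z\<in>S. \<omega> g z) * Q) + s * (\<Sum>z\<in>S. tr (P * \<omega> g z * P * M * (P * \<omega> g z * P) * M))
        + tr (Q * (\<Sum>z\<in>S. \<omega> g z) * Q * M * (Q * r * Q) * M) - tr (\<Sum>z\<in>S. \<omega> g z)"
      unfolding sum.distrib sum_subtractf sum_distrib_left[symmetric] tr_sum[symmetric] sum_distrib_right[symmetric] ..
    finally show ?thesis by (simp add: sum\<omega>[OF g] trr r_def(2) quad_Q_r)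
  qed

  \<comment> \<open>Expanding the square of a block gives all pairs with the same hash value; after
    summation over \<open>g\<close> each pair counts as often as it collides.\<close>
  have coll: "(\<Sum>g\<in>G. \<Sum>z\<in>S. tr (P * \<omega> g z * P * M * (P * \<omega> g z * P) * M)) \<le> m * (c + (1 - \<epsilon>) / s)"
  proof -
    have "tr (P * \<omega> g z * P * M * (P * \<omega> g z * P) * M)
        = (\<Sum>x\<in>X. \<Sum>y\<in>X. if g x = z \<and> g y = z then q x y else 0)" for g z
    proof -
      define f where "f x = (if g x = z then \<sigma> x else 0)" for x
      have "P * \<omega> g z * P * M * (P * \<omega> g z * P) * M
          = (\<Sum>x\<in>X. \<Sum>y\<in>X. P * f x * P * M * (P * f y * P) * M)"
        unfolding \<omega>_if f_def[symmetric] sum_distrib_left sum_distrib_right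
        by (subst sum.swap) (rule refl)
      then have "tr (P * \<omega> g z * P * M * (P * \<omega> g z * P) * M) = (\<Sum>x\<in>X. \<Sum>y\<in>X. tr (P * f x * P * M * (P * f y * P) * M))"
        by simp
      also have "\<dots> = (\<Sum>x\<in>X. \<Sum>y\<in>X. if g x = z \<and> g y = z then q x y else 0)"
        by (intro sum.cong refl) (auto simp: f_def q_def)
      finally show ?thesis .
    qed
    then have "(\<Sum>g\<in>G. \<Sum>z\<in>S. tr (P * \<omega> g z * P * M * (P * \<omega> g z * P) * M))
      = (\<Sum>g\<in>G. \<Sum>z\<in>S. \<Sum>x\<in>X. \<Sum>y\<in>X. if g x = z \<and> g y = z then q x y else 0)"
      by simp
    also have "\<dots> = (\<Sum>g\<in>G. \<Sum>x\<in>X. \<Sum>y\<in>X. if g x = g y then q x y else 0)"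
    proof (rule sum.cong[OF refl])
      fix g assume g: "g \<in> G"
      have "(\<Sum>z\<in>S. \<Sum>x\<in>X. \<Sum>y\<in>X. if g x = z \<and> g y = z then q x y else 0)
          = (\<Sum>x\<in>X. \<Sum>y\<in>X. \<Sum>z\<in>S. if g x = z \<and> g y = z then q x y else 0)"
        by (subst sum.swap) (rule sum.cong[OF refl], rule sum.swap)
      also have "\<dots> = (\<Sum>x\<in>X. \<Sum>y\<in>X. if g x = g y then q x y else 0)"
      proof (intro sum.cong refl)
        fix x y assume xy: "x \<in> X" "y \<in> X"
        have "(\<Sum>z\<in>S. if g x = z \<and> g y = z then q x y else 0)
            = (\<Sum>z\<in>S. if z = g x then (if g x = g y then q x y else 0) else 0)"
          by (rule sum.cong) auto
        then show "(\<Sum>z\<in>S. if g x = z \<and> g y = z then q x y else 0) = (if g x = g y then q x y else 0)"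
          using maps[OF g xy(1)] fin by simp
      qed
      finally show "(\<Sum>z\<in>S. \<Sum>x\<in>X. \<Sum>y\<in>X. if g x = z \<and> g y = z then q x y else 0)
          = (\<Sum>x\<in>X. \<Sum>y\<in>X. if g x = g y then q x y else 0)" .
    qed
    also have "\<dots> = (\<Sum>x\<in>X. \<Sum>y\<in>X. \<Sum>g\<in>G. if g x = g y then q x y else 0)"
      by (subst sum.swap) (rule sum.cong[OF refl], rule sum.swap)
    also have "\<dots> = (\<Sum>x\<in>X. \<Sum>y\<in>X. real (card {g \<in> G. g x = g y}) * q x y)"
      by (intro sum.cong refl) (simp add: sum.inter_filter[OF fin(3), symmetric])
    \<comment> \<open>Equal pairs collide under all \<open>m\<close> functions, distinct ones under
      at most \<open>m / s\<close>. As \<open>q\<close> is nonnegative, \<open>m / s * q x x\<close>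
      may be added, which completes the double sum to the quadratic form of
      \<open>r\<close>.\<close>
    also have "\<dots> \<le> (\<Sum>x\<in>X. \<Sum>y\<in>X. (if x = y then m * q x x else 0) + m / s * q x y)"
    proof (intro sum_mono)
      fix x y assume xy: "x \<in> X" "y \<in> X"
      show "real (card {g \<in> G. g x = g y}) * q x y \<le> (if x = y then m * q x x else 0) + m / s * q x y"
      proof (cases "x = y")
        case True
        then show ?thesis using m s q[OF xy] by (simp add: m_def)
      next
        case False
        then show ?thesis using mult_right_mono[OF univ[OF xy False] q[OF xy]] by (simp add: m_def s_def)
      qed
    qed
    also have "\<dots> = m * (\<Sum>x\<in>X. q x x) + m / s * (\<Sum>x\<in>X. \<Sum>y\<in>X. q x y)"
      using fin by (simp add: sum.distrib sum_distrib_left)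
    also have "(\<Sum>x\<in>X. \<Sum>y\<in>X. q x y) = 1 - \<epsilon>"
    proof -
      have "P * r * P * M * (P * r * P) * M = (\<Sum>x\<in>X. \<Sum>y\<in>X. P * \<sigma> x * P * M * (P * \<sigma> y * P) * M)"
        unfolding r_def sum_distrib_left sum_distrib_right by (subst sum.swap) (rule refl)
      then have "tr (P * r * P * M * (P * r * P) * M) = (\<Sum>x\<in>X. \<Sum>y\<in>X. q x y)" by (simp add: q_def)
      then show ?thesis using quad_P_r trr by simp
    qed
    also have "(\<Sum>x\<in>X. q x x) \<le> c"
    proof -
      have "(\<Sum>x\<in>X. q x x) \<le> (\<Sum>x\<in>X. tr (P * (\<sigma> x * \<sigma> x) * P * (M * M)))"
        unfolding q_def by (intro sum_mono quad_P_diag \<sigma>)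
      also have "\<dots> = tr (P * (\<Sum>x\<in>X. \<sigma> x * \<sigma> x) * P * (M * M))"
        by (simp add: sum_distrib_left sum_distrib_right)
      also have "\<dots> \<le> tr (P * (c *\<^sub>R (r * r)) * P * (M * M))"
      proof (rule tr_mult_mono)
        show "pos (P * (c *\<^sub>R (r * r)) * P - P * (\<Sum>x\<in>X. \<sigma> x * \<sigma> x) * P)"
          using dom by (simp add: left_diff_distrib right_diff_distrib)
        show "pos (M * M)" by (rule pos_square[OF star_M])
      qed
      also have "\<dots> = c * tr (P * (r * r) * P * (M * M))" by simp
      also have "\<dots> \<le> c * 1" using schur_complement r_def(2) c by (intro mult_left_mono) simp_all
      finally show ?thesis by simp
    qed
    finally show ?thesis using m by (simp add: algebra_simps)
  qed

  have "(\<Sum>g\<in>G. \<Sum>z\<in>S. tr_xlnx n (\<omega> g z)) \<le> (\<Sum>g\<in>G. (tr (r * L) + (ln (1 + t) - ln s) * (1 - \<epsilon>) + ln (1 + 1 / t) * \<epsilon> + \<epsilon> - 1)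
      + s * (\<Sum>z\<in>S. tr (P * \<omega> g z * P * M * (P * \<omega> g z * P) * M)))"
    by (intro sum_mono) (use block in \<open>simp add: algebra_simps\<close>)
  also have "\<dots> = m * (tr (r * L) + (ln (1 + t) - ln s) * (1 - \<epsilon>) + ln (1 + 1 / t) * \<epsilon> + \<epsilon> - 1)
      + s * (\<Sum>g\<in>G. \<Sum>z\<in>S. tr (P * \<omega> g z * P * M * (P * \<omega> g z * P) * M))"
    unfolding sum.distrib sum_distrib_left[symmetric] by (simp add: m_def)
  also have "\<dots> \<le> m * (tr_xlnx n r + (ln (1 + t) - ln s) * (1 - \<epsilon>) + ln (1 + 1 / t) * \<epsilon> + \<epsilon> - 1)
      + s * (m * (c + (1 - \<epsilon>) / s))"
    using tr_r_L m s coll by (intro add_mono mult_left_mono) simp_all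
  \<comment> \<open>The share (1 - \<epsilon>)/s of the collision bound, multiplied by
    \<open>s * m\<close>, cancels \<open>m * (\<epsilon> - 1)\<close>.\<close>
  also have "\<dots> = m * (tr_xlnx n r + (ln (1 + t) - ln s) * (1 - \<epsilon>) + ln (1 + 1 / t) * \<epsilon> + s * c)"
    using s by (simp add: field_simps)
  finally have "(\<Sum>g\<in>G. \<Sum>z\<in>S. tr_xlnx n (\<omega> g z)) / m
      \<le> tr_xlnx n r + (ln (1 + t) - ln s) * (1 - \<epsilon>) + ln (1 + 1 / t) * \<epsilon> + s * c"
    using m by (simp add: pos_divide_le_eq mult.commute)
  then show ?thesis unfolding \<omega>_def m_def[symmetric] s_def[symmetric] by (simp add: algebra_simps)
qed

section \<open>Choice of the free parameter\<close>

lemma ln_one_plus_square_le: "0 \<le> u \<Longrightarrow> ln (1 + u\<^sup>2) \<le> (u :: real)"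
proof -
  assume u: "0 \<le> u"
  \<comment> \<open>The quadratic Taylor bound for \<open>exp u\<close> itself falls below 1 + u^2
    for u > 2; squaring the one at \<open>u / 2\<close> supplies cubic and quartic terms.\<close>
  have "1 + u / 2 + (u / 2)\<^sup>2 / 2 \<le> exp (u / 2)" using u by (intro exp_lower_Taylor_quadratic) simp
  then have "(1 + u / 2 + (u / 2)\<^sup>2 / 2)\<^sup>2 \<le> (exp (u / 2))\<^sup>2" using u by (intro power_mono) auto
  also have "(exp (u / 2))\<^sup>2 = exp u" by (simp add: power2_eq_square flip: exp_add)
  finally have e: "(1 + u / 2 + (u / 2)\<^sup>2 / 2)\<^sup>2 \<le> exp u" .
  have "(1 + u / 2 + (u / 2)\<^sup>2 / 2)\<^sup>2 = 1 + u\<^sup>2 + u * ((u / 2 - 1)\<^sup>2 / 2 + 1 / 2) + (u\<^sup>2)\<^sup>2 / 64"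
    by (simp add: power2_eq_square field_simps)
  moreover have "0 \<le> u * ((u / 2 - 1)\<^sup>2 / 2 + 1 / 2) + (u\<^sup>2)\<^sup>2 / 64" using u by simp
  ultimately have "1 + u\<^sup>2 \<le> exp u" using e by linarith
  then have "ln (1 + u\<^sup>2) \<le> ln (exp u)" by (subst ln_le_cancel_iff) (auto intro: add_pos_nonneg)
  then show ?thesis by simp
qed

text \<open>At \<open>t = \<epsilon>\<close> the first logarithmic term is at most
  \<open>\<epsilon>\<close> and, by \<open>ln_one_plus_square_le\<close> with
  \<open>u = 1 / sqrt \<epsilon>\<close>, the second at most \<open>sqrt \<epsilon>\<close>. For
  \<open>\<epsilon> = 0\<close> this \<open>t\<close> is not admissible and one lets
  \<open>t\<close> tend to 0.\<close>

lemma binary_term_bound: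
  fixes \<epsilon> D B :: real
  assumes "0 \<le> \<epsilon>" "\<epsilon> \<le> 1" "\<And>t. 0 < t \<Longrightarrow> D \<le> B + (1 - \<epsilon>) * ln (1 + t) + \<epsilon> * ln (1 + 1 / t)"
  shows "D \<le> B + \<epsilon> + sqrt \<epsilon>"
proof (cases "\<epsilon> = 0")
  case True
  have "D \<le> B + t" if "0 < t" for t
    using assms(3)[OF that] True ln_add_one_self_le_self[of t] that by simp
  then show ?thesis using True by (auto intro: field_le_epsilon)
next
  case False
  then have e: "\<epsilon> > 0" using assms by simp
  have "(1 - \<epsilon>) * ln (1 + \<epsilon>) \<le> 1 * ln (1 + \<epsilon>)" using assms by (intro mult_right_mono) auto
  also have "\<dots> \<le> \<epsilon>" using ln_add_one_self_le_self[of \<epsilon>] e by simp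
  finally have 1: "(1 - \<epsilon>) * ln (1 + \<epsilon>) \<le> \<epsilon>" .
  have "ln (1 + 1 / \<epsilon>) \<le> 1 / sqrt \<epsilon>"
    using ln_one_plus_square_le[of "1 / sqrt \<epsilon>"] e by (simp add: power_divide)
  then have "\<epsilon> * ln (1 + 1 / \<epsilon>) \<le> \<epsilon> * (1 / sqrt \<epsilon>)" using e by (intro mult_left_mono) auto
  also have "\<dots> = sqrt \<epsilon>" using e by (simp add: real_div_sqrt)
  finally show ?thesis using assms(3)[OF e] 1 by linarith
qed

section \<open>Matrix functions through spectral resolutions\<close>

lemma mprod_eigen:
  assumes "bounded_by n f" "\<And>x. x \<in> set xs \<Longrightarrow> A x \<in> carrier_mat n n"
    and "\<And>x. x \<in> set xs \<Longrightarrow> emb (A x) * f = c x *\<^sub>R f"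
  shows "mprod n xs A \<in> carrier_mat n n \<and> emb (mprod n xs A) * f = (\<Prod>x\<leftarrow>xs. c x) *\<^sub>R f"
  using assms(2,3)
proof (induction xs)
  case Nil
  then show ?case using assms(1) by (simp add: mprod_def emb_one)
next
  case (Cons x xs)
  then have IH: "mprod n xs A \<in> carrier_mat n n" "emb (mprod n xs A) * f = (\<Prod>x\<leftarrow>xs. c x) *\<^sub>R f"
    and x: "A x \<in> carrier_mat n n" "emb (A x) * f = c x *\<^sub>R f" by auto
  have "mprod n (x # xs) A = A x * mprod n xs A" by (simp add: mprod_def)
  moreover have "emb (A x * mprod n xs A) = emb (A x) * emb (mprod n xs A)"
    using IH x by (intro emb_mult) auto
  ultimately show ?case using IH x by (simp add: mult.assoc)
qed

text \<open>Everything is evaluated on one \<open>F j\<close> at a time, where \<open>A\<close> acts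
  as the scalar \<open>a j\<close>. The Lagrange product for \<open>r\<close> has all factors 1 if
  \<open>a j = r\<close>; otherwise its factor for \<open>\<mu> = a j\<close> vanishes. That factor
  occurs because \<open>a j\<close> lies in \<open>rspec A\<close>, a nonzero column of
  \<open>F j\<close> being an eigenvector.\<close>

lemma emb_mfun:
  assumes A: "A \<in> carrier_mat n n" and F: "resolution n J F" "\<And>j. j \<in> J \<Longrightarrow> F j \<noteq> 0"
    and emb: "emb A = (\<Sum>j\<in>J. a j *\<^sub>R F j)"
  shows "mfun f A \<in> carrier_mat n n \<and> emb (mfun f A) = (\<Sum>j\<in>J. f (a j) *\<^sub>R F j)"
proof -
  note R = resolutionD[OF F(1)]
  have "finite (spectrum A)" using card_finite_spectrum[OF A] by simp
  then have fin: "finite (rspec A)"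
    unfolding rspec_def using finite_vimageI[of "spectrum A" complex_of_real]
    by (simp add: inj_def spectrum_def vimage_def)
  have AF: "emb A * F j = a j *\<^sub>R F j" if "j \<in> J" for j
    unfolding emb by (rule resolution_fun_proj(1)[OF F(1) that])
  have spec: "a j \<in> rspec A" if j: "j \<in> J" for j
  proof -
    obtain k l where kl: "entry (F j) k l \<noteq> 0" using F(2)[OF j] fmat_eqI[of "F j" 0] by (auto simp: entry_zero)
    have bF: "bounded_by n (F j)" by (rule resolution_bounded_by[OF F(1) j])
    define v where "v = vec n (\<lambda>i. entry (F j) i l)"
    have "k < n" using kl bounded_byD[OF bF, of k l] by force
    then have "v \<noteq> 0\<^sub>v n" using kl by (auto simp: v_def vec_eq_iff)
    moreover have "A *\<^sub>v v = complex_of_real (a j) \<cdot>\<^sub>v v"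
    proof (rule eq_vecI)
      fix i assume "i < dim_vec (complex_of_real (a j) \<cdot>\<^sub>v v)"
      then have i: "i < n" by (simp add: v_def)
      have "(A *\<^sub>v v) $ i = (\<Sum>m<n. entry (emb A) i m * entry (F j) m l)"
        using A i by (auto simp: v_def scalar_prod_def lessThan_atLeast0 entry_emb intro!: sum.cong)
      also have "\<dots> = entry (emb A * F j) i l" by (simp add: entry_mult_right[OF bF])
      also have "\<dots> = (complex_of_real (a j) \<cdot>\<^sub>v v) $ i" using i by (simp add: AF[OF j] entry_simps v_def)
      finally show "(A *\<^sub>v v) $ i = (complex_of_real (a j) \<cdot>\<^sub>v v) $ i" .
    qed (use A in \<open>simp add: v_def\<close>)
    ultimately have "eigenvector A v (complex_of_real (a j))"
      using A by (simp add: eigenvector_def v_def)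
    then show ?thesis by (auto simp: rspec_def eigenvalue_def)
  qed
  let ?step = "\<lambda>r \<mu>. complex_of_real (1 / (r - \<mu>)) \<cdot>\<^sub>m (A - complex_of_real \<mu> \<cdot>\<^sub>m 1\<^sub>m (dim_row A))"
  have step: "?step r \<mu> \<in> carrier_mat n n" for r \<mu> using A by auto
  have stepF: "emb (?step r \<mu>) * F j = ((1 / (r - \<mu>)) * (a j - \<mu>)) *\<^sub>R F j" if "j \<in> J" for r \<mu> j
  proof -
    have "emb (?step r \<mu>) = (1 / (r - \<mu>)) *\<^sub>R (emb A - \<mu> *\<^sub>R unit n)"
      using A emb_minus[of A "complex_of_real \<mu> \<cdot>\<^sub>m 1\<^sub>m (dim_row A)"] by (simp only: emb_smult) (simp add: emb_smult emb_one)
    then show ?thesis using AF[OF that] resolution_bounded_by[OF F(1) that]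
      by (simp add: left_diff_distrib scaleR_diff_left[symmetric])
  qed
  have eig: "eigproj A r \<in> carrier_mat n n \<and> emb (eigproj A r) * F j = (if a j = r then F j else 0)"
    if j: "j \<in> J" for r j
  proof -
    let ?xs = "[\<mu> \<leftarrow> sorted_list_of_set (rspec A). \<mu> \<noteq> r]"
    have *: "eigproj A r \<in> carrier_mat n n \<and>
        emb (eigproj A r) * F j = (\<Prod>\<mu>\<leftarrow>?xs. 1 / (r - \<mu>) * (a j - \<mu>)) *\<^sub>R F j"
      using mprod_eigen[OF resolution_bounded_by[OF F(1) j], of ?xs "?step r" "\<lambda>\<mu>. 1 / (r - \<mu>) * (a j - \<mu>)"]
        step stepF[OF j] A unfolding eigproj_def by simp
    show ?thesis
    proof (cases "a j = r")
      case True
      have "(\<Prod>\<mu>\<leftarrow>?xs. 1 / (r - \<mu>) * (a j - \<mu>)) = (\<Prod>\<mu>\<leftarrow>?xs. 1)"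
        by (rule arg_cong[of _ _ prod_list], rule map_cong) (use True in auto)
      also have "\<dots> = 1" by (simp add: map_replicate_const prod_list_replicate)
      finally show ?thesis using * True by simp
    next
      case False
      then have "a j \<in> set ?xs" using spec[OF j] fin by simp
      then have "(\<Prod>\<mu>\<leftarrow>?xs. 1 / (r - \<mu>) * (a j - \<mu>)) = 0"
        by (simp add: prod_list_zero_iff) (rule image_eqI[of _ _ "a j"], auto)
      then show ?thesis using * False by simp
    qed
  qed
  have car: "eigproj A r \<in> carrier_mat n n" for r
    using mprod_eigen[of n 0 "[\<mu> \<leftarrow> sorted_list_of_set (rspec A). \<mu> \<noteq> r]" "?step r" "\<lambda>_. 0"] step A
    unfolding eigproj_def by (simp add: bounded_by_entry entry_zero)
  have ms: "mfun f A \<in> carrier_mat n n" "emb (mfun f A) = (\<Sum>r\<in>rspec A. f r *\<^sub>R emb (eigproj A r))"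
    using emb_msum[of "sorted_list_of_set (rspec A)" "\<lambda>r. complex_of_real (f r) \<cdot>\<^sub>m eigproj A r" n] car A fin
    by (simp_all add: mfun_def emb_smult sum_list_distinct_conv_sum_set)
  have "emb (mfun f A) = emb (mfun f A) * sum F J" using bounded_by_emb[OF ms(1)] R(4) by simp
  also have "\<dots> = (\<Sum>j\<in>J. f (a j) *\<^sub>R F j)"
    unfolding sum_distrib_left
  proof (rule sum.cong[OF refl])
    fix j assume j: "j \<in> J"
    have "emb (mfun f A) * F j = (\<Sum>r\<in>rspec A. if r = a j then f (a j) *\<^sub>R F j else 0)"
      unfolding ms(2) sum_distrib_right by (rule sum.cong) (use eig[OF j] in auto)
    then show "emb (mfun f A) * F j = f (a j) *\<^sub>R F j" using spec[OF j] fin by simp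
  qed
  finally show ?thesis using ms by blast
qed

section \<open>Block decompositions\<close>

lift_definition incl :: "nat \<Rightarrow> nat \<Rightarrow> fmat" is "\<lambda>n k i a. if i = k * n + a \<and> a < n then 1 else 0"
proof -
  fix n k :: nat
  show "\<exists>N. \<forall>i a. N \<le> i \<or> N \<le> a \<longrightarrow> (if i = k * n + a \<and> a < n then 1 else 0 :: complex) = 0"
    by (rule exI[of _ "k * n + n"]) auto
qed

text \<open>\<open>incl n k\<close> is the isometry onto the \<open>k\<close>-th block of length \<open>n\<close>.\<close>

definition block :: "nat \<Rightarrow> nat \<Rightarrow> fmat \<Rightarrow> fmat" where
  "block n k x = incl n k * x * star (incl n k)"

lemma entry_incl: "entry (incl n k) i a = (if i = k * n + a \<and> a < n then 1 else 0)"
  by (simp add: incl.rep_eq)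

lemma bounded_by_incl: "bounded_by (k * n + n) (incl n k)"
  by (auto simp: bounded_by_entry entry_incl)

lemma index_eq_div_mod: "a < n \<Longrightarrow> i = k * n + a \<longleftrightarrow> k = i div n \<and> a = i mod n" for i :: nat
  by auto

lemma star_incl_incl: "star (incl n k) * incl n l = (if k = l then unit n else 0)"
proof (rule fmat_eqI)
  fix a b
  have "entry (star (incl n k) * incl n l) a b
      = (\<Sum>i<l * n + n. if i = l * n + b then (if k * n + a = i \<and> a < n \<and> b < n then 1 else 0) else 0)"
    unfolding entry_mult_right[OF bounded_by_incl]
    by (rule sum.cong) (auto simp: entry_star entry_incl)
  also have "\<dots> = (if k * n + a = l * n + b \<and> a < n \<and> b < n then 1 else 0)" by auto
  also have "\<dots> = entry (if k = l then unit n else 0) a b"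
    using index_eq_div_mod[of b n "k * n + a" l] by (auto simp: entry_unit entry_zero)
  finally show "entry (star (incl n k) * incl n l) a b = entry (if k = l then unit n else 0) a b" .
qed

lemma entry_block:
  assumes n: "0 < n"
  shows "entry (block n k x) i j = (if i div n = k \<and> j div n = k then entry x (i mod n) (j mod n) else 0)"
proof -
  have 1: "entry (incl n k * y) i b = (if i div n = k then entry y (i mod n) b else 0)" for y i b
  proof -
    have "entry (incl n k * y) i b = (\<Sum>a<k * n + n. if a = i mod n then (if i div n = k then entry y (i mod n) b else 0) else 0)"
      unfolding entry_mult_left[OF bounded_by_incl]
      by (rule sum.cong) (use n in \<open>auto simp: entry_incl\<close>)
    moreover have "i mod n < k * n + n" using n by (simp add: trans_less_add2)
    ultimately show ?thesis by simp
  qed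
  have "entry (block n k x) i j = (if i div n = k then entry (x * star (incl n k)) (i mod n) j else 0)"
    by (simp add: block_def mult.assoc 1)
  moreover have "entry (x * star (incl n k)) (i mod n) j = cnj (entry (incl n k * star x) j (i mod n))"
    using entry_star[of "incl n k * star x" "i mod n" j] by simp
  ultimately show ?thesis by (simp add: 1 entry_star)
qed

lemma star_block [simp]: "star (block n k x) = block n k (star x)"
  by (simp add: block_def mult.assoc)

lemma block_scaleR [simp]: "block n k (c *\<^sub>R x) = c *\<^sub>R block n k x"
  by (simp add: block_def)

lemma block_sum: "block n k (sum f A) = (\<Sum>a\<in>A. block n k (f a))"
  by (simp add: block_def sum_distrib_left sum_distrib_right)

lemma block_mult:
  assumes "bounded_by n x"
  shows "block n k x * block n l y = (if k = l then block n k (x * y) else 0)"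
proof -
  have "block n k x * block n l y = incl n k * (x * (star (incl n k) * incl n l)) * y * star (incl n l)"
    by (simp add: block_def mult.assoc)
  also have "\<dots> = (if k = l then incl n k * x * y * star (incl n k) else 0)"
    using assms by (simp add: star_incl_incl)
  finally show ?thesis by (simp add: block_def mult.assoc)
qed

lemma tr_block: assumes "bounded_by n x" shows "tr (block n k x) = tr x"
proof -
  have "tr (block n k x) = tr (x * (star (incl n k) * incl n k))"
    unfolding block_def by (subst mult.assoc, subst tr_commute) (simp add: mult.assoc)
  then show ?thesis using assms by (simp add: star_incl_incl)
qed

lemma block_nonzero:
  assumes "bounded_by n x" "x \<noteq> 0" shows "block n k x \<noteq> 0"
proof
  assume "block n k x = 0"
  then have "star (incl n k) * block n k x * incl n k = 0" by simp
  moreover have "star (incl n k) * block n k x * incl n k = unit n * x * unit n"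
    unfolding block_def by (metis star_incl_incl mult.assoc)
  ultimately show False using assms by simp
qed

text \<open>The states are nested Kronecker products over S and then G; this flattens the two
  registers into a single block index.\<close>

lemma incl_mult_incl:
  assumes "i < m" shows "incl (m * n) s * incl n i = incl n (s * m + i)"
proof (rule fmat_eqI)
  fix I a
  have "entry (incl (m * n) s * incl n i) I a
      = (\<Sum>l<i * n + n. if l = i * n + a then (if I = s * (m * n) + l \<and> l < m * n \<and> a < n then 1 else 0) else 0)"
    unfolding entry_mult_right[OF bounded_by_incl]
    by (rule sum.cong) (auto simp: entry_incl)
  also have "\<dots> = (if I = s * (m * n) + (i * n + a) \<and> i * n + a < m * n \<and> a < n then 1 else 0)" by auto
  also have "\<dots> = entry (incl n (s * m + i)) I a"
  proof -
    have "i * n + a < m * n" if "a < n"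
    proof -
      have "i * n + a < (i + 1) * n" using that by simp
      also have "\<dots> \<le> m * n" using assms by (intro mult_right_mono) auto
      finally show ?thesis .
    qed
    then show ?thesis by (auto simp: entry_incl algebra_simps)
  qed
  finally show "entry (incl (m * n) s * incl n i) I a = entry (incl n (s * m + i)) I a" .
qed

lemma block_block: "i < m \<Longrightarrow> block (m * n) s (block n i x) = block n (s * m + i) x"
proof -
  assume i: "i < m"
  have "block (m * n) s (block n i x) = (incl (m * n) s * incl n i) * x * star (incl (m * n) s * incl n i)"
    by (simp add: block_def mult.assoc)
  then show ?thesis by (simp add: incl_mult_incl[OF i] block_def)
qed

lemma sum_block_unit:
  assumes n: "0 < n" shows "(\<Sum>k<N. block n k (unit n)) = unit (N * n)"
proof (rule fmat_eqI)
  fix i j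
  have "entry (\<Sum>k<N. block n k (unit n)) i j = (\<Sum>k<N. if k = i div n then (if j div n = i div n \<and> i mod n = j mod n then 1 else 0) else 0)"
    unfolding entry_sum by (rule sum.cong) (use n in \<open>auto simp: entry_block entry_unit\<close>)
  also have "\<dots> = (if i div n < N \<and> j div n = i div n \<and> i mod n = j mod n then 1 else 0)" by simp
  also have "j div n = i div n \<and> i mod n = j mod n \<longleftrightarrow> i = j" by (metis div_mult_mod_eq)
  also have "(if i div n < N \<and> i = j then 1 else 0) = entry (unit (N * n)) i j" using n by (simp add: entry_unit less_mult_imp_div_less div_less_iff_less_mult)
  finally show "entry (\<Sum>k<N. block n k (unit n)) i j = entry (unit (N * n)) i j" .
qed

section \<open>Classical registers as block-diagonal operators\<close>

lemma kron_carrier: "A \<in> carrier_mat a b \<Longrightarrow> B \<in> carrier_mat c d \<Longrightarrow> kron A B \<in> carrier_mat (a * c) (b * d)"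
  by (simp add: kron_def)

lemma emb_kron_ketbra:
  assumes B: "B \<in> carrier_mat n n" and n: "0 < n" and s: "s < m"
  shows "emb (kron (complex_of_real c \<cdot>\<^sub>m ketbra m s) B) = c *\<^sub>R block n s (emb B)"
proof (rule fmat_eqI)
  fix i j
  have lt: "i < m * n \<longleftrightarrow> i div n < m" for i using n by (simp add: div_less_iff_less_mult)
  show "entry (emb (kron (complex_of_real c \<cdot>\<^sub>m ketbra m s) B)) i j = entry (c *\<^sub>R block n s (emb B)) i j"
    using B n s by (auto simp: entry_emb entry_block entry_simps kron_def ketbra_def lt)
qed

lemma emb_kron_one:
  assumes B: "B \<in> carrier_mat n n" and n: "0 < n"
  shows "emb (kron (complex_of_real c \<cdot>\<^sub>m 1\<^sub>m m) B) = c *\<^sub>R (\<Sum>s<m. block n s (emb B))"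
proof (rule fmat_eqI)
  fix i j
  have lt: "i < m * n \<longleftrightarrow> i div n < m" for i using n by (simp add: div_less_iff_less_mult)
  have "entry (c *\<^sub>R (\<Sum>s<m. block n s (emb B))) i j
      = of_real c * (\<Sum>s<m. if s = i div n then (if j div n = i div n then entry (emb B) (i mod n) (j mod n) else 0) else 0)"
    unfolding entry_scaleR entry_sum by (rule arg_cong2[of _ _ _ _ "(*)"], rule refl, rule sum.cong) (use n in \<open>auto simp: entry_block\<close>)
  then show "entry (emb (kron (complex_of_real c \<cdot>\<^sub>m 1\<^sub>m m) B)) i j = entry (c *\<^sub>R (\<Sum>s<m. block n s (emb B))) i j"
    using B n by (auto simp: entry_emb kron_def lt)
qed

lemma pos_emb:
  assumes "psd n A" shows "pos (emb A)"
  unfolding pos_def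
proof safe
  have A: "A \<in> carrier_mat n n" "mat_adjoint A = A" "\<And>v. v \<in> carrier_vec n \<Longrightarrow> 0 \<le> Re ((A *\<^sub>v v) \<bullet>c v)"
    using assms by (auto simp: psd_def hermitian_def)
  show "star (emb A) = emb A" using A emb_adjoint[of A] by simp
  fix x
  obtain N where N: "N \<ge> n" "bounded_by N x" using bounded_by_ex_ge by blast
  have sN: "bounded_by N (star x)" using N by simp
  have bA: "bounded_by n (emb A)" by (rule bounded_by_emb[OF A(1)])
  have bN: "bounded_by N (star x * emb A * x)"
    using N sN bounded_by_mono[OF bA] by (intro bounded_by_mult)
  have "0 \<le> Re (entry (star x * emb A * x) j j)" for j
  proof -
    define v where "v = vec n (\<lambda>k. entry x k j)"
    have Av: "entry (emb A * x) i j = (if i < n then (A *\<^sub>v v) $ i else 0)" for i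
      unfolding entry_mult_left[OF bA]
      using A(1) by (auto simp: entry_emb v_def scalar_prod_def lessThan_atLeast0 intro!: sum.cong)
    have "entry (star x * emb A * x) j j = (\<Sum>i<N. cnj (entry x i j) * entry (emb A * x) i j)"
      by (simp add: mult.assoc entry_mult_left[OF sN] entry_star)
    also have "\<dots> = (\<Sum>i<n. cnj (entry x i j) * entry (emb A * x) i j)"
      by (rule sum.mono_neutral_right) (use N Av in auto)
    also have "\<dots> = (A *\<^sub>v v) \<bullet>c v"
      using A(1) by (auto simp: Av scalar_prod_def v_def lessThan_atLeast0 mult.commute intro!: sum.cong)
    finally show ?thesis using A(3)[of v] by (simp add: v_def)
  qed
  then show "0 \<le> tr (star x * emb A * x)" unfolding tr_eq[OF bN] by (intro sum_nonneg)
qed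

lemma resolution_blocks:
  assumes n: "0 < n" and R: "\<And>k. k < N \<Longrightarrow> resolution n (J k) (F k)"
  shows "resolution (N * n) (SIGMA k:{..<N}. J k) (\<lambda>(k, j). block n k (F k j))"
  unfolding resolution_def
proof (intro conjI ballI)
  note R' = resolutionD[OF R]
  show "finite (SIGMA k:{..<N}. J k)" using R'(1) by auto
  fix i assume "i \<in> (SIGMA k:{..<N}. J k)"
  then obtain k a where i: "i = (k, a)" "k < N" "a \<in> J k" by auto
  show "star ((\<lambda>(k, j). block n k (F k j)) i) = (\<lambda>(k, j). block n k (F k j)) i"
    using i R'(2) by simp
  fix j assume "j \<in> (SIGMA k:{..<N}. J k)"
  then obtain l b where j: "j = (l, b)" "l < N" "b \<in> J l" by auto
  have "block n k (F k a) * block n l (F l b) = (if k = l then block n k (F k a * F l b) else 0)"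
    using resolution_bounded_by[OF R[OF i(2)] i(3)] by (rule block_mult)
  then show "(\<lambda>(k, j). block n k (F k j)) i * (\<lambda>(k, j). block n k (F k j)) j = (if i = j then (\<lambda>(k, j). block n k (F k j)) i else 0)"
    using i j R'(3) by (auto simp: block_def)
next
  note R' = resolutionD[OF R]
  have "sum (\<lambda>(k, j). block n k (F k j)) (SIGMA k:{..<N}. J k) = (\<Sum>k<N. \<Sum>j\<in>J k. block n k (F k j))"
    using R'(1) by (subst sum.Sigma) auto
  also have "\<dots> = (\<Sum>k<N. block n k (unit n))" using R'(4) by (simp add: block_sum[symmetric])
  finally show "sum (\<lambda>(k, j). block n k (F k j)) (SIGMA k:{..<N}. J k) = unit (N * n)"
    by (simp add: sum_block_unit[OF n])
qed

text \<open>With \<open>w = h * h\<close> the norm of \<open>h * z\<close> is bounded by the form of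
  \<open>r\<close> at \<open>z\<close>. This gives the support condition in
  \<open>rel_entropy\<close>, since every block lies below \<open>r\<close>.\<close>

lemma pos_le_kernel:
  assumes "pos w" "pos (r - w)" "r * z = 0" shows "w * z = 0"
proof -
  obtain n where "bounded_by n w" using bounded_by_ex by blast
  then obtain h where h: "star h = h" "h * h = w" using pos_sqrt[OF assms(1)] by blast
  have "0 \<le> tr (star z * (r - w) * z)" using assms(2) by (simp add: pos_def)
  then have "tr (star z * w * z) \<le> 0"
    using assms(3) tr_diff[of 0 "star z * (w * z)"] by (simp add: left_diff_distrib right_diff_distrib mult.assoc)
  moreover have e: "star z * w * z = star (h * z) * (h * z)" using h by (metis mult.assoc star_mult)
  ultimately have "tr (star (h * z) * (h * z)) = 0"
    using tr_star_mult_nonneg[of "h * z"] unfolding e by linarith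
  then have "h * z = 0" using tr_star_mult_eq_0 by blast
  then show ?thesis using h by (metis mult.assoc mult_zero_right)
qed

lemma tr_xlnx_scale:
  assumes "pos w" "bounded_by n w" "0 < c"
  shows "tr_xlnx n (c *\<^sub>R w) = c * tr_xlnx n w + c * ln c * tr w"
proof -
  obtain J :: "real set" and F where F: "resolution n J F" "w = (\<Sum>r\<in>J. r *\<^sub>R F r)" "\<And>r. r \<in> J \<Longrightarrow> 0 \<le> r"
    using pos_spectral[OF assms(1,2)] by blast
  have cw: "c *\<^sub>R w = (\<Sum>r\<in>J. (c * r) *\<^sub>R F r)" by (simp add: F(2) scaleR_sum_right)
  have "tr_xlnx n (c *\<^sub>R w) = (\<Sum>r\<in>J. c * r * ln (c * r) * tr (F r))"
    by (rule tr_xlnx_eq[OF cw F(1)]) (use F(3) assms(3) in auto)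
  also have "\<dots> = (\<Sum>r\<in>J. c * (r * ln r * tr (F r)) + c * ln c * (r * tr (F r)))"
  proof (rule sum.cong[OF refl])
    fix r assume "r \<in> J"
    then show "c * r * ln (c * r) * tr (F r) = c * (r * ln r * tr (F r)) + c * ln c * (r * tr (F r))"
      using F(3)[of r] assms(3) by (cases "r = 0") (auto simp: ln_mult algebra_simps)
  qed
  also have "\<dots> = c * tr_xlnx n w + c * ln c * tr w"
    using tr_xlnx_eq[OF F(2,1,3)] F(2)[THEN arg_cong[of _ _ tr]]
    by (simp add: sum.distrib sum_distrib_left)
  finally show ?thesis .
qed

text \<open>All blocks of \<open>B\<close> carry the same operator, so only the sum \<open>r\<close>
  of the blocks of \<open>A\<close> enters Tr (A ln B). The relative entropy thus reduces to
  \<open>tr_xlnx\<close> of the blocks and of \<open>r\<close>.\<close>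

lemma rel_entropy_blocks:
  assumes n: "0 < n" and A: "A \<in> carrier_mat (N * n) (N * n)" and B: "B \<in> carrier_mat (N * n) (N * n)"
    and embA: "emb A = (\<Sum>k<N. block n k (W k))" and embB: "emb B = (\<Sum>k<N. block n k (c *\<^sub>R r))"
    and W: "\<And>k. k < N \<Longrightarrow> pos (W k)" "\<And>k. k < N \<Longrightarrow> bounded_by n (W k)" "r = (\<Sum>k<N. W k)"
    and c: "0 < c"
  shows "rel_entropy A B = ereal (((\<Sum>k<N. tr_xlnx n (W k)) - tr_xlnx n r - ln c * tr r) / ln 2)"
proof -
  have r: "pos r" "bounded_by n r" unfolding W(3) using W by (auto intro: pos_sum bounded_by_sum)
  have rW: "pos (r - W k)" if "k < N" for k
    using pos_diff_sum_subset[of "{..<N}" "{k}" W] that W by auto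
  have supp: "A *\<^sub>v v = 0\<^sub>v (dim_row A)" if v: "v \<in> carrier_vec (dim_row B)" "B *\<^sub>v v = 0\<^sub>v (dim_row B)" for v
  proof -
    \<comment> \<open>The vector becomes a one-column matrix, so that it can be embedded into
      \<open>fmat\<close>.\<close>
    define V where "V = mat (N * n) 1 (\<lambda>(i, _). v $ i)"
    have colV: "col V 0 = v" using v B by (auto simp: V_def)
    have ent: "entry (emb M * emb V) i j = (if i < N * n \<and> j = 0 then (M *\<^sub>v v) $ i else 0)"
      if "M \<in> carrier_mat (N * n) (N * n)" for M i j
    proof -
      have "emb M * emb V = emb (M * V)" using that by (simp add: emb_mult V_def)
      then show ?thesis using that colV by (auto simp: entry_emb V_def)
    qed
    have Bz: "emb B * emb V = 0"
      by (rule fmat_eqI) (use v B in \<open>auto simp: ent[OF B] entry_zero\<close>)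
    have Wz: "W k * (star (incl n k) * emb V) = 0" if k: "k < N" for k
    proof (rule pos_le_kernel[OF W(1)[OF k] rW[OF k]])
      have "star (incl n k) * emb B = (\<Sum>l<N. if l = k then c *\<^sub>R (r * star (incl n k)) else 0)"
        unfolding embB sum_distrib_left
      proof (rule sum.cong[OF refl])
        fix l
        have "star (incl n k) * block n l (c *\<^sub>R r) = c *\<^sub>R ((star (incl n k) * incl n l) * r * star (incl n l))"
          by (simp add: block_def mult.assoc)
        then show "star (incl n k) * block n l (c *\<^sub>R r) = (if l = k then c *\<^sub>R (r * star (incl n k)) else 0)"
          using r(2) by (auto simp: star_incl_incl)
      qed
      then have "star (incl n k) * emb B = c *\<^sub>R (r * star (incl n k))" using k by simp
      then have "c *\<^sub>R (r * star (incl n k) * emb V) = star (incl n k) * (emb B * emb V)"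
        by (metis mult.assoc mult_scaleR_left)
      then show "r * (star (incl n k) * emb V) = 0" using Bz c by (simp add: mult.assoc)
    qed
    have "emb A * emb V = (\<Sum>k<N. incl n k * (W k * (star (incl n k) * emb V)))"
      by (simp add: embA sum_distrib_right block_def mult.assoc)
    also have "\<dots> = 0" using Wz by simp
    finally have "entry (emb A * emb V) i 0 = 0" for i by (simp add: entry_zero)
    then have "(A *\<^sub>v v) $ i = 0" if "i < N * n" for i using that by (metis ent[OF A])
    then show ?thesis using A by (intro eq_vecI) (auto simp del: index_mult_mat_vec)
  qed
  define l where "l x = (if x = 0 then 0 else log 2 x)" for x :: real
  have "\<forall>k<N. \<exists>(J :: real set) F. resolution n J F \<and> W k = (\<Sum>r\<in>J. r *\<^sub>R F r) \<and> (\<forall>r\<in>J. F r \<noteq> 0) \<and> (\<forall>r\<in>J. 0 \<le> r)"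
    using pos_spectral W by blast
  then obtain J :: "nat \<Rightarrow> real set" and F where F: "\<And>k. k < N \<Longrightarrow> resolution n (J k) (F k)"
    "\<And>k. k < N \<Longrightarrow> W k = (\<Sum>r\<in>J k. r *\<^sub>R F k r)" "\<And>k r. k < N \<Longrightarrow> r \<in> J k \<Longrightarrow> F k r \<noteq> 0"
    "\<And>k r. k < N \<Longrightarrow> r \<in> J k \<Longrightarrow> 0 \<le> r" by metis
  obtain I :: "real set" and E where E: "resolution n I E" "r = (\<Sum>i\<in>I. i *\<^sub>R E i)" "\<And>i. i \<in> I \<Longrightarrow> E i \<noteq> 0"
    "\<And>i. i \<in> I \<Longrightarrow> 0 \<le> i" using pos_spectral[OF r] by blast
  have finJ: "finite (J k)" if "k < N" for k using resolutionD(1)[OF F(1)[OF that]] .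
  have finI: "finite I" using resolutionD(1)[OF E(1)] .

  have logA: "mlog2 A \<in> carrier_mat (N * n) (N * n)" "emb (mlog2 A) = (\<Sum>k<N. block n k (\<Sum>r\<in>J k. l r *\<^sub>R F k r))"
  proof -
    have "mfun l A \<in> carrier_mat (N * n) (N * n) \<and>
        emb (mfun l A) = (\<Sum>j\<in>(SIGMA k:{..<N}. J k). l (snd j) *\<^sub>R (\<lambda>(k, j). block n k (F k j)) j)"
    proof (rule emb_mfun[OF A resolution_blocks[OF n F(1)]])
      show "(\<lambda>(k, j). block n k (F k j)) j \<noteq> 0" if "j \<in> (SIGMA k:{..<N}. J k)" for j
        using that block_nonzero[OF resolution_bounded_by[OF F(1)] F(3)] by auto
      show "emb A = (\<Sum>j\<in>(SIGMA k:{..<N}. J k). snd j *\<^sub>R (\<lambda>(k, j). block n k (F k j)) j)"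
        unfolding embA using finJ by (simp add: F(2) block_sum sum.Sigma split_def)
    qed auto
    then show "mlog2 A \<in> carrier_mat (N * n) (N * n)" "emb (mlog2 A) = (\<Sum>k<N. block n k (\<Sum>r\<in>J k. l r *\<^sub>R F k r))"
      unfolding mlog2_def l_def[symmetric] using finJ by (simp_all add: block_sum sum.Sigma split_def)
  qed
  have logB: "mlog2 B \<in> carrier_mat (N * n) (N * n)" "emb (mlog2 B) = (\<Sum>k<N. block n k (\<Sum>i\<in>I. l (c * i) *\<^sub>R E i))"
  proof -
    have "mfun l B \<in> carrier_mat (N * n) (N * n) \<and>
        emb (mfun l B) = (\<Sum>j\<in>(SIGMA k:{..<N}. I). l (c * snd j) *\<^sub>R (\<lambda>(k, j). block n k (E j)) j)"
    proof (rule emb_mfun[OF B resolution_blocks[OF n E(1)]])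
      show "(\<lambda>(k, j). block n k (E j)) j \<noteq> 0" if "j \<in> (SIGMA k:{..<N}. I)" for j
        using that block_nonzero[OF resolution_bounded_by[OF E(1)] E(3)] by auto
      show "emb B = (\<Sum>j\<in>(SIGMA k:{..<N}. I). (c * snd j) *\<^sub>R (\<lambda>(k, j). block n k (E j)) j)"
        unfolding embB using finI by (simp add: E(2) block_sum scaleR_sum_right sum.Sigma split_def)
    qed
    then show "mlog2 B \<in> carrier_mat (N * n) (N * n)" "emb (mlog2 B) = (\<Sum>k<N. block n k (\<Sum>i\<in>I. l (c * i) *\<^sub>R E i))"
      unfolding mlog2_def l_def[symmetric] using finI by (simp_all add: block_sum sum.Sigma split_def)
  qed
  have trblocks: "tr (emb A * (\<Sum>k<N. block n k (Y k))) = (\<Sum>k<N. tr (W k * Y k))"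
    if Y: "\<And>k. k < N \<Longrightarrow> bounded_by n (Y k)" for Y
  proof -
    have "emb A * (\<Sum>k<N. block n k (Y k)) = (\<Sum>k<N. \<Sum>l<N. if l = k then block n k (W k * Y k) else 0)"
      unfolding embA sum_product by (intro sum.cong refl) (use block_mult[OF W(2)] in auto)
    also have "\<dots> = (\<Sum>k<N. block n k (W k * Y k))" by simp
    finally show ?thesis using tr_block bounded_by_mult W(2) Y by simp
  qed
  have xl: "x * l x = x * ln x / ln 2" for x by (simp add: l_def log_def)
  have "tr (emb A * emb (mlog2 A)) = (\<Sum>k<N. tr (W k * (\<Sum>r\<in>J k. l r *\<^sub>R F k r)))"
    unfolding logA(2) by (rule trblocks) (use F(1) resolution_fun_bounded_by in blast)
  also have "\<dots> = (\<Sum>k<N. tr_xlnx n (W k) / ln 2)"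
  proof (rule sum.cong[OF refl])
    fix k assume "k \<in> {..<N}"
    then have k: "k < N" by simp
    have "W k * (\<Sum>r\<in>J k. l r *\<^sub>R F k r) = (\<Sum>r\<in>J k. (r * l r) *\<^sub>R F k r)"
      using resolution_fun_mult[OF F(1)[OF k], of "\<lambda>r. r" l] F(2)[OF k] by simp
    then show "tr (W k * (\<Sum>r\<in>J k. l r *\<^sub>R F k r)) = tr_xlnx n (W k) / ln 2"
      using tr_xlnx_eq[OF F(2)[OF k] F(1)[OF k] F(4)[OF k]] by (simp add: xl sum_divide_distrib)
  qed
  finally have tA: "tr (emb A * emb (mlog2 A)) = (\<Sum>k<N. tr_xlnx n (W k)) / ln 2"
    by (simp add: sum_divide_distrib)
  have "tr (emb A * emb (mlog2 B)) = (\<Sum>k<N. tr (W k * (\<Sum>i\<in>I. l (c * i) *\<^sub>R E i)))"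
    unfolding logB(2) by (rule trblocks) (rule resolution_fun_bounded_by[OF E(1)])
  also have "\<dots> = tr (r * (\<Sum>i\<in>I. l (c * i) *\<^sub>R E i))"
    unfolding W(3) sum_distrib_right by simp
  also have "r * (\<Sum>i\<in>I. l (c * i) *\<^sub>R E i) = (\<Sum>i\<in>I. (i * l (c * i)) *\<^sub>R E i)"
    using resolution_fun_mult[OF E(1), of "\<lambda>r. r" "\<lambda>i. l (c * i)"] E(2) by simp
  also have "tr \<dots> = (\<Sum>i\<in>I. (i * ln i * tr (E i) + ln c * (i * tr (E i))) / ln 2)"
    unfolding tr_sum
  proof (rule sum.cong[OF refl])
    fix i assume "i \<in> I"
    then show "tr ((i * l (c * i)) *\<^sub>R E i) = (i * ln i * tr (E i) + ln c * (i * tr (E i))) / ln 2"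
      using E(4)[of i] c by (cases "i = 0") (auto simp: l_def log_def ln_mult field_simps)
  qed
  also have "\<dots> = (tr_xlnx n r + ln c * tr r) / ln 2"
    using tr_xlnx_eq[OF E(2,1,4)] E(2)[THEN arg_cong[of _ _ tr]]
    unfolding sum_divide_distrib[symmetric] sum.distrib sum_distrib_left[symmetric] by simp
  finally have tB: "tr (emb A * emb (mlog2 B)) = (tr_xlnx n r + ln c * tr r) / ln 2" .
  have "Re (mtrace (A * (mlog2 A - mlog2 B))) = tr (emb (A * (mlog2 A - mlog2 B)))"
    using A logA(1) logB(1) by (subst tr_emb[of _ "N * n"]) auto
  also have "emb (A * (mlog2 A - mlog2 B)) = emb A * (emb (mlog2 A) - emb (mlog2 B))"
    using A logA(1) logB(1) by (subst emb_mult) (auto simp: emb_minus)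
  also have "tr \<dots> = ((\<Sum>k<N. tr_xlnx n (W k)) - tr_xlnx n r - ln c * tr r) / ln 2"
    by (simp add: right_diff_distrib tA tB diff_divide_distrib add_divide_distrib)
  finally show ?thesis unfolding rel_entropy_def using supp by simp
qed

section \<open>The theorem\<close>

lemma rank_pos:
  fixes A :: "complex mat"
  assumes A: "A \<in> carrier_mat n n" "A \<noteq> 0\<^sub>m n n"
  shows "1 \<le> vec_space.rank n A"
proof -
  interpret vec_space "TYPE(complex)" n .
  obtain i j where ij: "i < n" "j < n" "A $$ (i, j) \<noteq> 0"
    using A by (metis carrier_matD eq_matI index_zero_mat)
  define v where "v = col A j"
  have v: "v \<in> set (cols A)" "v \<in> carrier_vec n" "v $ i \<noteq> 0"
    using A ij by (auto simp: v_def cols_def)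
  have "lin_indpt {v}"
  proof
    assume "lin_dep {v}"
    then obtain B a w where B: "finite B" "B \<subseteq> {v}" "lincomb a B = 0\<^sub>v n" "w \<in> B" "a w \<noteq> 0"
      unfolding lin_dep_def by auto
    then have "B = {v}" "w = v" by auto
    then have "a v \<cdot>\<^sub>v v = 0\<^sub>v n" using B v lincomb_def[of a "{v}"] by simp
    then have "(a v \<cdot>\<^sub>v v) $ i = 0" using ij by simp
    then show False using B v ij \<open>w = v\<close> by simp
  qed
  then show ?thesis using rank_ge_card_indpt[OF A(1), of "{v}"] v by simp
qed

lemma emb_ptrace1:
  assumes A: "A \<in> carrier_mat (m * n) (m * n)" and n: "0 < n"
    and emb: "emb A = (\<Sum>x<m. block n x (\<sigma> x))" and \<sigma>: "\<And>x. x < m \<Longrightarrow> bounded_by n (\<sigma> x)"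
  shows "emb (ptrace1 m n A) = (\<Sum>x<m. \<sigma> x)"
proof (rule fmat_eqI)
  fix i j
  show "entry (emb (ptrace1 m n A)) i j = entry (\<Sum>x<m. \<sigma> x) i j"
  proof (cases "i < n \<and> j < n")
    case True
    have "A $$ (k * n + i, k * n + j) = entry (\<sigma> k) i j" if k: "k < m" for k
    proof -
      have "k * n + l < m * n" if "l < n" for l
      proof -
        have "k * n + l < (k + 1) * n" using that by simp
        also have "\<dots> \<le> m * n" using k by (intro mult_right_mono) auto
        finally show ?thesis .
      qed
      then have "A $$ (k * n + i, k * n + j) = entry (emb A) (k * n + i) (k * n + j)"
        using A True by (simp add: entry_emb)
      also have "\<dots> = (\<Sum>x<m. if x = k then entry (\<sigma> k) i j else 0)"
        unfolding emb entry_sum by (rule sum.cong) (use True in \<open>auto simp: entry_block[OF n]\<close>)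
      finally show ?thesis using k by simp
    qed
    then show ?thesis using True by (simp add: entry_emb ptrace1_def entry_sum)
  next
    case False
    then have "entry (\<sigma> x) i j = 0" if "x < m" for x using bounded_byD[OF \<sigma>[OF that]] by force
    then show ?thesis using False by (auto simp: entry_emb ptrace1_def entry_sum)
  qed
qed

text \<open>The last claim becomes the hypothesis \<open>dom\<close> of
  \<open>universal_hash_xlnx\<close>: on the range of the projection the eigenvalues of
  \<open>- Y\<close> are nonnegative.\<close>

lemma emb_nonpos_proj:
  assumes Y: "Y \<in> carrier_mat n n" "star (emb Y) = emb Y"
  defines "P \<equiv> emb (nonpos_proj Y)"
  shows "nonpos_proj Y \<in> carrier_mat n n" "bounded_by n P" "star P = P" "P * P = P"
    "pos (P * (- emb Y) * P)"
proof -
  obtain J :: "real set" and F where F: "resolution n J F" "emb Y = (\<Sum>r\<in>J. r *\<^sub>R F r)" "\<And>r. r \<in> J \<Longrightarrow> F r \<noteq> 0"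
    using spectral_theorem[OF bounded_by_emb[OF Y(1)] Y(2)] by blast
  define h where "h r = (if r \<le> 0 then 1 else 0 :: real)" for r :: real
  have P: "nonpos_proj Y \<in> carrier_mat n n" "P = (\<Sum>r\<in>J. h r *\<^sub>R F r)"
    using emb_mfun[OF Y(1) F(1,3,2), of h] unfolding nonpos_proj_def P_def h_def by auto
  show "nonpos_proj Y \<in> carrier_mat n n" by fact
  show "bounded_by n P" unfolding P(2) by (rule resolution_fun_bounded_by[OF F(1)])
  show "star P = P" unfolding P(2) by (rule resolution_fun_star[OF F(1)])
  show "P * P = P" unfolding P(2) resolution_fun_mult[OF F(1)] by (rule sum.cong) (auto simp: h_def)
  have "- emb Y = (\<Sum>r\<in>J. (- r) *\<^sub>R F r)" by (simp add: F(2) sum_negf)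
  then have "P * (- emb Y) * P = (\<Sum>r\<in>J. (h r * (- r) * h r) *\<^sub>R F r)"
    unfolding P(2) by (simp only: resolution_fun_mult[OF F(1)])
  also have "pos \<dots>"
    by (intro pos_sum pos_scaleR resolution_pos[OF F(1)]) (auto simp: h_def)
  finally show "pos (P * (- emb Y) * P)" .
qed

lemma sum_nat_pairs: "(\<Sum>k<a * b. f k) = (\<Sum>s<a. \<Sum>i<b. f (s * b + i))" for f :: "nat \<Rightarrow> 'a :: comm_monoid_add"
proof (induction a)
  case (Suc a)
  have "(\<Sum>k<a * b + b. f k) = (\<Sum>k<a * b. f k) + (\<Sum>k=a * b..<a * b + b. f k)"
    by (simp add: lessThan_atLeast0 sum.atLeastLessThan_concat)
  also have "(\<Sum>k=a * b..<a * b + b. f k) = (\<Sum>i<b. f (a * b + i))"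
    using sum.shift_bounds_nat_ivl[of f 0 "a * b" b] by (simp add: lessThan_atLeast0 add.commute)
  finally show ?case using Suc by (simp add: add.commute)
qed simp

lemma sum_list_upt: "sum_list (map f [0..<k]) = (\<Sum>i<k. f i)" for f :: "nat \<Rightarrow> 'a :: comm_monoid_add"
  by (simp add: interv_sum_list_conv_sum_set_nat lessThan_atLeast0)

text \<open>The supremum need not be attained. The bound is monotone in \<open>l\<close>, so it
  holds at every real \<open>y\<close> below the supremum, and continuity carries it to a finite
  supremum; at infinity the exponential term disappears.\<close>

lemma bound_at_Sup:
  fixes \<Lambda> :: "real set" and C D s :: real and \<delta> :: ereal
  assumes bound: "\<And>l. l \<in> \<Lambda> \<Longrightarrow> D \<le> C + s * 2 powr (- l)" and s: "0 \<le> s"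
    and \<delta>: "\<delta> = (case Sup (ereal ` \<Lambda>) of ereal r \<Rightarrow> ereal (s * 2 powr (- r)) | PInfty \<Rightarrow> 0 | MInfty \<Rightarrow> \<infinity>)"
  shows "ereal D \<le> ereal C + \<delta>"
proof -
  have below: "D \<le> C + s * 2 powr (- y)" if y: "ereal y < Sup (ereal ` \<Lambda>)" for y
  proof -
    obtain l where l: "l \<in> \<Lambda>" "y < l" using y unfolding less_Sup_iff by auto
    have "s * 2 powr (- l) \<le> s * 2 powr (- y)" using l s by (intro mult_left_mono) auto
    then show ?thesis using bound[OF l(1)] by linarith
  qed
  show ?thesis
  proof (cases "Sup (ereal ` \<Lambda>)")
    case (real r)
    have "((\<lambda>y. C + s * 2 powr (- y)) \<longlongrightarrow> C + s * 2 powr (- r)) (at_left r)"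
      by (intro tendsto_intros) auto
    then have "D \<le> C + s * 2 powr (- r)"
      by (rule tendsto_lowerbound) (use below real in \<open>auto simp: eventually_at_left_field intro!: exI[of _ "r - 1"]\<close>)
    then show ?thesis using \<delta> real by simp
  next
    case PInf
    have "((\<lambda>y. C + s * 2 powr (- y)) \<longlongrightarrow> C) at_top" by real_asymp
    then have "D \<le> C" by (rule tendsto_lowerbound) (use below PInf in auto)
    then show ?thesis using \<delta> PInf by simp
  next
    case MInf
    then show ?thesis using \<delta> by simp
  qed
qed

lemma eta0_nonneg: "0 \<le> x \<Longrightarrow> 0 \<le> eta0 x"
proof -
  assume x: "0 \<le> x"
  have "log 2 x \<le> 0" if "x \<le> 1/2"
    using that x by (cases "x = 0") (auto simp: log_def divide_le_0_iff)
  then show ?thesis using x by (auto simp: eta0_def mult_nonneg_nonpos)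
qed

lemma sum_ketbra_kron:
  assumes R: "\<And>x. x < m \<Longrightarrow> R x \<in> carrier_mat n n" and n: "0 < n"
  shows "msum (m * n) [0..<m] (\<lambda>x. complex_of_real (p x) \<cdot>\<^sub>m kron (ketbra m x) (R x)) \<in> carrier_mat (m * n) (m * n)"
    "emb (msum (m * n) [0..<m] (\<lambda>x. complex_of_real (p x) \<cdot>\<^sub>m kron (ketbra m x) (R x)))
      = (\<Sum>x<m. block n x (p x *\<^sub>R emb (R x)))"
proof -
  have c: "kron (ketbra m x) (R x) \<in> carrier_mat (m * n) (m * n)" if "x < m" for x
    using R[OF that] by (intro kron_carrier) (auto simp: ketbra_def)
  have k: "emb (kron (ketbra m x) (R x)) = block n x (emb (R x))" if "x < m" for x
  proof -
    have "complex_of_real 1 \<cdot>\<^sub>m ketbra m x = ketbra m x" by (rule eq_matI) auto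
    then show ?thesis using emb_kron_ketbra[OF R[OF that] n that, of 1] by simp
  qed
  note s = emb_msum[of "[0..<m]" "\<lambda>x. complex_of_real (p x) \<cdot>\<^sub>m kron (ketbra m x) (R x)" "m * n"]
  show "msum (m * n) [0..<m] (\<lambda>x. complex_of_real (p x) \<cdot>\<^sub>m kron (ketbra m x) (R x)) \<in> carrier_mat (m * n) (m * n)"
    using s c by simp
  have "emb (msum (m * n) [0..<m] (\<lambda>x. complex_of_real (p x) \<cdot>\<^sub>m kron (ketbra m x) (R x)))
      = (\<Sum>x<m. emb (complex_of_real (p x) \<cdot>\<^sub>m kron (ketbra m x) (R x)))"
    using s c by (simp add: sum_list_upt)
  also have "\<dots> = (\<Sum>x<m. block n x (p x *\<^sub>R emb (R x)))" by (rule sum.cong) (auto simp: emb_smult k)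
  finally show "emb (msum (m * n) [0..<m] (\<lambda>x. complex_of_real (p x) \<cdot>\<^sub>m kron (ketbra m x) (R x)))
      = (\<Sum>x<m. block n x (p x *\<^sub>R emb (R x)))" .
qed

theorem theorem1:
  fixes nX nS n :: nat and p :: "nat \<Rightarrow> real" and rho :: "nat \<Rightarrow> complex mat"
    and Gs :: "(nat \<Rightarrow> nat) list" and eps :: real
    and rhoXB rhoB rho2 rhoSGB sigmaSGB :: "complex mat"
    and psg :: "nat \<Rightarrow> (nat \<Rightarrow> nat) \<Rightarrow> real" and rhosg :: "nat \<Rightarrow> (nat \<Rightarrow> nat) \<Rightarrow> complex mat"
    and nG d :: nat and R delta :: ereal
  assumes p_nonneg: "\<forall>x<nX. 0 \<le> p x"
    and p_sum: "(\<Sum>x<nX. p x) = 1"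
    and rho_states: "\<forall>x<nX. density n (rho x)"
    and Gs_nonempty: "Gs \<noteq> []"
    and Gs_distinct: "distinct Gs"
    and Gs_funs: "\<forall>g \<in> set Gs. g \<in> {..<nX} \<rightarrow>\<^sub>E {..<nS}"
    and two_univ: "two_universal nX nS Gs"
    and eps_nonneg: "0 \<le> eps"
    and rhoXB_def: "rhoXB = msum (nX * n) [0..<nX]
                      (\<lambda>x. complex_of_real (p x) \<cdot>\<^sub>m kron (ketbra nX x) (rho x))"
    and rhoB_def: "rhoB = msum n [0..<nX] (\<lambda>x. complex_of_real (p x) \<cdot>\<^sub>m rho x)"
    and rho2_def: "rho2 = ptrace1 nX n (rhoXB * rhoXB)"
    and nG_def: "nG = length Gs"
    and psg_def: "psg = (\<lambda>s g. \<Sum>x \<in> {x. x < nX \<and> g x = s}. p x)"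
    and rhosg_def: "rhosg = (\<lambda>s g. complex_of_real (1 / psg s g) \<cdot>\<^sub>m
                      msum n (filter (\<lambda>x. g x = s) [0..<nX]) (\<lambda>x. complex_of_real (p x) \<cdot>\<^sub>m rho x))"
    and rhoSGB_def: "rhoSGB = msum (nS * nG * n) [0..<nS] (\<lambda>s. msum (nS * nG * n) [0..<nG] (\<lambda>i.
                      kron (complex_of_real (psg s (Gs ! i)) \<cdot>\<^sub>m ketbra nS s)
                        (kron (complex_of_real (1 / real nG) \<cdot>\<^sub>m ketbra nG i) (rhosg s (Gs ! i)))))"
    and sigmaSGB_def: "sigmaSGB = kron (complex_of_real (1 / real nS) \<cdot>\<^sub>m 1\<^sub>m nS)
                      (kron (complex_of_real (1 / real nG) \<cdot>\<^sub>m 1\<^sub>m nG) rhoB)"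
    and d_def: "d = vec_space.rank n rhoB"
    and R_def: "R = R_coll eps rho2 rhoB"
    and delta_def: "delta = (case R of ereal r \<Rightarrow> ereal (real nS * 2 powr (- r))
                              | PInfty \<Rightarrow> 0 | MInfty \<Rightarrow> \<infinity>)"
  shows "rel_entropy rhoSGB sigmaSGB
           \<le> ereal (eps * log 2 (real d * real nS) + eta0 eps)
             + (delta + ereal (eps + sqrt eps)) / ereal (ln 2)"
proof -
  have nX: "0 < nX" using p_sum by (cases nX) auto
  have rho: "rho x \<in> carrier_mat n n" "pos (emb (rho x))" "tr (emb (rho x)) = 1" if "x < nX" for x
  proof -
    have d: "psd n (rho x)" "mtrace (rho x) = 1" using rho_states that by (auto simp: density_def)
    then show "rho x \<in> carrier_mat n n" "pos (emb (rho x))" by (auto simp: psd_def pos_emb)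
    then show "tr (emb (rho x)) = 1" using d tr_emb[of "rho x" n] by simp
  qed
  have n: "0 < n"
  proof (rule ccontr)
    assume "\<not> 0 < n"
    then have "emb (rho 0) = 0" using rho(1)[OF nX] by (intro fmat_eqI) (auto simp: entry_emb entry_zero)
    then show False using rho(3)[OF nX] by simp
  qed
  have maps: "g x \<in> {..<nS}" if "g \<in> set Gs" "x \<in> {..<nX}" for g x
    using Gs_funs that by (auto simp: PiE_iff)
  have nS: "0 < nS" using maps[of "hd Gs" 0] nX Gs_nonempty by fastforce
  have nG: "0 < nG" using Gs_nonempty by (simp add: nG_def)
  have nGn: "0 < nG * n" using nG n by simp

  define \<sigma> where "\<sigma> x = p x *\<^sub>R emb (rho x)" for x
  define r where "r = (\<Sum>x<nX. \<sigma> x)"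
  define \<omega> where "\<omega> g s = (\<Sum>x | x \<in> {..<nX} \<and> g x = s. \<sigma> x)" for g :: "nat \<Rightarrow> nat" and s
  \<comment> \<open>The block index is \<open>k = s * nG + i\<close>, with the hash function running
    fastest, as in the order of the Kronecker factors.\<close>
  define W where "W k = (1 / real nG) *\<^sub>R \<omega> (Gs ! (k mod nG)) (k div nG)" for k
  have \<sigma>: "pos (\<sigma> x)" "bounded_by n (\<sigma> x)" if "x < nX" for x
    using rho[OF that] p_nonneg that by (auto simp: \<sigma>_def intro: pos_scaleR bounded_by_scaleR bounded_by_emb)
  have p\<omega>: "pos (\<omega> g s)" and b\<omega>: "bounded_by n (\<omega> g s)" for g s
    unfolding \<omega>_def using \<sigma> by (auto intro: pos_sum bounded_by_sum)
  have sum\<omega>: "(\<Sum>s<nS. \<omega> g s) = r" if "g \<in> set Gs" for g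
  proof -
    have "(\<Sum>s<nS. \<omega> g s) = (\<Sum>s<nS. \<Sum>x<nX. if g x = s then \<sigma> x else 0)"
      unfolding \<omega>_def by (intro sum.cong refl sum.inter_filter) simp
    also have "\<dots> = r" by (subst sum.swap) (use maps[OF that] in \<open>simp add: r_def\<close>)
    finally show ?thesis .
  qed
  have tr_r: "tr r = 1" using p_sum rho(3) by (simp add: r_def \<sigma>_def)

  have rhoB: "rhoB \<in> carrier_mat n n" "emb rhoB = r"
    using emb_msum[of "[0..<nX]" "\<lambda>x. complex_of_real (p x) \<cdot>\<^sub>m rho x" n] rho(1)
    by (simp_all add: rhoB_def r_def \<sigma>_def sum_list_upt emb_smult)
  have rhoXB: "rhoXB \<in> carrier_mat (nX * n) (nX * n)" "emb rhoXB = (\<Sum>x<nX. block n x (\<sigma> x))"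
    using sum_ketbra_kron[of nX rho n p] rho(1) n by (simp_all add: rhoXB_def \<sigma>_def)
  have rho2: "rho2 \<in> carrier_mat n n" "emb rho2 = (\<Sum>x<nX. \<sigma> x * \<sigma> x)"
  proof -
    show "rho2 \<in> carrier_mat n n" by (simp add: rho2_def ptrace1_def)
    have "emb (rhoXB * rhoXB) = (\<Sum>x<nX. \<Sum>y<nX. block n x (\<sigma> x) * block n y (\<sigma> y))"
      using rhoXB by (simp add: emb_mult sum_product)
    also have "\<dots> = (\<Sum>x<nX. \<Sum>y<nX. if y = x then block n x (\<sigma> x * \<sigma> x) else 0)"
      by (intro sum.cong refl) (use block_mult \<sigma> in auto)
    also have "\<dots> = (\<Sum>x<nX. block n x (\<sigma> x * \<sigma> x))" by simp
    finally show "emb rho2 = (\<Sum>x<nX. \<sigma> x * \<sigma> x)"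
      unfolding rho2_def using rhoXB(1) n \<sigma>(2) by (intro emb_ptrace1) (auto intro: bounded_by_mult)
  qed

  have rhosg: "rhosg s g \<in> carrier_mat n n" "psg s g *\<^sub>R emb (rhosg s g) = \<omega> g s" for s g
  proof -
    let ?xs = "filter (\<lambda>x. g x = s) [0..<nX]"
    have m: "msum n ?xs (\<lambda>x. complex_of_real (p x) \<cdot>\<^sub>m rho x) \<in> carrier_mat n n"
      "emb (msum n ?xs (\<lambda>x. complex_of_real (p x) \<cdot>\<^sub>m rho x)) = (\<Sum>x\<leftarrow>?xs. \<sigma> x)"
      using emb_msum[of ?xs "\<lambda>x. complex_of_real (p x) \<cdot>\<^sub>m rho x" n] rho(1)
      by (simp_all add: \<sigma>_def emb_smult)
    show "rhosg s g \<in> carrier_mat n n" using m by (simp add: rhosg_def)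
    have "(\<Sum>x\<leftarrow>?xs. \<sigma> x) = \<omega> g s"
      by (subst sum_list_distinct_conv_sum_set) (auto simp: \<omega>_def)
    then have e: "emb (rhosg s g) = (1 / psg s g) *\<^sub>R \<omega> g s" unfolding rhosg_def emb_smult using m by simp
    show "psg s g *\<^sub>R emb (rhosg s g) = \<omega> g s"
    proof (cases "psg s g = 0")
      \<comment> \<open>Here \<open>rhosg s g\<close> is 0 because \<open>1 / 0 = 0\<close>. A hash
        value of probability 0 has only preimages of probability 0, so the block
        \<open>\<omega> g s\<close> vanishes as well.\<close>
      case True
      then have "p x = 0" if "x < nX" "g x = s" for x
        using that p_nonneg unfolding psg_def by (subst (asm) sum_nonneg_eq_0_iff) auto
      then have "\<omega> g s = 0" unfolding \<omega>_def by (intro sum.neutral) (auto simp: \<sigma>_def)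
      then show ?thesis using e by simp
    qed (simp add: e)
  qed

  have rhoSGB: "rhoSGB \<in> carrier_mat (nS * nG * n) (nS * nG * n)"
    "emb rhoSGB = (\<Sum>k<nS * nG. block n k (W k))"
  proof -
    define T where "T s i = kron (complex_of_real (psg s (Gs ! i)) \<cdot>\<^sub>m ketbra nS s)
      (kron (complex_of_real (1 / real nG) \<cdot>\<^sub>m ketbra nG i) (rhosg s (Gs ! i)))" for s i
    have Tc: "T s i \<in> carrier_mat (nS * nG * n) (nS * nG * n)" for s i
      unfolding T_def mult.assoc by (intro kron_carrier rhosg(1)) (auto simp: ketbra_def)
    have Te: "emb (T s i) = block n (s * nG + i) (W (s * nG + i))" if "s < nS" "i < nG" for s i
    proof -
      have c: "kron (complex_of_real (1 / real nG) \<cdot>\<^sub>m ketbra nG i) (rhosg s (Gs ! i)) \<in> carrier_mat (nG * n) (nG * n)"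
        by (intro kron_carrier rhosg(1)) (auto simp: ketbra_def)
      have "emb (T s i) = psg s (Gs ! i) *\<^sub>R block (nG * n) s ((1 / real nG) *\<^sub>R block n i (emb (rhosg s (Gs ! i))))"
        unfolding T_def emb_kron_ketbra[OF c nGn that(1)] emb_kron_ketbra[OF rhosg(1) n that(2)] ..
      also have "\<dots> = block n (s * nG + i) ((1 / real nG) *\<^sub>R (psg s (Gs ! i) *\<^sub>R emb (rhosg s (Gs ! i))))"
        using that by (simp add: block_block)
      finally show ?thesis using that by (simp add: rhosg(2) W_def)
    qed
    have in1: "msum (nS * nG * n) [0..<nG] (T s) \<in> carrier_mat (nS * nG * n) (nS * nG * n)"
      "emb (msum (nS * nG * n) [0..<nG] (T s)) = (\<Sum>i<nG. emb (T s i))" for s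
      using emb_msum[of "[0..<nG]" "T s"] Tc by (simp_all add: sum_list_upt)
    have "rhoSGB = msum (nS * nG * n) [0..<nS] (\<lambda>s. msum (nS * nG * n) [0..<nG] (T s))"
      unfolding rhoSGB_def T_def ..
    then have "rhoSGB \<in> carrier_mat (nS * nG * n) (nS * nG * n)" "emb rhoSGB = (\<Sum>s<nS. \<Sum>i<nG. emb (T s i))"
      using emb_msum[of "[0..<nS]" "\<lambda>s. msum (nS * nG * n) [0..<nG] (T s)" "nS * nG * n"] in1
      by (simp_all add: sum_list_upt)
    then show "rhoSGB \<in> carrier_mat (nS * nG * n) (nS * nG * n)" "emb rhoSGB = (\<Sum>k<nS * nG. block n k (W k))"
      by (simp_all add: sum_nat_pairs Te)
  qed

  have sigma: "sigmaSGB \<in> carrier_mat (nS * nG * n) (nS * nG * n)"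
    "emb sigmaSGB = (\<Sum>k<nS * nG. block n k ((1 / (real nS * real nG)) *\<^sub>R r))"
  proof -
    show "sigmaSGB \<in> carrier_mat (nS * nG * n) (nS * nG * n)"
      unfolding sigmaSGB_def mult.assoc by (intro kron_carrier rhoB(1)) auto
    have c: "kron (complex_of_real (1 / real nG) \<cdot>\<^sub>m 1\<^sub>m nG) rhoB \<in> carrier_mat (nG * n) (nG * n)"
      by (intro kron_carrier rhoB(1)) auto
    have "emb sigmaSGB = (1 / real nS) *\<^sub>R (\<Sum>s<nS. block (nG * n) s ((1 / real nG) *\<^sub>R (\<Sum>i<nG. block n i r)))"
      unfolding sigmaSGB_def emb_kron_one[OF c nGn] emb_kron_one[OF rhoB(1) n] rhoB(2) ..
    then show "emb sigmaSGB = (\<Sum>k<nS * nG. block n k ((1 / (real nS * real nG)) *\<^sub>R r))"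
      by (simp add: sum_nat_pairs block_sum block_block scaleR_sum_right)
  qed

  have sumG: "(\<Sum>i<nG. f (Gs ! i)) = (\<Sum>g\<in>set Gs. f g)" for f :: "(nat \<Rightarrow> nat) \<Rightarrow> 'z :: comm_monoid_add"
    using sum.reindex_bij_betw[OF bij_betw_nth[OF Gs_distinct refl refl], of f] by (simp add: nG_def)
  have cardG: "card (set Gs) = nG" using Gs_distinct by (simp add: nG_def distinct_card)
  have sumW: "(\<Sum>k<nS * nG. f (W k)) = (\<Sum>g\<in>set Gs. \<Sum>s<nS. f ((1 / real nG) *\<^sub>R \<omega> g s))"
    for f :: "fmat \<Rightarrow> 'z :: comm_monoid_add"
  proof -
    have "(\<Sum>k<nS * nG. f (W k)) = (\<Sum>s<nS. \<Sum>i<nG. f ((1 / real nG) *\<^sub>R \<omega> (Gs ! i) s))"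
      unfolding sum_nat_pairs by (intro sum.cong refl) (simp add: W_def)
    also have "\<dots> = (\<Sum>i<nG. \<Sum>s<nS. f ((1 / real nG) *\<^sub>R \<omega> (Gs ! i) s))" by (rule sum.swap)
    also have "\<dots> = (\<Sum>g\<in>set Gs. \<Sum>s<nS. f ((1 / real nG) *\<^sub>R \<omega> g s))" by (rule sumG)
    finally show ?thesis .
  qed
  \<comment> \<open>The relative entropy in nats. The register of the hash function contributes -ln
    \<open>nG\<close> through the scaling of the blocks and +ln \<open>nG\<close> through
    \<open>sigmaSGB\<close>.\<close>
  define T where "T = (\<Sum>g\<in>set Gs. \<Sum>s<nS. tr_xlnx n (\<omega> g s)) / real nG - tr_xlnx n r + ln (real nS)"
  have D: "rel_entropy rhoSGB sigmaSGB = ereal (T / ln 2)"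
  proof -
    have "r = (\<Sum>k<nS * nG. W k)"
      using sumW[of "\<lambda>x. x"] nG by (simp add: scaleR_sum_right[symmetric] sum\<omega> cardG scaleR_sum_left[symmetric])
        (simp add: scaleR_left.sum[symmetric] sum_constant_scaleR cardG)
    then have "rel_entropy rhoSGB sigmaSGB
        = ereal (((\<Sum>k<nS * nG. tr_xlnx n (W k)) - tr_xlnx n r - ln (1 / (real nS * real nG)) * tr r) / ln 2)"
      using n nS nG p\<omega> b\<omega> by (intro rel_entropy_blocks[OF n rhoSGB(1) sigma(1) rhoSGB(2) sigma(2)])
        (auto simp: W_def intro: pos_scaleR bounded_by_scaleR)
    moreover have "(\<Sum>k<nS * nG. tr_xlnx n (W k)) = (\<Sum>g\<in>set Gs. \<Sum>s<nS. tr_xlnx n (\<omega> g s)) / real nG - ln (real nG)"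
    proof -
      have "(\<Sum>k<nS * nG. tr_xlnx n (W k))
          = (\<Sum>g\<in>set Gs. \<Sum>s<nS. tr_xlnx n (\<omega> g s) / real nG + 1 / real nG * ln (1 / real nG) * tr (\<omega> g s))"
        unfolding sumW[of "tr_xlnx n"] by (intro sum.cong refl) (use nG tr_xlnx_scale[OF p\<omega> b\<omega>] in simp)
      also have "\<dots> = (\<Sum>g\<in>set Gs. \<Sum>s<nS. tr_xlnx n (\<omega> g s)) / real nG
          + 1 / real nG * ln (1 / real nG) * (\<Sum>g\<in>set Gs. tr (\<Sum>s<nS. \<omega> g s))"
        by (simp add: sum.distrib sum_divide_distrib sum_distrib_left)
      also have "(\<Sum>g\<in>set Gs. tr (\<Sum>s<nS. \<omega> g s)) = real nG"
        using sum\<omega> tr_r cardG by (simp del: tr_sum)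
      finally show ?thesis using nG by (simp add: ln_div)
    qed
    ultimately show ?thesis using nS nG by (simp add: T_def tr_r ln_div ln_mult)
  qed

  define \<Lambda> where "\<Lambda> = {lam. Re (mtrace (nonpos_proj (rho2 - complex_of_real (2 powr (- lam)) \<cdot>\<^sub>m (rhoB * rhoB)) * rhoB)) \<ge> 1 - eps}"
  have key: "T \<le> (eps * ln (real nS) + eps + sqrt eps) + real nS * 2 powr (- lam)" if lam: "lam \<in> \<Lambda>" for lam
  proof -
    define c where "c = 2 powr (- lam)"
    define Y where "Y = rho2 - complex_of_real c \<cdot>\<^sub>m (rhoB * rhoB)"
    define P where "P = emb (nonpos_proj Y)"
    have sr: "star r = r" unfolding r_def by (rule pos_star, rule pos_sum) (use \<sigma> in auto)
    have pr: "pos r" unfolding r_def by (rule pos_sum) (use \<sigma> in auto)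
    have br: "bounded_by n r" unfolding r_def by (rule bounded_by_sum) (use \<sigma> in auto)
    have Yc: "Y \<in> carrier_mat n n" unfolding Y_def by (intro minus_carrier_mat smult_carrier_mat mult_carrier_mat[of _ n n] rhoB)
    have embY: "emb Y = (\<Sum>x<nX. \<sigma> x * \<sigma> x) - c *\<^sub>R (r * r)"
      unfolding Y_def using rho2 rhoB by (simp add: emb_minus emb_smult emb_mult)
    have "star (emb Y) = emb Y" using pos_star[OF \<sigma>(1)] by (simp add: embY sr)
    note P = emb_nonpos_proj[OF Yc this, folded P_def]
    have "1 - eps \<le> tr (emb (nonpos_proj Y * rhoB))"
      using lam P(1) rhoB tr_emb[of "nonpos_proj Y * rhoB" n] by (simp add: \<Lambda>_def Y_def c_def)
    then have eps: "1 - tr (r * P) \<le> eps"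
      using P(1) rhoB tr_commute[of P r] by (simp add: emb_mult P_def)
    \<comment> \<open>The exact mass outside \<open>P\<close> lies in [0, 1], as
      \<open>binary_term_bound\<close> requires, whereas \<open>eps\<close> may exceed 1. The
      passage to \<open>eps\<close> is made afterwards by monotonicity.\<close>
    define \<epsilon> where "\<epsilon> = 1 - tr (r * P)"
    have \<epsilon>1: "\<epsilon> \<le> 1" using tr_pos_mult[OF pr, of P] pos_square[OF P(3)] by (simp add: \<epsilon>_def P(4))
    have "pos ((unit n - P) * (unit n - P))" by (rule pos_square) (simp add: P)
    then have "0 \<le> tr (r * (unit n - P))"
      using P by (intro tr_pos_mult[OF pr]) (simp add: left_diff_distrib right_diff_distrib bounded_by_unit)
    then have \<epsilon>0: "0 \<le> \<epsilon>" using br tr_r by (simp add: right_diff_distrib \<epsilon>_def)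
    have dom: "pos (P * (c *\<^sub>R (r * r) - (\<Sum>x<nX. \<sigma> x * \<sigma> x)) * P)" using P(5) by (simp add: embY)
    have univ: "real (card {g \<in> set Gs. g x = g y}) \<le> real (card (set Gs)) / real (card {..<nS})"
      if "x \<in> {..<nX}" "y \<in> {..<nX}" "x \<noteq> y" for x y
      using two_univ that nG nS unfolding two_universal_def by (auto simp: cardG field_simps)
    have "T \<le> (\<epsilon> * ln (real nS) + real nS * c) + (1 - \<epsilon>) * ln (1 + t) + \<epsilon> * ln (1 + 1 / t)" if t: "0 < t" for t
    proof -
      have "(\<Sum>g\<in>set Gs. \<Sum>s<nS. tr_xlnx n (\<Sum>x | x \<in> {..<nX} \<and> g x = s. \<sigma> x)) / real (card (set Gs))
          - tr_xlnx n r + ln (real (card {..<nS}))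
        \<le> \<epsilon> * ln (real (card {..<nS})) + (1 - \<epsilon>) * ln (1 + t) + \<epsilon> * ln (1 + 1 / t) + real (card {..<nS}) * c"
        by (rule universal_hash_xlnx[where P = P])
          (use nS Gs_nonempty \<sigma> tr_r maps univ P dom t in \<open>auto simp: r_def c_def \<epsilon>_def\<close>)
      then show ?thesis by (simp add: T_def \<omega>_def cardG)
    qed
    then have "T \<le> (\<epsilon> * ln (real nS) + real nS * c) + \<epsilon> + sqrt \<epsilon>" by (rule binary_term_bound[OF \<epsilon>0 \<epsilon>1])
    moreover have "\<epsilon> \<le> eps" using eps by (simp add: \<epsilon>_def)
    moreover from this have "sqrt \<epsilon> \<le> sqrt eps" "\<epsilon> * ln (real nS) \<le> eps * ln (real nS)"
      using nS by (auto intro: mult_right_mono)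
    ultimately show ?thesis unfolding c_def by linarith
  qed

  have R: "R = Sup (ereal ` \<Lambda>)" unfolding R_def R_coll_def \<Lambda>_def by (rule arg_cong[of _ _ Sup]) auto
  have bd: "ereal T \<le> ereal (eps * ln (real nS) + eps + sqrt eps) + delta"
    by (rule bound_at_Sup[OF key]) (auto simp: delta_def R)
  \<comment> \<open>A state is nonzero, so \<open>d\<close> is at least 1. Together with the sign of
    \<open>eta0\<close> this puts \<open>eps * ln (real nS) / ln 2\<close> below the first two terms
    of the claim.\<close>
  have "rhoB \<noteq> 0\<^sub>m n n" using rhoB(2) tr_r by (auto simp: emb_zero)
  then have "1 \<le> d" unfolding d_def by (rule rank_pos[OF rhoB(1)])
  then have "ln (real nS) \<le> ln (real d * real nS)" using nS by (simp add: ln_mult)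
  then have log: "eps * ln (real nS) / ln 2 \<le> eps * log 2 (real d * real nS) + eta0 eps"
    using eta0_nonneg[OF eps_nonneg] eps_nonneg by (auto simp: log_def divide_right_mono mult_left_mono intro: add_increasing2)
  show ?thesis
  proof (cases R)
    case (real x)
    then have dl: "delta = ereal (real nS * 2 powr (- x))" by (simp add: delta_def)
    then show ?thesis using bd log unfolding D by (simp add: field_simps)
  next
    case PInf
    then have dl: "delta = 0" by (simp add: delta_def)
    then show ?thesis using bd log unfolding D by (simp add: field_simps)
  next
    case MInf
    then have "delta = \<infinity>" by (simp add: delta_def)
    then show ?thesis by simp
  qed
qed

end
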